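(* Take $g=k=1$, and let $\mathbb H_{(n-1,1)}(z,w)\in\mathbb Q(z,w)$, $n\ge 1$, be the rational functions defined in the context. Then, as formal power series, $$1+\sum_{n\ge1}\mathbb H_{(n-1,1)}\big(e^{u/2},e^{-u/2}\big)T^n=\frac1u\big(e^{u/2}-e^{-u/2}\big)\exp\Big(2\sum_{\substack{k\ge2\\ k\text{ even}}}G_k(T)\frac{u^k}{k!}\Big),$$ where for even $k\ge 2$ $$G_k(T)=\frac{-B_k}{2k}+\sum_{n\ge1}\sum_{d\mid n}d^{k-1}T^n$$ and $B_k$ is the $k$-th Bernoulli number. In particular, the coefficient of any power of $u$ on the left-hand side lies in the ring of quasi-modular forms, i.e. the $\mathbb Q$-algebra generated by the $G_k$ ($k\ge2$ even).
   Context: Here $g=1$ and there is one set of variables $\mathbf x$. For a partition $\lambda$ and a cell $s\in\lambda$ let $a(s),l(s)$ be the arm and leg lengths, and put $$\mathcal H_\lambda(z,w)=\prod_{s\in\lambda}\frac{(z^{2a(s)+1}-w^{2l(s)+1})^{2}}{(z^{2a(s)+2}-w^{2l(s)})(z^{2a(s)}-w^{2l(s)+2})}.$$ Let $\tilde H_\lambda(\mathbf x;q,t)$ be the modified Macdonald symmetric function (Garsia–Haiman); it is characterized by: $\tilde H_\lambda[X(1-q)]\in\mathrm{span}\{s_\nu:\nu\trianglerighteq\lambda\}$, $\tilde H_\lambda[X(1-t)]\in\mathrm{span}\{s_\nu:\nu\trianglerighteq\lambda'\}$, $\langle\tilde H_\lambda,s_{(|\lambda|)}\rangle=1$, where $f[X(1-a)]$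 is the image of $f$ under $p_r\mapsto(1-a^r)p_r$. Put $\Omega(z,w)=\sum_\lambda\mathcal H_\lambda(z,w)\tilde H_\lambda(\mathbf x;z^2,w^2)$, sum over all partitions including the empty one. The Adams operation $\psi_d$ replaces every variable ($z$, $w$ and all $x_i$) by its $d$-th power; for a series $F$ with constant term $1$, $\mathrm{Log}(F)=\sum_{m\ge1}\frac{\mu(m)}{m}\psi_m(\log F)$ with $\mu$ the Möbius function. With the Hall pairing $\langle\cdot,\cdot\rangle$ and $h_\mu$ the complete symmetric functions, $$\mathbb H_\mu(z,w)=(z^2-1)(1-w^2)\langle\mathrm{Log}\,\Omega(z,w),h_\mu(\mathbf x)\rangle .$$ For $n=1$, $(n-1,1)$ is understood as the partition $(1)$. Elements of the ring of quasi-modular forms are identified with their expansions as power series in $T$. *)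

theory Defs
  imports
    "HOL-Computational_Algebra.Computational_Algebra"
    "HOL-Computational_Algebra.Field_as_Ring"
    "HOL-Library.Multiset"
    "HOL-Library.Poly_Mapping"
    "Jordan_Normal_Form.Determinant"
begin

section \<open>Formal power series in infinitely many variables\<close>

text \<open>
  A monomial in the variables \<open>x\<^sub>0, x\<^sub>1, x\<^sub>2, \<dots>\<close> is a multiset of variable indices:
  the exponent of \<open>x\<^sub>i\<close> in \<open>m\<close> is \<open>count m i\<close>, and the degree is \<open>size m\<close>.
\<close>

typedef 'a xps = "UNIV :: (nat multiset \<Rightarrow> 'a) set"
  morphisms xcoeff Abs_xps ..

setup_lifting type_definition_xps

lemma xcoeff_Abs_xps [simp]: "xcoeff (Abs_xps f) = f"
  by (simp add: Abs_xps_inverse)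

lemma xps_eqI: "(\<And>m. xcoeff f m = xcoeff g m) \<Longrightarrow> f = g"
  by (simp add: ext flip: xcoeff_inject)

lemma finite_submultisets: "finite {a. a \<subseteq># (m :: 'b multiset)}"
proof (induction m)
  case empty
  show ?case by simp
next
  case (add x m)
  have "{a. a \<subseteq># add_mset x m} \<subseteq> {a. a \<subseteq># m} \<union> add_mset x ` {a. a \<subseteq># m}"
  proof
    fix a assume a: "a \<in> {a. a \<subseteq># add_mset x m}"
    show "a \<in> {a. a \<subseteq># m} \<union> add_mset x ` {a. a \<subseteq># m}"
    proof (cases "x \<in># a")
      case True
      then obtain b where "a = add_mset x b" by (metis multi_member_split)
      with a show ?thesis by auto
    next
      case False
      with a show ?thesis
        by (auto simp: subseteq_mset_def count_eq_zero_iff split: if_splits)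
           (metis count_eq_zero_iff le0)
    qed
  qed
  then show ?case using add.IH finite_subset by blast
qed

lemma finite_multiset_splittings: "finite {(a, b). a + b = (m :: 'b multiset)}"
  by (rule finite_subset[of _ "{a. a \<subseteq># m} \<times> {a. a \<subseteq># m}"])
     (auto intro: finite_submultisets)

instantiation xps :: (comm_ring_1) comm_ring_1
begin

lift_definition zero_xps :: "'a xps" is "\<lambda>_. 0" .

lift_definition one_xps :: "'a xps" is "\<lambda>m. if m = {#} then 1 else 0" .

lift_definition plus_xps :: "'a xps \<Rightarrow> 'a xps \<Rightarrow> 'a xps" is "\<lambda>f g m. f m + g m" .

lift_definition minus_xps :: "'a xps \<Rightarrow> 'a xps \<Rightarrow> 'a xps" is "\<lambda>f g m. f m - g m" .

lift_definition uminus_xps :: "'a xps \<Rightarrow> 'a xps" is "\<lambda>f m. - f m" .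

lift_definition times_xps :: "'a xps \<Rightarrow> 'a xps \<Rightarrow> 'a xps" is
  "\<lambda>f g m. \<Sum>(a, b) | a + b = m. f a * g b" .

instance
proof
  fix f g h :: "'a xps"
  show "f + g + h = f + (g + h)" by transfer (simp add: add.assoc)
  show "f + g = g + f" by transfer (simp add: add.commute)
  show "0 + f = f" by transfer simp
  show "- f + f = 0" by transfer simp
  show "f - g = f + - g" by transfer simp
  show "(0 :: 'a xps) \<noteq> 1" by transfer (metis zero_neq_one)
  show "f * g = g * f"
  proof (transfer, rule ext)
    fix f g :: "nat multiset \<Rightarrow> 'a" and m
    show "(\<Sum>(a, b) | a + b = m. f a * g b) = (\<Sum>(a, b) | a + b = m. g a * f b)"
      by (rule sum.reindex_bij_witness[where i = prod.swap and j = prod.swap])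
         (auto simp: ac_simps)
  qed
  show "1 * f = f"
  proof (transfer, rule ext)
    fix f :: "nat multiset \<Rightarrow> 'a" and m
    have "(\<Sum>(a, b) | a + b = m. (if a = {#} then 1 else 0) * f b)
        = (\<Sum>(a, b)\<in>{({#} :: nat multiset, m)}. (if a = {#} then 1 else 0) * f b)"
      by (intro sum.mono_neutral_right finite_multiset_splittings) (auto split: if_splits)
    then show "(\<Sum>(a, b) | a + b = m. (if a = {#} then 1 else 0) * f b) = f m"
      by simp
  qed
  show "(f + g) * h = f * h + g * h"
    by transfer
       (simp add: distrib_right sum.distrib[symmetric] case_prod_unfold)
  show "f * g * h = f * (g * h)"
  proof (transfer, rule ext)
    fix f g h :: "nat multiset \<Rightarrow> 'a" and m :: "nat multiset"
    let ?S = "\<lambda>m. {(a, b). a + b = (m :: nat multiset)}"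
    have fin: "finite (?S m)" for m
      by (rule finite_multiset_splittings)
    have "(\<Sum>(a, b)\<in>?S m. (\<Sum>(c, d)\<in>?S a. f c * g d) * h b)
        = (\<Sum>p\<in>?S m. \<Sum>r\<in>?S (fst p). f (fst r) * g (snd r) * h (snd p))"
      by (simp add: sum_distrib_right case_prod_unfold)
    also have "\<dots> = (\<Sum>(p, r)\<in>(SIGMA p:?S m. ?S (fst p)). f (fst r) * g (snd r) * h (snd p))"
      by (rule sum.Sigma) (auto intro: fin)
    also have "\<dots> = (\<Sum>(p, r)\<in>(SIGMA p:?S m. ?S (snd p)). f (fst p) * g (fst r) * h (snd r))"
      by (rule sum.reindex_bij_witness[where
            i = "\<lambda>(p, r). ((fst p + fst r, snd r), (fst p, fst r))" and
            j = "\<lambda>(p, r). ((fst r, snd r + snd p), (snd r, snd p))"])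
         (auto simp: ac_simps)
    also have "\<dots> = (\<Sum>p\<in>?S m. \<Sum>r\<in>?S (snd p). f (fst p) * g (fst r) * h (snd r))"
      by (rule sum.Sigma[symmetric]) (auto intro: fin)
    also have "\<dots> = (\<Sum>(a, b)\<in>?S m. f a * (\<Sum>(c, d)\<in>?S b. g c * h d))"
      by (simp add: sum_distrib_left case_prod_unfold mult.assoc)
    finally show "(\<Sum>(a, b)\<in>?S m. (\<Sum>(c, d)\<in>?S a. f c * g d) * h b)
                = (\<Sum>(a, b)\<in>?S m. f a * (\<Sum>(c, d)\<in>?S b. g c * h d))" .
  qed
qed

end

definition xconst :: "'a::zero \<Rightarrow> 'a xps" where
  "xconst c = Abs_xps (\<lambda>m. if m = {#} then c else 0)"

text \<open>
  Sum of a possibly infinite family that is locally finite, i.e. in which every monomial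
  occurs in only finitely many members.
\<close>

definition xsum :: "('i \<Rightarrow> 'a::comm_monoid_add xps) \<Rightarrow> 'i set \<Rightarrow> 'a xps" where
  "xsum F I = Abs_xps (\<lambda>m. \<Sum>i | i \<in> I \<and> xcoeff (F i) m \<noteq> 0. xcoeff (F i) m)"


section \<open>Partitions\<close>

definition is_partition :: "nat list \<Rightarrow> bool" where
  "is_partition \<mu> \<longleftrightarrow> sorted_wrt (\<ge>) \<mu> \<and> 0 \<notin> set \<mu>"

text \<open>The one-row partition \<open>(n)\<close>, which is the empty partition for \<open>n = 0\<close>.\<close>

definition row_partition :: "nat \<Rightarrow> nat list" where
  "row_partition n = (if n = 0 then [] else [n])"

definition cells :: "nat list \<Rightarrow> (nat \<times> nat) set" where
  "cells \<mu> = {(i, j). i < length \<mu> \<and> j < \<mu> ! i}"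

definition arm :: "nat list \<Rightarrow> nat \<times> nat \<Rightarrow> nat" where
  "arm \<mu> s = card {j. (fst s, j) \<in> cells \<mu> \<and> snd s < j}"

definition leg :: "nat list \<Rightarrow> nat \<times> nat \<Rightarrow> nat" where
  "leg \<mu> s = card {i. (i, snd s) \<in> cells \<mu> \<and> fst s < i}"

definition conjugate :: "nat list \<Rightarrow> nat list" where
  "conjugate \<mu> = map (\<lambda>j. card {i. (i, j) \<in> cells \<mu>}) [0..<sum_list (take 1 \<mu>)]"

definition dominates :: "nat list \<Rightarrow> nat list \<Rightarrow> bool"  (infix \<open>\<unrhd>\<close> 50) where
  "\<nu> \<unrhd> \<mu> \<longleftrightarrow> sum_list \<nu> = sum_list \<mu> \<and>
     (\<forall>k. sum_list (take k \<mu>) \<le> sum_list (take k \<nu>))"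


section \<open>Symmetric functions\<close>

definition sym_functions :: "'a::zero xps set" where
  "sym_functions = {f. (\<forall>\<pi> m. bij \<pi> \<longrightarrow> xcoeff f (image_mset \<pi> m) = xcoeff f m) \<and>
                       (\<exists>N. \<forall>m. xcoeff f m \<noteq> 0 \<longrightarrow> size m \<le> N)}"

definition power_sum :: "nat \<Rightarrow> 'a::zero_neq_one xps" where
  "power_sum r = Abs_xps (\<lambda>m. if \<exists>i. m = replicate_mset r i then 1 else 0)"

definition complete_sym :: "nat \<Rightarrow> 'a::zero_neq_one xps" where
  "complete_sym n = Abs_xps (\<lambda>m. if size m = n then 1 else 0)"

definition p_fun :: "nat list \<Rightarrow> 'a::comm_ring_1 xps" where
  "p_fun \<rho> = prod_list (map power_sum \<rho>)"

definition h_fun :: "nat list \<Rightarrow> 'a::comm_ring_1 xps" where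
  "h_fun \<mu> = prod_list (map complete_sym \<mu>)"

text \<open>Schur functions by the Jacobi--Trudi formula, with \<open>h\<^sub>k = 0\<close> for \<open>k < 0\<close>.\<close>

definition schur :: "nat list \<Rightarrow> 'a::comm_ring_1 xps" where
  "schur \<mu> = det (mat (length \<mu>) (length \<mu>) (\<lambda>(i, j).
     let k = int (\<mu> ! i) - int i + int j in if k < 0 then 0 else complete_sym (nat k)))"

definition schur_span :: "nat list set \<Rightarrow> 'a::comm_ring_1 xps set" where
  "schur_span A = {\<Sum>\<nu>\<in>S. xconst (c \<nu>) * schur \<nu> | S c. finite S \<and> S \<subseteq> A}"

text \<open>
  Coordinates of a symmetric function (over a field of characteristic 0) in a linear basis
  of the ring of symmetric functions indexed by partitions.
\<close>

definition basis_coords ::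
  "(nat list \<Rightarrow> 'a::comm_ring_1 xps) \<Rightarrow> 'a xps \<Rightarrow> (nat list \<Rightarrow>\<^sub>0 'a)" where
  "basis_coords b f = (THE c. (\<forall>\<mu>\<in>Poly_Mapping.keys c. is_partition \<mu>) \<and>
     f = (\<Sum>\<mu>\<in>Poly_Mapping.keys c. xconst (Poly_Mapping.lookup c \<mu>) * b \<mu>))"

text \<open>
  The image \<open>f[X(1 - a)]\<close> of \<open>f\<close> under the algebra homomorphism
  \<open>p\<^sub>r \<mapsto> (1 - a\<^sup>r) p\<^sub>r\<close>, computed on the basis \<open>p\<^sub>\<rho>\<close>.
\<close>

definition plethysm_one_minus :: "'a::comm_ring_1 \<Rightarrow> 'a xps \<Rightarrow> 'a xps" where
  "plethysm_one_minus a f = (\<Sum>\<rho>\<in>Poly_Mapping.keys (basis_coords p_fun f).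
     xconst (Poly_Mapping.lookup (basis_coords p_fun f) \<rho>) *
     prod_list (map (\<lambda>r. xconst (1 - a ^ r) * power_sum r) \<rho>))"

text \<open>The monomial \<open>x\<^sup>\<mu>\<close>, in which \<open>x\<^sub>i\<close> has exponent \<open>\<mu> ! i\<close>.\<close>

definition part_monomial :: "nat list \<Rightarrow> nat multiset" where
  "part_monomial \<mu> = (\<Sum>i<length \<mu>. replicate_mset (\<mu> ! i) i)"

text \<open>
  The Hall pairing: the bilinear pairing with \<open>\<langle>m\<^sub>\<lambda>, h\<^sub>\<mu>\<rangle> = \<delta>\<^bsub>\<lambda>\<mu>\<^esub>\<close>.
  The coefficient of the monomial symmetric function \<open>m\<^sub>\<mu>\<close> in \<open>f\<close> is the coefficient of
  \<open>x\<^sup>\<mu>\<close>.  The first argument may have unbounded degree.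
\<close>

definition hall :: "'a::comm_ring_1 xps \<Rightarrow> 'a xps \<Rightarrow> 'a" where
  "hall f g = (\<Sum>\<mu>\<in>Poly_Mapping.keys (basis_coords h_fun g).
     Poly_Mapping.lookup (basis_coords h_fun g) \<mu> * xcoeff f (part_monomial \<mu>))"


section \<open>Rational functions in two variables\<close>

text \<open>
  An element of \<open>rat poly poly\<close> is a polynomial in the second variable whose coefficients are
  polynomials in the first one.
\<close>

type_synonym ratfun = "rat poly poly fract"

definition var1 :: ratfun where "var1 = Fract [:[:0, 1:]:] 1"
definition var2 :: ratfun where "var2 = Fract [:0, 1:] 1"

instance fract :: ("{idom, ring_char_0}") ring_char_0
proof
  have "of_nat n = (Fract (of_nat n) 1 :: 'a fract)" for n
    by (rule of_nat_fract)
  then show "inj (of_nat :: nat \<Rightarrow> 'a fract)"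
    by (auto intro!: injI simp: eq_fract)
qed

instance fract :: ("{idom, ring_char_0}") field_char_0 ..

definition eval_poly2 :: "rat poly poly \<Rightarrow> 'a::field_char_0 \<Rightarrow> 'a \<Rightarrow> 'a" where
  "eval_poly2 P a b = poly (map_poly (\<lambda>c. poly (map_poly of_rat c) a) P) b"

text \<open>
  Substitution into a rational function, via its reduced fraction.  The value is meaningful
  when the function is defined at the given point, i.e. when the reduced denominator does
  not vanish there.
\<close>

definition ratfun_defined_at :: "ratfun \<Rightarrow> 'a::field_char_0 \<Rightarrow> 'a \<Rightarrow> bool" where
  "ratfun_defined_at r a b \<longleftrightarrow> eval_poly2 (snd (quot_of_fract r)) a b \<noteq> 0"

definition ratfun_eval :: "ratfun \<Rightarrow> 'a::field_char_0 \<Rightarrow> 'a \<Rightarrow> 'a" where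
  "ratfun_eval r a b =
     eval_poly2 (fst (quot_of_fract r)) a b / eval_poly2 (snd (quot_of_fract r)) a b"


section \<open>Modified Macdonald symmetric functions\<close>

text \<open>Here the two variables of \<^typ>\<open>ratfun\<close> are \<open>q\<close> and \<open>t\<close>.\<close>

definition is_modified_macdonald :: "nat list \<Rightarrow> ratfun xps \<Rightarrow> bool" where
  "is_modified_macdonald \<mu> H \<longleftrightarrow>
     H \<in> sym_functions \<and>
     plethysm_one_minus var1 H \<in> schur_span {\<nu>. is_partition \<nu> \<and> \<nu> \<unrhd> \<mu>} \<and>
     plethysm_one_minus var2 H \<in> schur_span {\<nu>. is_partition \<nu> \<and> \<nu> \<unrhd> conjugate \<mu>} \<and>
     hall H (schur (row_partition (sum_list \<mu>))) = 1"


section \<open>The genus one generating function\<close>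

text \<open>From here on the two variables of \<^typ>\<open>ratfun\<close> are \<open>z\<close> and \<open>w\<close>.\<close>

definition hook_function :: "nat list \<Rightarrow> ratfun" where
  "hook_function \<mu> = (let z = var1; w = var2 in
     \<Prod>s\<in>cells \<mu>. (z ^ (2 * arm \<mu> s + 1) - w ^ (2 * leg \<mu> s + 1)) ^ 2 /
       ((z ^ (2 * arm \<mu> s + 2) - w ^ (2 * leg \<mu> s)) *
        (z ^ (2 * arm \<mu> s) - w ^ (2 * leg \<mu> s + 2))))"

text \<open>
  The argument \<open>Ht \<mu>\<close> is the modified Macdonald function of \<open>\<mu>\<close>, in which \<open>q\<close> and \<open>t\<close> are
  replaced by \<open>z\<^sup>2\<close> and \<open>w\<^sup>2\<close>.
\<close>

definition Omega :: "(nat list \<Rightarrow> ratfun xps) \<Rightarrow> ratfun xps" where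
  "Omega Ht = xsum (\<lambda>\<mu>. xconst (hook_function \<mu>) *
     Abs_xps (\<lambda>m. ratfun_eval (xcoeff (Ht \<mu>) m) (var1 ^ 2) (var2 ^ 2))) {\<mu>. is_partition \<mu>}"

text \<open>The monomials of the form \<open>a(x\<^sup>d)\<close> are those with \<open>m = repeat_mset d a\<close>.\<close>

definition adams :: "nat \<Rightarrow> ratfun xps \<Rightarrow> ratfun xps" where
  "adams d F = Abs_xps (\<lambda>m. \<Sum>a | repeat_mset d a = m.
     ratfun_eval (xcoeff F a) (var1 ^ d) (var2 ^ d))"

definition moebius :: "nat \<Rightarrow> int" where
  "moebius n = (if squarefree n then (-1) ^ card (prime_factors n) else 0)"

definition xlog :: "'a::field_char_0 xps \<Rightarrow> 'a xps" where
  "xlog F = xsum (\<lambda>k. xconst ((-1) ^ (k - 1) / of_nat k) * (F - 1) ^ k) {1..}"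

definition pleth_Log :: "ratfun xps \<Rightarrow> ratfun xps" where
  "pleth_Log F = xsum (\<lambda>d. xconst (of_int (moebius d) / of_nat d) * adams d (xlog F)) {1..}"

definition HH :: "(nat list \<Rightarrow> ratfun xps) \<Rightarrow> nat list \<Rightarrow> ratfun" where
  "HH Ht \<mu> = (var1 ^ 2 - 1) * (1 - var2 ^ 2) * hall (pleth_Log (Omega Ht)) (h_fun \<mu>)"

text \<open>The partition \<open>(n - 1, 1)\<close>, read as \<open>(1)\<close> for \<open>n = 1\<close>.\<close>

definition hook_partition :: "nat \<Rightarrow> nat list" where
  "hook_partition n = (if n = 1 then [1] else [n - 1, 1])"


section \<open>Generating series\<close>

text \<open>The Laurent series \<open>exp (c u)\<close> in \<open>u\<close>.\<close>

definition exp_u :: "rat \<Rightarrow> rat fls" where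
  "exp_u c = fps_to_fls (fps_exp c)"

text \<open>
  The left-hand side, a power series in \<open>T\<close> with coefficients in the field of Laurent series
  in \<open>u\<close>.
\<close>

definition lhs_series :: "(nat list \<Rightarrow> ratfun xps) \<Rightarrow> rat fls fps" where
  "lhs_series Ht = 1 + Abs_fps (\<lambda>n. if n = 0 then 0
     else ratfun_eval (HH Ht (hook_partition n)) (exp_u (1/2)) (exp_u (- 1/2)))"

text \<open>Bernoulli numbers, by \<open>u / (exp u - 1) = (\<Sum>k. B\<^sub>k u\<^sup>k / k!)\<close>.\<close>

definition bernoulli_num :: "nat \<Rightarrow> rat" where
  "bernoulli_num k = fact k * fps_nth (fps_X / (fps_exp 1 - 1)) k"

definition eisenstein :: "nat \<Rightarrow> rat fps" where
  "eisenstein k = Abs_fps (\<lambda>n. if n = 0 then - bernoulli_num k / (2 * of_nat k)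
     else (\<Sum>d | d dvd n. of_nat d ^ (k - 1)))"

text \<open>
  The right-hand side, a power series in \<open>u\<close> with coefficients in the ring of power series
  in \<open>T\<close>.  The exponent has no constant term as a series in \<open>u\<close>.
\<close>

definition rhs_exponent :: "rat fps fps" where
  "rhs_exponent = Abs_fps (\<lambda>k. if even k \<and> k \<ge> 2
     then fps_const (2 / fact k) * eisenstein k else 0)"

definition rhs_series :: "rat fps fps" where
  "rhs_series =
     Abs_fps (\<lambda>k. fps_const (fps_nth ((fps_exp (1/2) - fps_exp (- 1/2)) / fps_X) k)) *
     fps_compose (Abs_fps (\<lambda>k. fps_const (1 / fact k))) rhs_exponent"

text \<open>Regards a power series in \<open>u\<close> over power series in \<open>T\<close> as a power series in \<open>T\<close>
  over Laurent series in \<open>u\<close>.\<close>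

definition reorder_series :: "rat fps fps \<Rightarrow> rat fls fps" where
  "reorder_series F =
     Abs_fps (\<lambda>n. fps_to_fls (Abs_fps (\<lambda>k. fps_nth (fps_nth F k) n)))"

text \<open>The coefficient of a power of \<open>u\<close>, as a power series in \<open>T\<close>.\<close>

definition u_coeff :: "rat fls fps \<Rightarrow> int \<Rightarrow> rat fps" where
  "u_coeff F j = Abs_fps (\<lambda>n. fls_nth (fps_nth F n) j)"

text \<open>The \<open>\<rat>\<close>-algebra generated by the Eisenstein series \<open>G\<^sub>k\<close>, as power series in \<open>T\<close>.\<close>

inductive_set quasi_modular :: "rat fps set" where
  const: "fps_const c \<in> quasi_modular"
| eisenstein: "even k \<Longrightarrow> k \<ge> 2 \<Longrightarrow> eisenstein k \<in> quasi_modular"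
| add: "f \<in> quasi_modular \<Longrightarrow> g \<in> quasi_modular \<Longrightarrow> f + g \<in> quasi_modular"
| mult: "f \<in> quasi_modular \<Longrightarrow> g \<in> quasi_modular \<Longrightarrow> f * g \<in> quasi_modular"

end

theory Submission
  imports Defs
begin

text \<open>
  Pairing with \<open>h\<^bsub>(n-1,1)\<^esub>\<close> reads off the coefficient of \<open>x\<^sub>0\<^bsup>n-1\<^esup> x\<^sub>1\<close>.  An Adams
  operation \<open>\<psi>\<^sub>d\<close> with \<open>d \<ge> 2\<close> only produces monomials whose exponents are all divisible by
  \<open>d\<close>, so in the plethystic logarithm of \<open>\<Omega>\<close> only the ordinary logarithm contributes
  (\<open>xcoeff_pleth_Log\<close>).  Taking the part of first order in \<open>x\<^sub>1\<close> is a derivation over setting \<open>x\<^sub>1 = 0\<close>, hence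
  \<open>log \<Omega>\<close> contributes the quotient \<open>B(T) / A(T)\<close>, where \<open>A\<close> and \<open>B\<close> collect the coefficients
  of \<open>x\<^sub>0\<^sup>n\<close> and of \<open>x\<^sub>0\<^sup>n x\<^sub>1\<close> in \<open>\<Omega>\<close> (\<open>hook_series_xlog\<close>).

  These two coefficients of the modified Macdonald function of \<open>\<mu>\<close> are \<open>1\<close>, by the normalization,
  and the sum \<open>B\<^sub>\<mu>(q, t)\<close> of \<open>t\<^sup>i q\<^sup>j\<close> over the cells \<open>(i, j)\<close> of \<open>\<mu>\<close>
  (\<open>modified_macdonald_coefficients\<close>).  The second one follows from the eigenvector property for the
  operator \<open>D\<close> that sends \<open>f\<close> to the constant term in \<open>z\<close> of
  \<open>f[X + (1 - q) (1 - t) z] (\<Sum>\<^sub>m (-1)\<^sup>m e\<^sub>m z\<^bsup>-m\<^esup>)\<close>.  The plethysm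
  \<open>X \<mapsto> X (1 - q)\<close> turns \<open>D\<close> into an operator whose values on Jacobi--Trudi determinants are explicit
  (\<open>macdonald_op'_jt\<close>); it is triangular on Schur functions, with eigenvalues
  \<open>e\<^sub>\<nu>(q, t) = 1 - (1 - q) (1 - t) B\<^sub>\<nu>(q, t)\<close>.  Since \<open>D\<close> is symmetric in \<open>q\<close> and \<open>t\<close>, the
  same holds with \<open>q\<close> and \<open>t\<close> exchanged.  By the two span conditions, \<open>D H - e\<^sub>\<mu> H\<close> lies in two
  \<open>D\<close>-invariant spaces at once.  Dominance bounds the sum of squares of the conjugate parts of the
  partitions that belong to the first space, and the sum of squares of the parts of those that belong to
  the second one.  Both sums are determined by the size of the partition and the \<open>t\<close>-derivative of the
  cell sum, \<open>B\<^sub>\<nu>(q, t)\<close> or \<open>B\<^sub>\<kappa>(t, q)\<close>, at \<open>q = t = 1\<close>, and the bounds show that no eigenvalue of \<open>D\<close> occurs on both spaces; hence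
  \<open>D H = e\<^sub>\<mu> H\<close> (\<open>macdonald_op_eigenvector\<close>).  Setting every power sum to \<open>1\<close> in this equation
  gives \<open>B\<^sub>\<mu>\<close> (\<open>eps_macdonald_op\<close>).

  At \<open>w = 1/z\<close> every factor of the hook function is \<open>1\<close>.  With \<open>q = z\<^sup>2 = exp u\<close> the left-hand
  side of the theorem therefore becomes the average of \<open>e\<^sub>\<mu>(q, 1/q)\<close> over the partitions, that is,
  the quotient of \<open>\<Sum>\<^sub>\<mu> e\<^sub>\<mu>(q, 1/q) T\<^bsup>\<bar>\<mu>\<bar>\<^esup>\<close> and \<open>\<Sum>\<^sub>\<mu> T\<^bsup>\<bar>\<mu>\<bar>\<^esup>\<close>.  By the
  \<open>q\<close>-binomial theorem this is \<open>\<Prod>\<^sub>n (1 - T\<^sup>n)\<^sup>2 / ((1 - q T\<^sup>n) (1 - T\<^sup>n / q))\<close>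
  (\<open>average_series_product\<close>).

  The right-hand side is the same product.  Its constant term in \<open>T\<close> is \<open>1\<close> by the generating
  function of the Bernoulli numbers (\<open>sinh_exp_bernoulli\<close>), and summing the Eisenstein series over
  \<open>k\<close> shows that its logarithmic \<open>T\<close>-derivative is that of the product (\<open>log_series_crank\<close>).
  A coefficient of a power of \<open>u\<close> on the right-hand side is a polynomial in finitely many \<open>G\<^sub>k\<close>,
  which gives the quasi-modularity.
\<close>

section \<open>Polynomials in the power sums\<close>

text \<open>
  The symmetric functions in characteristic 0 are the polynomials in the power sums, and algebra
  homomorphisms are easiest to define on these.  The index \<open>i\<close> of a variable stands for the power
  sum \<open>p\<^bsub>i+1\<^esub>\<close>, and a multiset of such indices for a product of power sums.
\<close>

type_synonym 'k psym = "nat multiset \<Rightarrow>\<^sub>0 'k"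

definition pconst :: "'k \<Rightarrow> ('k::comm_ring_1) psym" where
  "pconst c = Poly_Mapping.single {#} c"

definition pvar :: "nat \<Rightarrow> ('k::comm_ring_1) psym" where
  "pvar i = Poly_Mapping.single {#i#} 1"

text \<open>
  The homomorphism out of the polynomial ring that is \<open>c\<close> on constants and sends the
  variable \<open>i\<close> to \<open>v i\<close>.
\<close>

definition peval :: "('k::comm_ring_1 \<Rightarrow> 'r::comm_ring_1) \<Rightarrow> (nat \<Rightarrow> 'r) \<Rightarrow> 'k psym \<Rightarrow> 'r" where
  "peval c v f = (\<Sum>m\<in>Poly_Mapping.keys f. c (Poly_Mapping.lookup f m) * prod_mset (image_mset v m))"

lemma pconst_hom: "comm_ring_hom (pconst :: 'k::comm_ring_1 \<Rightarrow> 'k psym)"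
  by unfold_locales (auto simp: pconst_def single_add mult_single simp flip: single_one)

interpretation pconst: comm_ring_hom pconst
  by (rule pconst_hom)

lemma single_conv_pvar:
  "Poly_Mapping.single m (c::'k::comm_ring_1) = pconst c * prod_mset (image_mset pvar m)"
proof -
  have "prod_mset (image_mset pvar m) = (Poly_Mapping.single m 1 :: 'k psym)"
    by (induction m) (auto simp: pvar_def mult_single)
  thus ?thesis
    by (simp add: pconst_def mult_single)
qed

lemma psym_expand:
  "f = (\<Sum>m\<in>Poly_Mapping.keys f. Poly_Mapping.single m (Poly_Mapping.lookup f m))"
proof (rule poly_mapping_eqI)
  fix k
  have "Poly_Mapping.lookup (\<Sum>m\<in>Poly_Mapping.keys f. Poly_Mapping.single m (Poly_Mapping.lookup f m)) k
     = (\<Sum>m\<in>Poly_Mapping.keys f. if m = k then Poly_Mapping.lookup f k else 0)"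
    unfolding lookup_sum by (rule sum.cong) (auto simp: lookup_single)
  also have "\<dots> = Poly_Mapping.lookup f k"
    by (auto simp: in_keys_iff)
  finally show "Poly_Mapping.lookup f k =
    Poly_Mapping.lookup (\<Sum>m\<in>Poly_Mapping.keys f. Poly_Mapping.single m (Poly_Mapping.lookup f m)) k" ..
qed

lemma psym_hom_eqI:
  fixes \<phi> \<psi> :: "'k::comm_ring_1 psym \<Rightarrow> 'r::comm_ring_1"
  assumes "comm_ring_hom \<phi>" "comm_ring_hom \<psi>"
    and c: "\<And>c. \<phi> (pconst c) = \<psi> (pconst c)" and v: "\<And>i. \<phi> (pvar i) = \<psi> (pvar i)"
  shows "\<phi> f = \<psi> f"
proof -
  interpret p: comm_ring_hom \<phi> by fact
  interpret s: comm_ring_hom \<psi> by fact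
  have "\<phi> (prod_mset (image_mset pvar m)) = \<psi> (prod_mset (image_mset pvar m))" for m
    by (induction m) (auto simp: p.hom_mult s.hom_mult v simp del: p.prod_mset_image s.prod_mset_image)
  hence "\<phi> (Poly_Mapping.single m d) = \<psi> (Poly_Mapping.single m d)" for m d
    by (simp add: single_conv_pvar p.hom_mult s.hom_mult c del: p.prod_mset_image s.prod_mset_image)
  thus ?thesis
    by (subst (1 2) psym_expand[of f]) (simp add: p.hom_sum s.hom_sum)
qed

lemma comm_ring_hom_comp:
  assumes "comm_ring_hom \<phi>" "comm_ring_hom \<psi>"
  shows "comm_ring_hom (\<lambda>x. \<phi> (\<psi> x))"
proof -
  interpret p: comm_ring_hom \<phi> by fact
  interpret s: comm_ring_hom \<psi> by fact
  show ?thesis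
    by unfold_locales (auto simp: p.hom_mult s.hom_mult p.hom_add s.hom_add)
qed

context
  fixes c :: "'k::comm_ring_1 \<Rightarrow> 'r::comm_ring_1" and v :: "nat \<Rightarrow> 'r"
  assumes c: "comm_ring_hom c"
begin

interpretation c: comm_ring_hom c by (rule c)

lemma peval_superset:
  assumes "finite A" "Poly_Mapping.keys f \<subseteq> A"
  shows "peval c v f = (\<Sum>m\<in>A. c (Poly_Mapping.lookup f m) * prod_mset (image_mset v m))"
  unfolding peval_def using assms
  by (intro sum.mono_neutral_left) (auto simp: in_keys_iff)

lemma peval_add: "peval c v (f + g) = peval c v f + peval c v g"
proof -
  let ?A = "Poly_Mapping.keys f \<union> Poly_Mapping.keys g"
  show ?thesis
    by (subst (1 2 3) peval_superset[where A = ?A])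
       (auto simp: lookup_add c.hom_add algebra_simps sum.distrib dest: set_mp[OF keys_add])
qed

lemma peval_single: "peval c v (Poly_Mapping.single m d) = c d * prod_mset (image_mset v m)"
  by (simp add: peval_def)

lemma peval_zero [simp]: "peval c v 0 = 0"
  by (simp add: peval_def)

lemma peval_sum: "peval c v (sum f A) = (\<Sum>x\<in>A. peval c v (f x))"
  by (induction A rule: infinite_finite_induct) (auto simp: peval_add)

lemma peval_mult: "peval c v (f * g) = peval c v f * peval c v g"
proof -
  have "f * g = (\<Sum>m\<in>Poly_Mapping.keys f. \<Sum>n\<in>Poly_Mapping.keys g.
      Poly_Mapping.single m (Poly_Mapping.lookup f m) * Poly_Mapping.single n (Poly_Mapping.lookup g n))"
    by (subst psym_expand[of f], subst psym_expand[of g]) (simp add: sum_product)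
  also have "peval c v \<dots> = (\<Sum>m\<in>Poly_Mapping.keys f. \<Sum>n\<in>Poly_Mapping.keys g.
      (c (Poly_Mapping.lookup f m) * prod_mset (image_mset v m)) *
      (c (Poly_Mapping.lookup g n) * prod_mset (image_mset v n)))"
    by (simp add: peval_sum mult_single peval_single c.hom_mult mult_ac)
  also have "\<dots> = peval c v f * peval c v g"
    unfolding peval_def by (rule sum_product [symmetric])
  finally show ?thesis .
qed

lemma peval_hom: "comm_ring_hom (peval c v)"
proof
  show "peval c v 1 = 1" by (simp add: peval_single flip: single_one)
qed (simp_all add: peval_add peval_mult)

lemma peval_pconst [simp]: "peval c v (pconst d) = c d"
  by (simp add: pconst_def peval_single)

lemma peval_pvar [simp]: "peval c v (pvar i) = v i"
  by (simp add: pvar_def peval_single)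

end

lemma peval_unique:
  assumes "comm_ring_hom c" "comm_ring_hom \<phi>"
    "\<And>d. \<phi> (pconst d) = c d" "\<And>i. \<phi> (pvar i) = v i"
  shows "\<phi> f = peval c v f"
  by (rule psym_hom_eqI) (use assms in \<open>auto intro: peval_hom\<close>)


section \<open>Series with a prescribed logarithmic derivative\<close>

definition log_series :: "(nat \<Rightarrow> 'r) \<Rightarrow> 'r::comm_ring_1 fps" where
  "log_series a = Abs_fps (\<lambda>n. if n = 0 then 0 else a n)"

text \<open>
  Says \<open>F = exp (\<Sum>\<^bsub>n\<ge>1\<^esub> a\<^sub>n T\<^sup>n / n)\<close>.  The differential equation avoids the
  denominators and thus makes sense over every commutative ring; it turns all the product formulas
  below into additions of the sequences \<open>a\<close>.
\<close>

definition exp_series :: "(nat \<Rightarrow> 'r) \<Rightarrow> 'r::comm_ring_1 fps \<Rightarrow> bool" where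
  "exp_series a F \<longleftrightarrow> fps_nth F 0 = 1 \<and> fps_X * fps_deriv F = log_series a * F"

lemma fps_X_deriv_nth: "fps_nth (fps_X * fps_deriv F) n = of_nat n * (fps_nth F n :: 'r::comm_ring_1)"
  by (cases n) auto

text \<open>
  Newton's identities: comparing coefficients in the differential equation gives a recursion.
\<close>

lemma exp_series_iff:
  "exp_series a F \<longleftrightarrow> fps_nth F 0 = 1 \<and>
     (\<forall>n. of_nat n * fps_nth F n = (\<Sum>r=1..n. a r * fps_nth F (n - r)))"
proof -
  have "fps_nth (log_series a * F) n = (\<Sum>r=1..n. a r * fps_nth F (n - r))" for n
    unfolding fps_mult_nth log_series_def fps_nth_Abs_fps
    by (rule sum.mono_neutral_cong_right) auto
  thus ?thesis
    unfolding exp_series_def fps_eq_iff fps_X_deriv_nth by simp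
qed

lemma exp_series_mult:
  assumes "exp_series a F" "exp_series b G"
  shows "exp_series (\<lambda>n. a n + b n) (F * G)"
proof -
  have "log_series (\<lambda>n. a n + b n) = log_series a + log_series b"
    by (auto simp: log_series_def fps_eq_iff)
  hence "log_series (\<lambda>n. a n + b n) * (F * G) = (log_series a * F) * G + F * (log_series b * G)"
    by (simp add: algebra_simps)
  also have "\<dots> = (fps_X * fps_deriv F) * G + F * (fps_X * fps_deriv G)"
    using assms by (simp only: exp_series_def)
  also have "\<dots> = fps_X * fps_deriv (F * G)"
    by (simp add: algebra_simps)
  finally show ?thesis using assms by (simp add: exp_series_def)
qed

lemma exp_series_linear: "exp_series (\<lambda>n. - (c ^ n)) (1 - fps_const c * fps_X)"
proof -
  have "of_nat n * fps_nth (1 - fps_const c * fps_X) n =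
    (\<Sum>r = 1..n. - (c ^ r) * fps_nth (1 - fps_const c * fps_X) (n - r))" for n
  proof (cases n)
    case (Suc m)
    have "(\<Sum>r = 1..n. - (c ^ r) * fps_nth (1 - fps_const c * fps_X) (n - r))
       = (\<Sum>r\<in>{m, Suc m} - {0}. - (c ^ r) * fps_nth (1 - fps_const c * fps_X) (n - r))"
      by (rule sum.mono_neutral_right) (auto simp: Suc fps_X_def)
    also have "\<dots> = of_nat n * fps_nth (1 - fps_const c * fps_X) n"
      by (cases m) (auto simp: Suc fps_X_def)
    finally show ?thesis ..
  qed auto
  thus ?thesis by (auto simp: exp_series_iff)
qed

lemma exp_series_scale:
  assumes "exp_series a F"
  shows "exp_series (\<lambda>n. c ^ n * a n) (Abs_fps (\<lambda>n. c ^ n * fps_nth F n))"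
  unfolding exp_series_iff
proof (intro conjI allI)
  fix n
  have "of_nat n * (c ^ n * fps_nth F n) = c ^ n * (of_nat n * fps_nth F n)"
    by (rule mult.left_commute)
  also have "of_nat n * fps_nth F n = (\<Sum>r=1..n. a r * fps_nth F (n - r))"
    using assms by (simp only: exp_series_iff)
  also have "c ^ n * \<dots> = (\<Sum>r=1..n. (c ^ r * a r) * (c ^ (n - r) * fps_nth F (n - r)))"
    unfolding sum_distrib_left
  proof (rule sum.cong [OF refl])
    fix r assume "r \<in> {1..n}"
    hence "c ^ n = c ^ r * c ^ (n - r)" by (simp flip: power_add)
    thus "c ^ n * (a r * fps_nth F (n - r)) = (c ^ r * a r) * (c ^ (n - r) * fps_nth F (n - r))"
      by (simp add: mult_ac)
  qed
  finally show "of_nat n * fps_nth (Abs_fps (\<lambda>n. c ^ n * fps_nth F n)) n =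
    (\<Sum>r = 1..n. c ^ r * a r * fps_nth (Abs_fps (\<lambda>n. c ^ n * fps_nth F n)) (n - r))" by simp
qed (use assms in \<open>auto simp: exp_series_iff\<close>)

lemma exp_series_hom:
  assumes "comm_ring_hom \<phi>" "exp_series a F"
  shows "exp_series (\<lambda>n. \<phi> (a n)) (Abs_fps (\<lambda>n. \<phi> (fps_nth F n)))"
proof -
  interpret comm_ring_hom \<phi> by fact
  have "of_nat n * \<phi> (fps_nth F n) = (\<Sum>r=1..n. \<phi> (a r) * \<phi> (fps_nth F (n - r)))" for n
  proof -
    have "\<phi> (of_nat n * fps_nth F n) = \<phi> (\<Sum>r=1..n. a r * fps_nth F (n - r))"
      using assms(2) by (simp only: exp_series_iff)
    thus ?thesis by (simp only: hom_mult hom_of_nat hom_sum)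
  qed
  thus ?thesis
    using assms(2) unfolding exp_series_iff by simp
qed

text \<open>
  A ring that receives a homomorphism from a field of characteristic 0 is a \<open>\<rat>\<close>-algebra.  The
  homomorphism is a parameter because polynomial rings and rings of symmetric functions occur here,
  which are algebras over a field without being fields.
\<close>

lemma hom_of_nat_cancel:
  fixes x y :: "'r::comm_ring_1" and c :: "'k::field_char_0 \<Rightarrow> 'r"
  assumes "comm_ring_hom c" "of_nat n * x = of_nat n * y" "n > 0"
  shows "x = y"
proof -
  interpret comm_ring_hom c by fact
  have inv: "c (inverse (of_nat n)) * of_nat n = 1"
    using assms(3) by (simp flip: hom_of_nat hom_mult)
  have "c (inverse (of_nat n)) * (of_nat n * x) = c (inverse (of_nat n)) * (of_nat n * y)"
    using assms(2) by simp
  thus ?thesis by (simp add: inv flip: mult.assoc)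
qed

lemma exp_series_unique:
  fixes F G :: "'r::comm_ring_1 fps" and c :: "'k::field_char_0 \<Rightarrow> 'r"
  assumes c: "comm_ring_hom c" and F: "exp_series a F" and G: "exp_series a G"
  shows "F = G"
proof (rule fps_ext)
  fix n
  show "fps_nth F n = fps_nth G n"
  proof (induction n rule: less_induct)
    case (less n)
    show ?case
    proof (cases "n = 0")
      case False
      have "of_nat n * fps_nth F n = (\<Sum>r=1..n. a r * fps_nth F (n - r))"
        using F by (simp add: exp_series_iff)
      also have "\<dots> = (\<Sum>r=1..n. a r * fps_nth G (n - r))"
        by (rule sum.cong) (use less False in auto)
      also have "\<dots> = of_nat n * fps_nth G n"
        using G by (simp add: exp_series_iff)
      finally show ?thesis using hom_of_nat_cancel[OF c] False by blast
    qed (use F G in \<open>simp add: exp_series_iff\<close>)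
  qed
qed

text \<open>
  The complete symmetric function \<open>h\<^sub>n\<close> as a polynomial in the power sums, by Newton's recursion.
\<close>

fun phom :: "nat \<Rightarrow> 'k::field_char_0 psym" where
  "phom 0 = 1"
| "phom (Suc n) = pconst (1 / of_nat (Suc n)) * (\<Sum>r\<le>n. pvar r * phom (n - r))"

declare phom.simps(2) [simp del]

lemma exp_series_phom: "exp_series (\<lambda>r. pvar (r - 1)) (Abs_fps phom)"
proof -
  have "of_nat (Suc n) * phom (Suc n) = (\<Sum>r=1..Suc n. pvar (r - 1) * (phom (Suc n - r) :: 'k::field_char_0 psym))" for n
  proof -
    have "of_nat (Suc n) * (phom (Suc n) :: 'k psym) =
        pconst (of_nat (Suc n) * (1 / of_nat (Suc n))) * (\<Sum>r\<le>n. pvar r * phom (n - r))"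
      unfolding phom.simps pconst.hom_mult pconst.hom_of_nat mult.assoc ..
    also have "(of_nat (Suc n) :: 'k) * (1 / of_nat (Suc n)) = 1"
      using of_nat_neq_0[of n] by (simp del: of_nat_Suc)
    also have "(\<Sum>r\<le>n. pvar r * (phom (n - r) :: 'k psym)) = (\<Sum>r=1..Suc n. pvar (r - 1) * phom (Suc n - r))"
      by (rule sum.reindex_bij_witness[of _ "\<lambda>r. r - 1" Suc]) auto
    finally show ?thesis by simp
  qed
  hence "of_nat n * phom n = (\<Sum>r=1..n. pvar (r - 1) * (phom (n - r) :: 'k::field_char_0 psym))" for n
    by (cases n) auto
  thus ?thesis by (auto simp: exp_series_iff)
qed

lemma exp_series_peval:
  assumes "comm_ring_hom c"
  shows "exp_series (\<lambda>r. v (r - 1)) (Abs_fps (\<lambda>n. peval c v (phom n)))"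
  using exp_series_hom[OF peval_hom[OF assms] exp_series_phom, of v] assms by simp

section \<open>Determinant identities\<close>

lemma det_column_differences:
  fixes f :: "nat \<Rightarrow> nat \<Rightarrow> 'r::comm_ring_1"
  shows "det (mat k k (\<lambda>(i,j). f i j - (if j = 0 then 0 else c * f i (j - 1)))) = det (mat k k (\<lambda>(i,j). f i j))"
proof -
  define U where "U = mat k k (\<lambda>(l,j). if l = j then 1 else if Suc l = j then - c else (0::'r))"
  have U: "U \<in> carrier_mat k k" by (simp add: U_def)
  have "upper_triangular U" by (auto simp: upper_triangular_def U_def)
  hence "det U = prod_list (diag_mat U)" using U by (rule det_upper_triangular)
  also have "diag_mat U = map (\<lambda>_. 1) [0..<k]"
    by (auto simp: diag_mat_def U_def)
  also have "prod_list \<dots> = (1::'r)" by (induction k) auto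
  finally have det_U: "det U = 1" .
  have "mat k k (\<lambda>(i,j). f i j - (if j = 0 then 0 else c * f i (j - 1))) = mat k k (\<lambda>(i,j). f i j) * U"
  proof (rule eq_matI)
    fix i j assume "i < dim_row (mat k k (\<lambda>(i,j). f i j) * U)" "j < dim_col (mat k k (\<lambda>(i,j). f i j) * U)"
    hence ij: "i < k" "j < k" by (auto simp: U_def)
    have "(mat k k (\<lambda>(i,j). f i j) * U) $$ (i,j) = (\<Sum>l<k. f i l * (if l = j then 1 else if Suc l = j then - c else 0))"
      using ij by (auto simp: times_mat_def scalar_prod_def U_def atLeast0LessThan intro!: sum.cong)
    also have "\<dots> = (\<Sum>l\<in>{j, j - 1}. f i l * (if l = j then 1 else if Suc l = j then - c else 0))"
      using ij by (intro sum.mono_neutral_right) auto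
    also have "\<dots> = f i j - (if j = 0 then 0 else c * f i (j - 1))"
      by (cases j) (auto simp: mult_ac)
    finally show "mat k k (\<lambda>(i,j). f i j - (if j = 0 then 0 else c * f i (j - 1))) $$ (i,j) =
      (mat k k (\<lambda>(i,j). f i j) * U) $$ (i,j)" using ij by simp
  qed (auto simp: U_def)
  thus ?thesis
    using det_mult[of "mat k k (\<lambda>(i,j). f i j)" k U] U by (simp add: det_U)
qed

lemma cofactor_cong:
  assumes "\<And>i' j'. i' < k \<Longrightarrow> j' < k \<Longrightarrow> i' \<noteq> i \<Longrightarrow> j' \<noteq> j \<Longrightarrow> f i' j' = g i' j'" "i < k" "j < k"
  shows "cofactor (mat k k (\<lambda>(i,j). f i j)) i j = cofactor (mat k k (\<lambda>(i,j). g i j)) i j"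
proof -
  have "mat_delete (mat k k (\<lambda>(i,j). f i j)) i j = mat_delete (mat k k (\<lambda>(i,j). g i j)) i j"
    by (rule eq_matI) (use assms in \<open>auto simp: mat_delete_def\<close>)
  thus ?thesis by (simp add: cofactor_def)
qed

lemma cofactor_expansion_other_column:
  assumes "A \<in> carrier_mat k k" "j < k" "p < k"
  shows "(\<Sum>i<k. A $$ (i, j) * cofactor A i p) = (if j = p then det A else 0)"
proof -
  have "(adj_mat A * A) $$ (p, j) = (\<Sum>i<k. A $$ (i, j) * cofactor A i p)"
    using assms by (auto simp: times_mat_def scalar_prod_def adj_mat_def atLeast0LessThan mult_ac intro!: sum.cong)
  thus ?thesis
    using assms by (auto simp: adj_mat(3)[OF assms(1)])
qed

text \<open>
  Subtracting from each column a multiple of the preceding one preserves determinants.  Doing this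
  with \<open>b\<close> for \<open>v\<close> and with \<open>c\<close> for \<open>u\<close> gives two matrices that agree outside the first column,
  so the first matrix can be expanded along that column with the minors of the second one.  These are
  expressed by the cofactors of \<open>u\<close> itself: put the row \<open>1, c, c\<^sup>2, \<dots>\<close> in place of a row of \<open>u\<close>; the
  column operations turn it into \<open>1, 0, 0, \<dots>\<close>.
\<close>

lemma det_via_shifted_cofactors:
  fixes u v :: "nat \<Rightarrow> nat \<Rightarrow> 'r::comm_ring_1"
  assumes rel: "\<And>i j. i < k \<Longrightarrow> 0 < j \<Longrightarrow> j < k \<Longrightarrow> v i j - b * v i (j - 1) = u i j - c * u i (j - 1)"
    and "0 < k"
  shows "det (mat k k (\<lambda>(i,j). v i j)) =
    (\<Sum>i<k. \<Sum>p<k. c ^ p * v i 0 * cofactor (mat k k (\<lambda>(i,j). u i j)) i p)"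
proof -
  define Q where "Q = (\<lambda>i j. u i j - (if j = 0 then 0 else c * u i (j - 1)))"
  define M where "M = (\<lambda>i j. v i j - (if j = 0 then 0 else b * v i (j - 1)))"
  have MQ: "M i j = Q i j" if "i < k" "j < k" "j \<noteq> 0" for i j
    using that rel by (auto simp: M_def Q_def)
  have cof: "cofactor (mat k k (\<lambda>(i,j). M i j)) i 0 = (\<Sum>p<k. c ^ p * cofactor (mat k k (\<lambda>(i,j). u i j)) i p)"
    if i: "i < k" for i
  proof -
    \<comment> \<open>The row of powers of \<open>c\<close> becomes \<open>1, 0, \<dots>, 0\<close> under the column operations.\<close>
    define R where "R = (\<lambda>i' j. if i' = i then c ^ j else u i' j)"
    define R' where "R' = (\<lambda>i' j. R i' j - (if j = 0 then 0 else c * R i' (j - 1)))"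
    have R'_i: "R' i j = (if j = 0 then 1 else 0)" for j
      by (cases j) (auto simp: R'_def R_def)
    have "det (mat k k (\<lambda>(i,j). R' i j)) = (\<Sum>j<k. R' i j * cofactor (mat k k (\<lambda>(i,j). R' i j)) i j)"
      using i by (subst laplace_expansion_row[of _ k i]) auto
    also have "\<dots> = (\<Sum>j\<in>{0}. R' i j * cofactor (mat k k (\<lambda>(i,j). R' i j)) i j)"
      using \<open>0 < k\<close> by (intro sum.mono_neutral_right) (auto simp: R'_i)
    also have "\<dots> = cofactor (mat k k (\<lambda>(i,j). R' i j)) i 0"
      by (simp add: R'_i)
    also have "\<dots> = cofactor (mat k k (\<lambda>(i,j). M i j)) i 0"
      by (rule cofactor_cong) (use i \<open>0 < k\<close> in \<open>auto simp: MQ R'_def R_def Q_def\<close>)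
    finally have 1: "det (mat k k (\<lambda>(i,j). R' i j)) = cofactor (mat k k (\<lambda>(i,j). M i j)) i 0" .
    have "det (mat k k (\<lambda>(i,j). R' i j)) = det (mat k k (\<lambda>(i,j). R i j))"
      unfolding R'_def by (rule det_column_differences)
    also have "\<dots> = (\<Sum>p<k. R i p * cofactor (mat k k (\<lambda>(i,j). R i j)) i p)"
      using i by (subst laplace_expansion_row[of _ k i]) auto
    also have "\<dots> = (\<Sum>p<k. c ^ p * cofactor (mat k k (\<lambda>(i,j). u i j)) i p)"
    proof (rule sum.cong [OF refl])
      fix p assume "p \<in> {..<k}"
      hence "cofactor (mat k k (\<lambda>(i,j). R i j)) i p = cofactor (mat k k (\<lambda>(i,j). u i j)) i p"
        by (intro cofactor_cong) (use i in \<open>auto simp: R_def\<close>)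
      thus "R i p * cofactor (mat k k (\<lambda>(i,j). R i j)) i p = c ^ p * cofactor (mat k k (\<lambda>(i,j). u i j)) i p"
        by (simp add: R_def)
    qed
    finally show ?thesis using 1 by simp
  qed
  have "det (mat k k (\<lambda>(i,j). v i j)) = det (mat k k (\<lambda>(i,j). M i j))"
    unfolding M_def by (rule det_column_differences [symmetric])
  also have "\<dots> = (\<Sum>i<k. M i 0 * cofactor (mat k k (\<lambda>(i,j). M i j)) i 0)"
    using \<open>0 < k\<close> by (subst laplace_expansion_column[of _ k 0]) auto
  also have "\<dots> = (\<Sum>i<k. \<Sum>p<k. c ^ p * v i 0 * cofactor (mat k k (\<lambda>(i,j). u i j)) i p)"
    by (rule sum.cong) (simp_all add: cof, simp add: M_def sum_distrib_left mult_ac)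
  finally show ?thesis .
qed


section \<open>The Macdonald operator\<close>

text \<open>
  The constant term of \<open>a(z) (\<Sum>\<^sub>m E\<^sub>m z\<^bsup>-m\<^esup>)\<close>, where \<open>a\<close> is a polynomial in \<open>z\<close>.
\<close>

definition ct :: "(nat \<Rightarrow> 'r) \<Rightarrow> 'r::comm_ring_1 poly \<Rightarrow> 'r" where
  "ct E a = (\<Sum>m\<le>degree a. coeff a m * E m)"

lemma ct_superset:
  assumes "degree a \<le> N"
  shows "ct E a = (\<Sum>m\<le>N. coeff a m * E m)"
  unfolding ct_def using assms by (intro sum.mono_neutral_left) (auto simp: coeff_eq_0)

lemma ct_add: "ct E (a + b) = ct E a + ct E b"
proof -
  let ?N = "max (degree a) (degree b)"
  have "degree (a + b) \<le> ?N" by (rule degree_add_le) auto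
  thus ?thesis
    by (simp add: ct_superset[where N = ?N] sum.distrib algebra_simps)
qed

lemma ct_smult: "ct E (Polynomial.smult c a) = c * ct E a"
  using ct_superset[of "Polynomial.smult c a" "degree a" E]
  by (simp add: degree_smult_le ct_def sum_distrib_left mult_ac)

lemma ct_0 [simp]: "ct E 0 = 0"
  by (simp add: ct_def)

lemma ct_sum: "ct E (sum f A) = (\<Sum>x\<in>A. ct E (f x))"
  by (induction A rule: infinite_finite_induct) (auto simp: ct_add)

lemma ct_hom:
  assumes "comm_ring_hom \<phi>"
  shows "\<phi> (ct E a) = ct (\<lambda>m. \<phi> (E m)) (map_poly \<phi> a)"
proof -
  interpret comm_ring_hom \<phi> by fact
  have "ct (\<lambda>m. \<phi> (E m)) (map_poly \<phi> a) = (\<Sum>m\<le>degree a. coeff (map_poly \<phi> a) m * \<phi> (E m))"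
    by (rule ct_superset) (simp add: degree_le coeff_map_poly coeff_eq_0)
  thus ?thesis by (simp add: ct_def hom_sum hom_mult coeff_map_poly)
qed

lemma const_poly_hom: "comm_ring_hom (\<lambda>x. [:x::'r::comm_ring_1:])"
  by unfold_locales (auto simp: one_pCons)

text \<open>
  The plethysms \<open>p\<^bsub>i+1\<^esub> \<mapsto> b\<^sub>i p\<^bsub>i+1\<^esub>\<close>, in particular \<open>f \<mapsto> f[X (1 - q)]\<close>.
\<close>

definition pscale :: "(nat \<Rightarrow> 'k) \<Rightarrow> 'k psym \<Rightarrow> ('k::comm_ring_1) psym" where
  "pscale b = peval pconst (\<lambda>i. pconst (b i) * pvar i)"

text \<open>
  The polynomial \<open>f[X + Y z]\<close> in \<open>z\<close>, where \<open>Y\<close> is an alphabet with power sums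
  \<open>p\<^bsub>i+1\<^esub>[Y] = b\<^sub>i\<close>.
\<close>

definition add_alphabet :: "(nat \<Rightarrow> 'k) \<Rightarrow> 'k psym \<Rightarrow> ('k::comm_ring_1) psym poly" where
  "add_alphabet b = peval (\<lambda>a. [:pconst a:]) (\<lambda>i. [:pvar i:] + monom (pconst (b i)) (Suc i))"

text \<open>
  The functions \<open>h\<^sub>m[- X Y]\<close>, where \<open>Y\<close> is an alphabet with power sums \<open>p\<^bsub>i+1\<^esub>[Y] = b\<^sub>i\<close>.  For
  \<open>b = 1\<close> this is \<open>(-1)\<^sup>m e\<^sub>m\<close>.
\<close>

definition neg_hom :: "(nat \<Rightarrow> 'k) \<Rightarrow> nat \<Rightarrow> ('k::field_char_0) psym" where
  "neg_hom b m = peval pconst (\<lambda>i. - (pconst (b i) * pvar i)) (phom m)"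

definition macdonald_op :: "'k \<Rightarrow> 'k \<Rightarrow> 'k psym \<Rightarrow> ('k::field_char_0) psym" where
  "macdonald_op q t f = ct (neg_hom (\<lambda>_. 1)) (add_alphabet (\<lambda>i. (1 - q ^ Suc i) * (1 - t ^ Suc i)) f)"

text \<open>
  The operator \<open>D\<close> conjugated by the plethysm \<open>X \<mapsto> X (1 - q)\<close>.  It removes \<open>1 - q\<close> from the
  alphabet that is added and moves it to the generating function, which makes its action on complete
  symmetric functions explicit.
\<close>

definition macdonald_op' :: "'k \<Rightarrow> 'k \<Rightarrow> 'k psym \<Rightarrow> ('k::field_char_0) psym" where
  "macdonald_op' q t f = ct (neg_hom (\<lambda>i. 1 - q ^ Suc i)) (add_alphabet (\<lambda>i. 1 - t ^ Suc i) f)"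

lemma pscale_hom: "comm_ring_hom (pscale b)"
  unfolding pscale_def by (rule peval_hom) (rule pconst_hom)

lemma pscale_pconst [simp]: "pscale b (pconst a) = pconst a"
  by (simp add: pscale_def pconst_hom)

lemma pscale_pvar [simp]: "pscale b (pvar i) = pconst (b i) * pvar i"
  by (simp add: pscale_def pconst_hom)

lemma poly_pconst_hom: "comm_ring_hom (\<lambda>a. [:pconst a:])"
  by (rule comm_ring_hom_comp[OF const_poly_hom pconst_hom])

lemma add_alphabet_hom: "comm_ring_hom (add_alphabet b)"
  unfolding add_alphabet_def by (rule peval_hom) (rule poly_pconst_hom)

lemma add_alphabet_pconst [simp]: "add_alphabet b (pconst a) = [:pconst a:]"
  by (simp add: add_alphabet_def poly_pconst_hom)

lemma add_alphabet_pvar [simp]: "add_alphabet b (pvar i) = [:pvar i:] + monom (pconst (b i)) (Suc i)"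
  by (simp add: add_alphabet_def poly_pconst_hom)

lemma map_poly_hom:
  assumes "comm_ring_hom \<phi>"
  shows "comm_ring_hom (map_poly \<phi>)"
proof -
  interpret comm_ring_hom \<phi> by fact
  show ?thesis
    by unfold_locales
       (auto intro!: poly_eqI simp: coeff_map_poly coeff_mult hom_sum hom_mult hom_add one_pCons map_poly_pCons)
qed

lemma pscale_macdonald_op:
  "pscale (\<lambda>i. 1 - q ^ Suc i) (macdonald_op q t f) = macdonald_op' q t (pscale (\<lambda>i. 1 - q ^ Suc i) f)"
proof -
  let ?\<phi> = "pscale (\<lambda>i. 1 - q ^ Suc i)"
  have 1: "?\<phi> (neg_hom (\<lambda>_. 1) m) = neg_hom (\<lambda>i. 1 - q ^ Suc i) m" for m
  proof -
    interpret h: comm_ring_hom "pscale (\<lambda>i. 1 - q ^ Suc i)" by (rule pscale_hom)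
    show ?thesis unfolding neg_hom_def
      by (rule peval_unique, rule pconst_hom, rule comm_ring_hom_comp[OF pscale_hom], rule peval_hom, rule pconst_hom)
         (simp_all add: pconst_hom h.hom_uminus del: power_Suc)
  qed
  have 2: "map_poly ?\<phi> (add_alphabet (\<lambda>i. (1 - q ^ Suc i) * (1 - t ^ Suc i)) f) =
      add_alphabet (\<lambda>i. 1 - t ^ Suc i) (?\<phi> f)"
  proof (rule psym_hom_eqI[where f = f])
    show "comm_ring_hom (\<lambda>f. map_poly ?\<phi> (add_alphabet (\<lambda>i. (1 - q ^ Suc i) * (1 - t ^ Suc i)) f))"
      by (rule comm_ring_hom_comp[OF map_poly_hom[OF pscale_hom] add_alphabet_hom])
    show "comm_ring_hom (\<lambda>f. add_alphabet (\<lambda>i. 1 - t ^ Suc i) (?\<phi> f))"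
      by (rule comm_ring_hom_comp[OF add_alphabet_hom pscale_hom])
  next
    interpret h: comm_ring_hom "pscale (\<lambda>i. 1 - q ^ Suc i)" by (rule pscale_hom)
    show "map_poly ?\<phi> (add_alphabet (\<lambda>i. (1 - q ^ Suc i) * (1 - t ^ Suc i)) (pconst c)) =
        add_alphabet (\<lambda>i. 1 - t ^ Suc i) (?\<phi> (pconst c))" for c
      by (simp add: map_poly_pCons del: power_Suc)
    interpret m: comm_ring_hom "map_poly (pscale (\<lambda>i. 1 - q ^ Suc i))" by (rule map_poly_hom[OF pscale_hom])
    interpret a: comm_ring_hom "add_alphabet (\<lambda>i. 1 - t ^ Suc i)" by (rule add_alphabet_hom)
    show "map_poly ?\<phi> (add_alphabet (\<lambda>i. (1 - q ^ Suc i) * (1 - t ^ Suc i)) (pvar i)) =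
        add_alphabet (\<lambda>i. 1 - t ^ Suc i) (?\<phi> (pvar i))" for i
      by (simp add: m.hom_add a.hom_mult map_poly_pCons map_poly_monom smult_add_right smult_monom
            pconst.hom_mult h.hom_mult del: power_Suc)
  qed
  show ?thesis
    unfolding macdonald_op_def macdonald_op'_def ct_hom[OF pscale_hom] 1 2 ..
qed

lemma exp_series_cong:
  assumes "exp_series a F" "\<And>n. n > 0 \<Longrightarrow> a n = b n"
  shows "exp_series b F"
proof -
  have "log_series a = log_series b" using assms(2) by (auto simp: log_series_def fps_eq_iff)
  thus ?thesis using assms(1) by (simp add: exp_series_def)
qed

text \<open>
  The identity \<open>\<Sigma>[X] \<Sigma>[- X (1 - q)] = \<Sigma>[q X]\<close> for the generating function \<open>\<Sigma>\<close> of the complete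
  symmetric functions.
\<close>

lemma neg_hom_convolution:
  "(\<Sum>j\<le>n. phom (n - j) * neg_hom (\<lambda>i. 1 - q ^ Suc i) j) = pconst (q ^ n) * (phom n :: 'k::field_char_0 psym)"
proof -
  let ?H = "Abs_fps phom :: 'k psym fps" and ?E = "Abs_fps (neg_hom (\<lambda>i. 1 - q ^ Suc i))"
  have E: "exp_series (\<lambda>r. - (pconst (1 - q ^ r) * pvar (r - 1))) ?E"
    unfolding neg_hom_def
    by (rule exp_series_cong[OF exp_series_peval[OF pconst_hom]]) auto
  have "exp_series (\<lambda>r. pconst q ^ r * pvar (r - 1)) (?H * ?E)"
    by (rule exp_series_cong[OF exp_series_mult[OF exp_series_phom E]])
       (simp add: pconst.hom_minus pconst.hom_power algebra_simps)
  moreover have "exp_series (\<lambda>r. pconst q ^ r * pvar (r - 1)) (Abs_fps (\<lambda>n. pconst q ^ n * fps_nth ?H n))"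
    by (rule exp_series_scale) (rule exp_series_phom)
  ultimately have "?H * ?E = Abs_fps (\<lambda>n. pconst q ^ n * fps_nth ?H n)"
    by (rule exp_series_unique[OF pconst_hom])
  hence "fps_nth (?E * ?H) n = fps_nth (Abs_fps (\<lambda>n. pconst q ^ n * fps_nth ?H n)) n"
    by (simp only: mult.commute)
  hence "(\<Sum>j\<le>n. neg_hom (\<lambda>i. 1 - q ^ Suc i) j * phom (n - j)) = pconst q ^ n * (phom n :: 'k psym)"
    by (simp add: fps_mult_nth atLeast0AtMost del: power_Suc)
  moreover have "(\<Sum>j\<le>n. phom (n - j) * neg_hom (\<lambda>i. 1 - q ^ Suc i) j) =
      (\<Sum>j\<le>n. neg_hom (\<lambda>i. 1 - q ^ Suc i) j * (phom (n - j) :: 'k psym))"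
    by (rule sum.cong) (simp_all only: mult.commute)
  ultimately show ?thesis by (simp only: pconst.hom_power)
qed

lemma neg_hom_0 [simp]: "neg_hom b 0 = 1"
proof -
  interpret comm_ring_hom "peval pconst (\<lambda>i. - (pconst (b i) * pvar i))"
    by (rule peval_hom[OF pconst_hom])
  show ?thesis by (simp add: neg_hom_def)
qed

text \<open>
  In generating functions, \<open>\<Sigma>[X + (1 - t) z] = \<Sigma>[X] (1 - t z s) / (1 - z s)\<close> with \<open>s\<close> marking the degree.
  Multiplied out, this becomes a relation of the kind that \<open>det_via_shifted_cofactors\<close> needs.
\<close>

lemma add_alphabet_phom_Suc:
  "add_alphabet (\<lambda>i. 1 - t ^ Suc i) (phom (Suc n)) - monom 1 1 * add_alphabet (\<lambda>i. 1 - t ^ Suc i) (phom n) =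
     [:phom (Suc n):] - monom (pconst t) 1 * [:phom n:]"
proof -
  let ?T = "add_alphabet (\<lambda>i. 1 - t ^ Suc i)"
  have V: "exp_series (\<lambda>r. [:pvar (r - 1):] + monom (pconst (1 - t ^ r)) r) (Abs_fps (\<lambda>n. ?T (phom n)))"
    unfolding add_alphabet_def
    by (rule exp_series_cong[OF exp_series_peval[OF poly_pconst_hom]]) auto
  have U: "exp_series (\<lambda>r. [:pvar (r - 1):]) (Abs_fps (\<lambda>n. [:phom n :: 'a psym:]))"
    using exp_series_hom[OF const_poly_hom exp_series_phom] by simp
  have "exp_series (\<lambda>r. [:pvar (r - 1):] + - (monom (pconst t) 1 ^ r))
     (Abs_fps (\<lambda>n. ?T (phom n)) * (1 - fps_const (monom 1 1) * fps_X))"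
    by (rule exp_series_cong[OF exp_series_mult[OF V exp_series_linear]])
       (simp add: monom_power pconst.hom_minus pconst.hom_power algebra_simps add_monom)
  moreover have "exp_series (\<lambda>r. [:pvar (r - 1):] + - (monom (pconst t) 1 ^ r))
     (Abs_fps (\<lambda>n. [:phom n:]) * (1 - fps_const (monom (pconst t) 1) * fps_X))"
    by (rule exp_series_mult[OF U exp_series_linear])
  ultimately have "Abs_fps (\<lambda>n. ?T (phom n)) * (1 - fps_const (monom 1 1) * fps_X) =
     Abs_fps (\<lambda>n. [:phom n:]) * (1 - fps_const (monom (pconst t) 1) * fps_X)"
    by (rule exp_series_unique[OF poly_pconst_hom])
  hence "fps_nth (Abs_fps (\<lambda>n. ?T (phom n)) * (1 - fps_const (monom 1 1) * fps_X)) (Suc n) =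
     fps_nth (Abs_fps (\<lambda>n. [:phom n:]) * (1 - fps_const (monom (pconst t) 1) * fps_X)) (Suc n)"
    by simp
  moreover have "fps_nth (F * (1 - fps_const c * fps_X)) (Suc n) = fps_nth F (Suc n) - c * fps_nth F n"
    for F :: "'a psym poly fps" and c
  proof -
    have "F * (1 - fps_const c * fps_X) = F - fps_const c * (F * fps_X)" by (simp add: algebra_simps)
    thus ?thesis by simp
  qed
  ultimately show ?thesis by simp
qed

section \<open>The Macdonald operator on Jacobi--Trudi determinants\<close>

definition phomz :: "int \<Rightarrow> 'k::field_char_0 psym" where
  "phomz m = (if m < 0 then 0 else phom (nat m))"

lemma add_alphabet_phomz:
  fixes t :: "'k::field_char_0"
  shows
  "add_alphabet (\<lambda>i. 1 - t ^ Suc i) (phomz m) - monom 1 1 * add_alphabet (\<lambda>i. 1 - t ^ Suc i) (phomz (m - 1)) =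
     [:phomz m:] - monom (pconst t) 1 * [:phomz (m - 1):]"
proof -
  interpret comm_ring_hom "add_alphabet (\<lambda>i. 1 - t ^ Suc i)" by (rule add_alphabet_hom)
  consider "m < 0" | "m = 0" | n where "m = int (Suc n)"
    by (metis int_cases3 not0_implies_Suc of_nat_0_less_iff less_irrefl negative_zless_0)
  thus ?thesis
  proof cases
    case 3
    hence "phomz m = (phom (Suc n) :: 'k psym)" "phomz (m - 1) = (phom n :: 'k psym)"
      by (auto simp: phomz_def nat_add_distrib)
    thus ?thesis using add_alphabet_phom_Suc[of t n] by (simp only:)
  qed (simp_all add: phomz_def one_pCons del: power_Suc)
qed

lemma coeff_add_alphabet_phomz:
  "coeff (add_alphabet (\<lambda>i. 1 - t ^ Suc i) (phomz m)) j = (if j = 0 then 1 else pconst (1 - t)) * phomz (m - int j)"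
proof (induction j arbitrary: m)
  case 0
  have "coeff (add_alphabet (\<lambda>i. 1 - t ^ Suc i) (phomz m) - monom 1 1 * add_alphabet (\<lambda>i. 1 - t ^ Suc i) (phomz (m - 1))) 0 = phomz m"
    unfolding add_alphabet_phomz by (simp add: coeff_monom_mult)
  thus ?case by (simp add: coeff_monom_mult)
next
  case (Suc j)
  have "coeff (add_alphabet (\<lambda>i. 1 - t ^ Suc i) (phomz m) - monom 1 1 * add_alphabet (\<lambda>i. 1 - t ^ Suc i) (phomz (m - 1))) (Suc j)
     = (if j = 0 then - pconst t * phomz (m - 1) else 0)"
    unfolding add_alphabet_phomz by (cases j) (simp_all add: coeff_monom_mult)
  hence "coeff (add_alphabet (\<lambda>i. 1 - t ^ Suc i) (phomz m)) (Suc j) =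
     coeff (add_alphabet (\<lambda>i. 1 - t ^ Suc i) (phomz (m - 1))) j + (if j = 0 then - pconst t * phomz (m - 1) else 0)"
    by (simp add: coeff_monom_mult algebra_simps del: power_Suc)
  also have "\<dots> = pconst (1 - t) * phomz (m - int (Suc j))"
    unfolding Suc.IH by (auto simp: pconst.hom_minus algebra_simps)
  finally show ?case by simp
qed

lemma neg_hom_convolution_phomz:
  assumes "nat m \<le> N"
  shows "(\<Sum>j\<le>N. phomz (m - int j) * neg_hom (\<lambda>i. 1 - q ^ Suc i) j) = pconst (q ^ nat m) * phomz m"
proof (cases "m < 0")
  case True
  thus ?thesis by (simp add: phomz_def)
next
  case False
  have "(\<Sum>j\<le>N. phomz (m - int j) * neg_hom (\<lambda>i. 1 - q ^ Suc i) j) =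
      (\<Sum>j\<le>nat m. phom (nat m - j) * neg_hom (\<lambda>i. 1 - q ^ Suc i) j)"
    by (rule sum.mono_neutral_cong_right)
       (use False assms in \<open>auto simp: phomz_def nat_diff_distrib simp del: power_Suc\<close>)
  also have "\<dots> = pconst (q ^ nat m) * phom (nat m)"
    by (rule neg_hom_convolution)
  finally show ?thesis using False by (simp add: phomz_def)
qed

text \<open>
  By \<open>coeff_add_alphabet_phomz\<close> the left-hand side is, up to the term \<open>j = 0\<close>, a multiple of
  \<open>\<Sum>\<^sub>j h\<^bsub>m-j\<^esub> g\<^bsub>p+j\<^esub>\<close>.  This is the convolution of \<open>neg_hom_convolution\<close> in degree \<open>m + p\<close>
  without its first \<open>p\<close> terms.
\<close>

lemma ct_shifted_add_alphabet_phomz: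
  fixes q t :: "'k::field_char_0"
  defines "g \<equiv> neg_hom (\<lambda>i. 1 - q ^ Suc i)"
  shows "ct g (monom 1 p * add_alphabet (\<lambda>i. 1 - t ^ Suc i) (phomz m)) =
    pconst t * phomz m * g p +
    pconst (1 - t) * (pconst (q ^ nat (m + int p)) * phomz (m + int p) - (\<Sum>l<p. phomz (m + int (p - l)) * g l))"
proof -
  let ?v = "add_alphabet (\<lambda>i. 1 - t ^ Suc i) (phomz m)"
  \<comment> \<open>Large enough for both the polynomial and the full convolution.\<close>
  define N where "N = max (nat m) (degree ?v)"
  have "degree (monom 1 p * ?v) \<le> p + N"
  proof (rule degree_le, intro allI impI)
    fix i assume "p + N < i"
    thus "coeff (monom 1 p * ?v) i = 0"
      by (simp add: coeff_monom_mult coeff_eq_0 N_def)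
  qed
  hence "ct g (monom 1 p * ?v) = (\<Sum>j\<le>p + N. coeff (monom 1 p * ?v) j * g j)"
    by (rule ct_superset)
  also have "\<dots> = (\<Sum>j\<in>{p..p + N}. coeff ?v (j - p) * g j)"
    by (rule sum.mono_neutral_cong_right) (auto simp: coeff_monom_mult)
  also have "\<dots> = (\<Sum>j\<in>{p..p + N}. pconst (1 - t) * (phomz (m + int p - int j) * g j) +
      (if j = p then pconst t * phomz m * g p else 0))"
    by (rule sum.cong)
       (auto simp: coeff_add_alphabet_phomz pconst.hom_minus of_nat_diff algebra_simps simp del: power_Suc)
  also have "\<dots> = pconst (1 - t) * (\<Sum>j\<in>{p..p + N}. phomz (m + int p - int j) * g j) + pconst t * phomz m * g p"
    by (simp add: sum.distrib sum_distrib_left)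
  also have "(\<Sum>j\<in>{p..p + N}. phomz (m + int p - int j) * g j) =
     (\<Sum>j\<le>p + N. phomz (m + int p - int j) * g j) - (\<Sum>l<p. phomz (m + int p - int l) * g l)"
  proof -
    have "{..p + N} = {..<p} \<union> {p..p + N}" by auto
    hence "(\<Sum>j\<le>p + N. phomz (m + int p - int j) * g j) =
       (\<Sum>l<p. phomz (m + int p - int l) * g l) + (\<Sum>j\<in>{p..p + N}. phomz (m + int p - int j) * g j)"
      by (simp add: sum.union_disjoint ivl_disj_int)
    thus ?thesis by simp
  qed
  also have "(\<Sum>j\<le>p + N. phomz (m + int p - int j) * g j) = pconst (q ^ nat (m + int p)) * phomz (m + int p)"
    unfolding g_def by (rule neg_hom_convolution_phomz) (auto simp: N_def)
  also have "(\<Sum>l<p. phomz (m + int p - int l) * g l) = (\<Sum>l<p. phomz (m + int (p - l)) * g l)"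
    by (rule sum.cong) (auto simp: of_nat_diff algebra_simps)
  finally show ?thesis by (simp add: add.commute)
qed

text \<open>
  A Jacobi--Trudi matrix with arbitrary row degrees \<open>a\<close>; for \<open>a\<^sub>i = \<nu>\<^sub>i - i\<close> its determinant is a
  Schur function.
\<close>

definition jt_mat :: "nat \<Rightarrow> (nat \<Rightarrow> int) \<Rightarrow> 'k::field_char_0 psym mat" where
  "jt_mat k a = mat k k (\<lambda>(i, j). phomz (a i + int j))"

lemma ct_pconst_mult: "ct E ([:c:] * a) = c * ct E a"
  by (simp add: ct_smult)

text \<open>
  Adding the alphabet \<open>(1 - t) z\<close> to each entry of the determinant gives a matrix that satisfies the
  relation of \<open>det_via_shifted_cofactors\<close>, with \<open>c = t z\<close>.  The resulting constant terms are known from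
  \<open>ct_shifted_add_alphabet_phomz\<close>.  The truncated sums in them meet cofactors of the wrong column and
  vanish, except for multiples of the determinant whose coefficients telescope to \<open>t\<^sup>k\<close>.
\<close>

lemma macdonald_op'_jt_cofactor:
  fixes a :: "nat \<Rightarrow> int" and q t :: "'k::field_char_0"
  assumes "0 < k"
  shows "macdonald_op' q t (det (jt_mat k a)) = pconst (t ^ k) * det (jt_mat k a) +
     pconst (1 - t) * (\<Sum>i<k. \<Sum>p<k. pconst (t ^ p * q ^ nat (a i + int p)) * phomz (a i + int p) * cofactor (jt_mat k a) i p)"
proof -
  let ?T = "add_alphabet (\<lambda>i. 1 - t ^ Suc i)"
  define g :: "nat \<Rightarrow> 'k psym" where "g = neg_hom (\<lambda>i. 1 - q ^ Suc i)"
  define A where "A = (jt_mat k a :: 'k psym mat)"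
  have A: "A \<in> carrier_mat k k" by (simp add: A_def jt_mat_def)
  define C where "C = (\<lambda>i p. cofactor A i p)"
  interpret T: comm_ring_hom ?T by (rule add_alphabet_hom)
  interpret K: comm_ring_hom "\<lambda>x. [:x::'k psym:]" by (rule const_poly_hom)
  have cofK: "cofactor (mat k k (\<lambda>(i,j). [:phomz (a i + int j) :: 'k psym:])) i p = [:C i p:]"
    if "i < k" "p < k" for i p
  proof -
    have "mat k k (\<lambda>(i,j). [:phomz (a i + int j) :: 'k psym:]) = map_mat (\<lambda>x. [:x:]) A"
      by (rule eq_matI) (auto simp: A_def jt_mat_def)
    moreover have "mat_delete (map_mat (\<lambda>x. [:x:]) A) i p = map_mat (\<lambda>x. [:x:]) (mat_delete A i p)"
      using A that by (intro eq_matI) (auto simp: mat_delete_def)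
    ultimately show ?thesis
      unfolding C_def cofactor_def by (simp only: K.hom_det K.hom_mult K.hom_power K.hom_uminus K.hom_one)
  qed
  have mon: "monom (pconst t ^ p) p * y = Polynomial.smult (pconst t ^ p) (monom 1 p * y)" for p y
    by (metis mult.right_neutral mult_smult_left smult_monom)
  have "?T (det A) = det (mat k k (\<lambda>(i,j). ?T (phomz (a i + int j))))"
  proof -
    have "map_mat ?T A = mat k k (\<lambda>(i,j). ?T (phomz (a i + int j)))"
      by (rule eq_matI) (auto simp: A_def jt_mat_def)
    thus ?thesis by (metis T.hom_det)
  qed
  also have "\<dots> = (\<Sum>i<k. \<Sum>p<k. monom (pconst t) 1 ^ p * ?T (phomz (a i + int 0)) *
      cofactor (mat k k (\<lambda>(i,j). [:phomz (a i + int j):])) i p)"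
  proof (rule det_via_shifted_cofactors[where b = "monom 1 1"])
    fix i j :: nat assume "0 < j"
    hence "a i + int (j - 1) = a i + int j - 1" by simp
    thus "?T (phomz (a i + int j)) - monom 1 1 * ?T (phomz (a i + int (j - 1))) =
        [:phomz (a i + int j):] - monom (pconst t) 1 * [:phomz (a i + int (j - 1)):]"
      by (simp only: add_alphabet_phomz)
  qed (use assms in auto)
  also have "\<dots> = (\<Sum>i<k. \<Sum>p<k. [:C i p * pconst (t ^ p):] * (monom 1 p * ?T (phomz (a i))))"
    by (intro sum.cong refl)
       (simp add: cofK monom_power pconst.hom_power mon mult_ac del: power_Suc)
  finally have "macdonald_op' q t (det A) =
      (\<Sum>i<k. \<Sum>p<k. C i p * pconst (t ^ p) * ct g (monom 1 p * ?T (phomz (a i))))"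
    unfolding macdonald_op'_def g_def by (simp only: ct_sum ct_pconst_mult)
  also have "\<dots> = (\<Sum>i<k. \<Sum>p<k. C i p * pconst (t ^ p) * (pconst t * phomz (a i) * g p +
      pconst (1 - t) * (pconst (q ^ nat (a i + int p)) * phomz (a i + int p) -
        (\<Sum>l<p. phomz (a i + int (p - l)) * g l))))"
    unfolding g_def ct_shifted_add_alphabet_phomz ..
  also have "\<dots> = (\<Sum>p<k. pconst (t ^ p) * pconst t * g p * (\<Sum>i<k. phomz (a i) * C i p)) +
      pconst (1 - t) * (\<Sum>i<k. \<Sum>p<k. pconst (t ^ p * q ^ nat (a i + int p)) * phomz (a i + int p) * C i p) -
      pconst (1 - t) * (\<Sum>i<k. \<Sum>p<k. \<Sum>l<p. pconst (t ^ p) * g l * (phomz (a i + int (p - l)) * C i p))"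
    (is "_ = ?S1 + ?S2 - ?S3")
  proof -
    have "C i p * pconst (t ^ p) * (pconst t * phomz (a i) * g p +
      pconst (1 - t) * (pconst (q ^ nat (a i + int p)) * phomz (a i + int p) -
        (\<Sum>l<p. phomz (a i + int (p - l)) * g l))) =
      pconst (t ^ p) * pconst t * g p * (phomz (a i) * C i p) +
      pconst (1 - t) * (pconst (t ^ p * q ^ nat (a i + int p)) * phomz (a i + int p) * C i p) -
      pconst (1 - t) * (\<Sum>l<p. pconst (t ^ p) * g l * (phomz (a i + int (p - l)) * C i p))" for i p
    proof -
      have "(\<Sum>l<p. pconst (t ^ p) * g l * (phomz (a i + int (p - l)) * C i p)) =
        pconst (t ^ p) * C i p * (\<Sum>l<p. phomz (a i + int (p - l)) * g l)"
        by (simp add: sum_distrib_left mult_ac)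
      thus ?thesis by (simp add: pconst.hom_mult algebra_simps)
    qed
    moreover have "?S1 = (\<Sum>i<k. \<Sum>p<k. pconst (t ^ p) * pconst t * g p * (phomz (a i) * C i p))"
      by (subst sum.swap) (simp only: sum_distrib_left)
    ultimately show ?thesis
      by (simp only: sum.distrib sum_subtractf sum_distrib_left)
  qed
  also have "?S1 = pconst t * det A"
  proof -
    have "?S1 = (\<Sum>p<k. if p = 0 then pconst t * det A else 0)"
    proof (rule sum.cong [OF refl])
      fix p assume p: "p \<in> {..<k}"
      have "(\<Sum>i<k. phomz (a i) * C i p) = (\<Sum>i<k. A $$ (i, 0) * cofactor A i p)"
        unfolding C_def by (rule sum.cong) (use assms in \<open>auto simp: A_def jt_mat_def\<close>)
      also have "\<dots> = (if 0 = p then det A else 0)"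
        by (rule cofactor_expansion_other_column) (use A p in auto)
      finally show "pconst (t ^ p) * pconst t * g p * (\<Sum>i<k. phomz (a i) * C i p) =
          (if p = 0 then pconst t * det A else 0)"
        by (simp add: g_def)
    qed
    thus ?thesis using assms by simp
  qed
  also have "?S3 = pconst (1 - t) * (\<Sum>p\<in>{1..<k}. pconst (t ^ p) * det A)"
  proof -
    have "(\<Sum>i<k. \<Sum>p<k. \<Sum>l<p. pconst (t ^ p) * g l * (phomz (a i + int (p - l)) * C i p)) =
        (\<Sum>p<k. \<Sum>l<p. pconst (t ^ p) * g l * (\<Sum>i<k. phomz (a i + int (p - l)) * C i p))"
      by (subst sum.swap, rule sum.cong [OF refl], subst sum.swap) (simp only: sum_distrib_left)
    also have "\<dots> = (\<Sum>p<k. \<Sum>l<p. if l = 0 then pconst (t ^ p) * det A else 0)"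
    proof (intro sum.cong refl)
      fix p l assume pl: "p \<in> {..<k}" "l \<in> {..<p}"
      have "(\<Sum>i<k. phomz (a i + int (p - l)) * C i p) = (\<Sum>i<k. A $$ (i, p - l) * cofactor A i p)"
        unfolding C_def by (rule sum.cong) (use pl in \<open>auto simp: A_def jt_mat_def\<close>)
      also have "\<dots> = (if p - l = p then det A else 0)"
        by (rule cofactor_expansion_other_column) (use A pl in auto)
      finally show "pconst (t ^ p) * g l * (\<Sum>i<k. phomz (a i + int (p - l)) * C i p) =
          (if l = 0 then pconst (t ^ p) * det A else 0)"
        using pl by (auto simp: g_def)
    qed
    also have "\<dots> = (\<Sum>p\<in>{1..<k}. pconst (t ^ p) * det A)"
      by (rule sum.mono_neutral_cong_right) auto
    finally show ?thesis by simp
  qed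
  also have "pconst t * det A + ?S2 - pconst (1 - t) * (\<Sum>p\<in>{1..<k}. pconst (t ^ p) * det A) =
      pconst (t - (1 - t) * (\<Sum>p\<in>{1..<k}. t ^ p)) * det A + ?S2"
    by (simp only: pconst.hom_minus pconst.hom_mult pconst.hom_sum sum_distrib_right left_diff_distrib mult.assoc)
       (simp add: sum_distrib_right)
  also have "t - (1 - t) * (\<Sum>p\<in>{1..<k}. t ^ p) = t ^ k"
  proof -
    have "(1 - t) * (\<Sum>p\<in>{1..<k}. t ^ p) = (\<Sum>p\<in>{1..<k}. t ^ p - t ^ Suc p)"
      by (simp add: sum_distrib_left algebra_simps)
    also have "\<dots> = t ^ 1 - t ^ k" using assms by (induction k rule: nat_induct_non_zero) auto
    finally show ?thesis by simp
  qed
  finally show ?thesis unfolding A_def C_def .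
qed

text \<open>
  The permutation expansion shows that the operator multiplies each term of the determinant by its
  own scalar.  The scalar of the diagonal term will be the eigenvalue.
\<close>

lemma macdonald_op'_jt:
  fixes a :: "nat \<Rightarrow> int" and q t :: "'k::field_char_0"
  shows "macdonald_op' q t (det (jt_mat k a)) =
    (\<Sum>\<sigma> | \<sigma> permutes {0..<k}. signof \<sigma> *
       pconst (t ^ k + (1 - t) * (\<Sum>i<k. t ^ \<sigma> i * q ^ nat (a i + int (\<sigma> i)))) *
       (\<Prod>i<k. phomz (a i + int (\<sigma> i))))"
proof (cases "k = 0")
  case True
  interpret comm_ring_hom "add_alphabet (\<lambda>i. 1 - t ^ Suc i)" by (rule add_alphabet_hom)
  have "det (jt_mat 0 a) = (1 :: 'k psym)" by (simp add: jt_mat_def)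
  thus ?thesis
    using True by (simp add: macdonald_op'_def ct_def del: power_Suc)
next
  case False
  hence "0 < k" by simp
  let ?f = "\<lambda>i j. phomz (a i + int j) :: 'k psym"
  have A: "jt_mat k a \<in> carrier_mat k k" by (simp add: jt_mat_def)
  have det: "det (jt_mat k a) = (\<Sum>\<sigma> | \<sigma> permutes {0..<k}. signof \<sigma> * (\<Prod>i<k. ?f i (\<sigma> i)))"
    unfolding det_def'[OF A]
    by (rule sum.cong) (auto simp: jt_mat_def atLeast0LessThan permutes_in_image intro!: prod.cong)
  have row: "(\<Sum>p<k. pconst (t ^ p * q ^ nat (a i + int p)) * ?f i p * cofactor (jt_mat k a) i p) =
     (\<Sum>\<sigma> | \<sigma> permutes {0..<k}. signof \<sigma> *
        pconst (t ^ \<sigma> i * q ^ nat (a i + int (\<sigma> i))) * (\<Prod>i<k. ?f i (\<sigma> i)))"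
    if i: "i < k" for i
  proof -
    \<comment> \<open>Scaling the entries of row \<open>i\<close> by \<open>x\<close> gives a determinant whose expansion along that row is the sum.\<close>
    define x where "x = (\<lambda>p. pconst (t ^ p * q ^ nat (a i + int p)))"
    define R where "R = (\<lambda>i' j. if i' = i then x j * ?f i j else ?f i' j)"
    have R: "mat k k (\<lambda>(i,j). R i j) \<in> carrier_mat k k" by simp
    have "(\<Sum>p<k. x p * ?f i p * cofactor (jt_mat k a) i p) =
       (\<Sum>p<k. mat k k (\<lambda>(i,j). R i j) $$ (i, p) * cofactor (mat k k (\<lambda>(i,j). R i j)) i p)"
    proof (rule sum.cong [OF refl])
      fix p assume "p \<in> {..<k}"
      hence "cofactor (jt_mat k a :: 'k psym mat) i p = cofactor (mat k k (\<lambda>(i,j). R i j)) i p"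
        unfolding jt_mat_def by (intro cofactor_cong) (use i in \<open>auto simp: R_def\<close>)
      with \<open>p \<in> {..<k}\<close> i show "x p * ?f i p * cofactor (jt_mat k a) i p =
          mat k k (\<lambda>(i,j). R i j) $$ (i, p) * cofactor (mat k k (\<lambda>(i,j). R i j)) i p"
        by (simp add: R_def)
    qed
    also have "\<dots> = det (mat k k (\<lambda>(i,j). R i j))"
      by (rule laplace_expansion_row [OF R i, symmetric])
    also have "\<dots> = (\<Sum>\<sigma> | \<sigma> permutes {0..<k}. signof \<sigma> * (\<Prod>i<k. R i (\<sigma> i)))"
      unfolding det_def'[OF R]
      by (rule sum.cong) (auto simp: atLeast0LessThan permutes_in_image intro!: prod.cong)
    also have "\<dots> = (\<Sum>\<sigma> | \<sigma> permutes {0..<k}. signof \<sigma> * x (\<sigma> i) * (\<Prod>i<k. ?f i (\<sigma> i)))"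
    proof (rule sum.cong [OF refl])
      fix \<sigma> :: "nat \<Rightarrow> nat"
      have "(\<Prod>i<k. R i (\<sigma> i)) = R i (\<sigma> i) * (\<Prod>i\<in>{..<k}-{i}. R i (\<sigma> i))"
        using i by (subst prod.remove[of _ i]) auto
      also have "(\<Prod>i\<in>{..<k}-{i}. R i (\<sigma> i)) = (\<Prod>i\<in>{..<k}-{i}. ?f i (\<sigma> i))"
        by (rule prod.cong) (auto simp: R_def)
      also have "R i (\<sigma> i) * \<dots> = x (\<sigma> i) * (?f i (\<sigma> i) * (\<Prod>i\<in>{..<k}-{i}. ?f i (\<sigma> i)))"
        by (simp add: R_def mult_ac)
      also have "?f i (\<sigma> i) * (\<Prod>i\<in>{..<k}-{i}. ?f i (\<sigma> i)) = (\<Prod>i<k. ?f i (\<sigma> i))"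
        using i by (subst prod.remove[of _ i]) auto
      finally show "signof \<sigma> * (\<Prod>i<k. R i (\<sigma> i)) = signof \<sigma> * x (\<sigma> i) * (\<Prod>i<k. ?f i (\<sigma> i))"
        by (simp add: mult_ac)
    qed
    finally show ?thesis by (simp add: x_def)
  qed
  have "macdonald_op' q t (det (jt_mat k a)) = pconst (t ^ k) * det (jt_mat k a) +
     pconst (1 - t) * (\<Sum>i<k. \<Sum>\<sigma> | \<sigma> permutes {0..<k}. signof \<sigma> *
        pconst (t ^ \<sigma> i * q ^ nat (a i + int (\<sigma> i))) * (\<Prod>i<k. ?f i (\<sigma> i)))"
    unfolding macdonald_op'_jt_cofactor[OF \<open>0 < k\<close>] by (simp add: row)
  also have "\<dots> = (\<Sum>\<sigma> | \<sigma> permutes {0..<k}. pconst (t ^ k) * (signof \<sigma> * (\<Prod>i<k. ?f i (\<sigma> i))) +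
      pconst (1 - t) * (\<Sum>i<k. signof \<sigma> *
        pconst (t ^ \<sigma> i * q ^ nat (a i + int (\<sigma> i))) * (\<Prod>i<k. ?f i (\<sigma> i))))"
    by (subst sum.swap) (simp only: det sum_distrib_left sum.distrib)
  also have "\<dots> = (\<Sum>\<sigma> | \<sigma> permutes {0..<k}. signof \<sigma> *
       pconst (t ^ k + (1 - t) * (\<Sum>i<k. t ^ \<sigma> i * q ^ nat (a i + int (\<sigma> i)))) *
       (\<Prod>i<k. ?f i (\<sigma> i)))"
  proof (rule sum.cong [OF refl])
    fix \<sigma> :: "nat \<Rightarrow> nat"
    let ?P = "signof \<sigma> * (\<Prod>i<k. ?f i (\<sigma> i))"
    have "(\<Sum>i<k. signof \<sigma> * pconst (t ^ \<sigma> i * q ^ nat (a i + int (\<sigma> i))) * (\<Prod>i<k. ?f i (\<sigma> i))) =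
       pconst (\<Sum>i<k. t ^ \<sigma> i * q ^ nat (a i + int (\<sigma> i))) * ?P"
      unfolding pconst.hom_sum sum_distrib_right by (rule sum.cong) (simp_all only: mult_ac)
    thus "pconst (t ^ k) * ?P + pconst (1 - t) * (\<Sum>i<k. signof \<sigma> *
        pconst (t ^ \<sigma> i * q ^ nat (a i + int (\<sigma> i))) * (\<Prod>i<k. ?f i (\<sigma> i))) =
      signof \<sigma> * pconst (t ^ k + (1 - t) * (\<Sum>i<k. t ^ \<sigma> i * q ^ nat (a i + int (\<sigma> i)))) *
       (\<Prod>i<k. ?f i (\<sigma> i))"
      by (simp only: pconst.hom_add pconst.hom_mult distrib_left distrib_right mult_ac)
  qed
  finally show ?thesis .
qed

section \<open>Triangular operators\<close>

context vector_space
begin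

text \<open>
  The operator \<open>D\<close> acts on the family \<open>b\<close> by the scalars \<open>e\<close>, up to members with a smaller
  statistic \<open>st\<close>.  A family takes the place of a basis, and spans take the place of coordinates.
\<close>

definition triangular_on :: "('b \<Rightarrow> 'b) \<Rightarrow> ('i \<Rightarrow> 'b) \<Rightarrow> ('i \<Rightarrow> 'a) \<Rightarrow> ('i \<Rightarrow> nat) \<Rightarrow> 'i set \<Rightarrow> bool" where
  "triangular_on D b e st A \<longleftrightarrow> finite A \<and>
     (\<forall>x\<in>A. D (b x) - scale (e x) (b x) \<in> span (b ` {y \<in> A. st y < st x}))"

end

context vector_space
begin

lemma triangular_on_span_invariant:
  assumes tri: "triangular_on D b e st A" and add: "\<And>x y. D (x + y) = D x + D y"
    and sc: "\<And>c x. D (scale c x) = scale c (D x)" and r: "r \<in> span (b ` A)"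
  shows "D r \<in> span (b ` A)"
  using r
proof (induction rule: span_induct_alt)
  case base
  have "D 0 = 0" using sc[of 0 0] by simp
  thus ?case by (simp add: span_zero)
next
  case (step c y z)
  then obtain x where x: "x \<in> A" "y = b x" by auto
  have "D (b x) - scale (e x) (b x) \<in> span (b ` A)"
    using tri x span_mono[of "b ` {y \<in> A. st y < st x}" "b ` A"] by (auto simp: triangular_on_def)
  hence "D (b x) - scale (e x) (b x) + scale (e x) (b x) \<in> span (b ` A)"
    by (rule span_add[OF _ span_scale[OF span_base]]) (use x in auto)
  hence "D y \<in> span (b ` A)" using x by simp
  thus ?case using step by (auto simp: add sc intro!: span_add span_scale)
qed

lemma triangular_on_remove:
  assumes "triangular_on D b e st A" "\<And>y. y \<in> A \<Longrightarrow> st y \<le> st x"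
  shows "triangular_on D b e st (A - {x})"
proof -
  have eq: "{y \<in> A. st y < st z} = {y \<in> A - {x}. st y < st z}" if "z \<in> A - {x}" for z
    using assms(2)[of z] that by auto
  show ?thesis
    unfolding triangular_on_def
  proof (intro conjI ballI)
    fix z assume z: "z \<in> A - {x}"
    show "D (b z) - scale (e z) (b z) \<in> span (b ` {y \<in> A - {x}. st y < st z})"
      using assms(1) z by (simp only: eq[OF z, symmetric]) (simp add: triangular_on_def)
  qed (use assms(1) in \<open>simp add: triangular_on_def\<close>)
qed

text \<open>
  One step of eliminating the eigenvalues one by one: \<open>D - e\<^sub>x\<close> maps the span into the span of the
  smaller family if \<open>x\<close> has the largest statistic.
\<close>

lemma triangular_on_eliminate:
  assumes tri: "triangular_on D b e st A" and add: "\<And>x y. D (x + y) = D x + D y"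
    and sc: "\<And>c x. D (scale c x) = scale c (D x)" and r: "r \<in> span (b ` A)"
    and x: "x \<in> A" "\<And>y. y \<in> A \<Longrightarrow> st y \<le> st x"
  shows "D r - scale (e x) r \<in> span (b ` (A - {x}))"
proof -
  have "b ` A = insert (b x) (b ` (A - {x}))" using x by auto
  with r obtain k where s: "r - scale k (b x) \<in> span (b ` (A - {x}))"
    by (auto simp: span_insert)
  define s where "s = r - scale k (b x)"
  have Ds: "D s \<in> span (b ` (A - {x}))"
    by (rule triangular_on_span_invariant[OF triangular_on_remove[OF tri x(2)] add sc]) (use s in \<open>auto simp: s_def\<close>)
  have "D (b x) - scale (e x) (b x) \<in> span (b ` {y \<in> A. st y < st x})"
    using tri x by (auto simp: triangular_on_def)
  also have "\<dots> \<subseteq> span (b ` (A - {x}))" by (rule span_mono) auto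
  finally have b: "D (b x) - scale (e x) (b x) \<in> span (b ` (A - {x}))" .
  have "r = s + scale k (b x)" by (simp add: s_def)
  hence "D r - scale (e x) r = (D s - scale (e x) s) + scale k (D (b x) - scale (e x) (b x))"
    by (simp add: add sc scale_right_distrib scale_right_diff_distrib scale_left_commute)
  thus ?thesis using Ds b s by (auto simp: s_def intro!: span_add span_diff span_scale)
qed

text \<open>
  Two triangular families without a common eigenvalue have spans that meet trivially.  If \<open>r\<close> is in
  both, remove the largest member \<open>x\<close> of the first family: \<open>D r - e\<^sub>x r\<close> is still in both spans and
  vanishes by induction.  The same holds for the second family, with another eigenvalue, so \<open>r = 0\<close>.
\<close>

lemma triangular_spans_disjoint:
  assumes add: "\<And>x y. D (x + y) = D x + D y" and sc: "\<And>c x. D (scale c x) = scale c (D x)"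
    and "triangular_on D b e st A" "triangular_on D b' e' st' A'"
    and "\<And>x x'. x \<in> A \<Longrightarrow> x' \<in> A' \<Longrightarrow> e x \<noteq> e' x'"
    and "r \<in> span (b ` A)" "r \<in> span (b' ` A')"
  shows "r = 0"
  using assms(3-)
proof (induction "card A + card A'" arbitrary: A A' r rule: less_induct)
  case less
  have fin: "finite A" "finite A'" using less.prems by (auto simp: triangular_on_def)
  show ?case
  proof (cases "A = {} \<or> A' = {}")
    case False
    obtain x where x: "x \<in> A" "\<And>y. y \<in> A \<Longrightarrow> st y \<le> st x"
    proof -
      have "Max (st ` A) \<in> st ` A" using False fin by (intro Max_in) auto
      then obtain y where "y \<in> A" "st y = Max (st ` A)" by auto
      thus ?thesis using that[of y] fin by auto
    qed
    obtain x' where x': "x' \<in> A'" "\<And>y. y \<in> A' \<Longrightarrow> st' y \<le> st' x'"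
    proof -
      have "Max (st' ` A') \<in> st' ` A'" using False fin by (intro Max_in) auto
      then obtain y where "y \<in> A'" "st' y = Max (st' ` A')" by auto
      thus ?thesis using that[of y] fin by auto
    qed
    have Dr: "D r \<in> span (b ` A)" "D r \<in> span (b' ` A')"
      by (rule triangular_on_span_invariant[OF _ add sc]; use less.prems in blast)+
    have "D r - scale (e x) r = 0"
    proof (rule less.hyps)
      show "card (A - {x}) + card A' < card A + card A'"
        using card_Diff1_less[OF fin(1) x(1)] by simp
      show "triangular_on D b e st (A - {x})" by (rule triangular_on_remove[OF less.prems(1) x(2)])
      show "D r - scale (e x) r \<in> span (b ` (A - {x}))"
        by (rule triangular_on_eliminate[OF less.prems(1) add sc less.prems(4) x])
      show "D r - scale (e x) r \<in> span (b' ` A')"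
        by (intro span_diff span_scale Dr less.prems)
    qed (use less.prems(2,3) in blast)+
    moreover have "D r - scale (e' x') r = 0"
    proof (rule less.hyps)
      show "card A + card (A' - {x'}) < card A + card A'"
        using card_Diff1_less[OF fin(2) x'(1)] by simp
      show "triangular_on D b' e' st' (A' - {x'})" by (rule triangular_on_remove[OF less.prems(2) x'(2)])
      show "D r - scale (e' x') r \<in> span (b' ` (A' - {x'}))"
        by (rule triangular_on_eliminate[OF less.prems(2) add sc less.prems(5) x'])
      show "D r - scale (e' x') r \<in> span (b ` A)"
        by (intro span_diff span_scale Dr less.prems)
    qed (use less.prems(1,3) in blast)+
    ultimately have "scale (e x - e' x') r = 0"
      by (simp add: scale_left_diff_distrib)
    thus ?thesis using less.prems(3)[OF x(1) x'(1)] by simp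
  qed (use less.prems in auto)
qed

end

lemma psym_vector_space: "vector_space (\<lambda>c (f::'k::field psym). pconst c * f)"
  by unfold_locales (auto simp: pconst.hom_add pconst.hom_mult algebra_simps)

global_interpretation psym: vector_space "\<lambda>c (f::'k::field psym). pconst c * f"
  by (rule psym_vector_space)


section \<open>Dominance and two statistics\<close>

lemma sum_lower_bound_card: "finite (A :: nat set) \<Longrightarrow> (\<Sum>i<card A. i) \<le> \<Sum>A"
proof (induction A rule: finite_linorder_max_induct)
  case (insert b A)
  have "A \<subseteq> {..<b}" using insert by auto
  hence "card A \<le> b" using card_mono[of "{..<b}" A] by simp
  moreover have "b \<notin> A" using insert by auto
  ultimately show ?case using insert by simp
qed simp

lemma sum_odd_lower_bound_card:
  assumes "finite (A :: nat set)"
  shows "(card A)\<^sup>2 \<le> (\<Sum>i\<in>A. 2 * i + 1)"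
proof -
  have "(card A)\<^sup>2 = 2 * (\<Sum>i<card A. i) + card A"
  proof -
    have "m\<^sup>2 = 2 * (\<Sum>i<m. i) + (m::nat)" for m
      by (induction m) (auto simp: power2_eq_square)
    thus ?thesis .
  qed
  also have "\<dots> \<le> 2 * \<Sum>A + card A" using sum_lower_bound_card[OF assms] by simp
  also have "\<dots> = (\<Sum>i\<in>A. 2 * i + 1)" by (simp only: sum_distrib_left sum.distrib) simp
  finally show ?thesis .
qed

lemma sum_odd_lessThan: "(\<Sum>i<m. 2 * i + 1) = (m::nat)\<^sup>2"
  by (induction m) (auto simp: power2_eq_square)

text \<open>
  The sum of the squares of the parts of the conjugate partition.  This formula also makes sense for
  compositions, and it depends only on the multiset of nonzero parts.
\<close>

definition col_stat :: "nat list \<Rightarrow> nat" where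
  "col_stat \<alpha> = (\<Sum>c<sum_list \<alpha>. (length (filter (\<lambda>x. c < x) \<alpha>))\<^sup>2)"

text \<open>
  The sum of squares is subtracted so that, like \<open>col_stat\<close>, the statistic is smaller for more
  dominant partitions.
\<close>

definition row_stat :: "nat list \<Rightarrow> nat" where
  "row_stat \<alpha> = (sum_list \<alpha>)\<^sup>2 - sum_list (map (\<lambda>x. x\<^sup>2) \<alpha>)"

lemma weighted_sum_levels:
  "(\<Sum>i<length \<alpha>. (2 * i + 1) * \<alpha> ! i) = (\<Sum>c<sum_list \<alpha>. \<Sum>i | i < length \<alpha> \<and> c < \<alpha> ! i. 2 * i + 1)"
proof -
  have "(\<Sum>i<length \<alpha>. (2 * i + 1) * \<alpha> ! i) = (\<Sum>i<length \<alpha>. \<Sum>c<sum_list \<alpha>. if c < \<alpha> ! i then 2 * i + 1 else 0)"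
  proof (rule sum.cong [OF refl])
    fix i assume "i \<in> {..<length \<alpha>}"
    hence "\<alpha> ! i \<le> sum_list \<alpha>" by (intro elem_le_sum_list) auto
    hence "(\<Sum>c<sum_list \<alpha>. if c < \<alpha> ! i then 2 * i + 1 else 0) = (\<Sum>c<\<alpha> ! i. 2 * i + 1)"
      by (intro sum.mono_neutral_cong_right) auto
    thus "(2 * i + 1) * \<alpha> ! i = (\<Sum>c<sum_list \<alpha>. if c < \<alpha> ! i then 2 * i + 1 else 0)" by simp
  qed
  also have "\<dots> = (\<Sum>c<sum_list \<alpha>. \<Sum>i<length \<alpha>. if c < \<alpha> ! i then 2 * i + 1 else 0)"
    by (rule sum.swap)
  also have "\<dots> = (\<Sum>c<sum_list \<alpha>. \<Sum>i | i < length \<alpha> \<and> c < \<alpha> ! i. 2 * i + 1)"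
    by (intro sum.cong sum.mono_neutral_cong_right) auto
  finally show ?thesis .
qed

text \<open>
  Level by level, the rows that reach a level are weighted by distinct odd numbers; \<open>k\<close> of them sum to
  at least \<open>k\<^sup>2\<close>, with equality if these are the first \<open>k\<close> rows.
\<close>

lemma col_stat_le: "col_stat \<alpha> \<le> (\<Sum>i<length \<alpha>. (2 * i + 1) * \<alpha> ! i)"
  unfolding weighted_sum_levels col_stat_def length_filter_conv_card
  by (intro sum_mono sum_odd_lower_bound_card) auto

lemma col_stat_decreasing:
  assumes "sorted_wrt (\<ge>) \<alpha>"
  shows "col_stat \<alpha> = (\<Sum>i<length \<alpha>. (2 * i + 1) * \<alpha> ! i)"
  unfolding weighted_sum_levels col_stat_def length_filter_conv_card
proof (rule sum.cong [OF refl])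
  fix c
  let ?S = "{i. i < length \<alpha> \<and> c < \<alpha> ! i}"
  have down: "i \<in> ?S" if "j \<in> ?S" "i \<le> j" for i j
  proof (cases "i = j")
    case False
    hence "\<alpha> ! j \<le> \<alpha> ! i" using assms that by (auto simp: sorted_wrt_iff_nth_less)
    thus ?thesis using that by auto
  qed (use that in auto)
  have "?S = {..<card ?S}"
  proof -
    have "finite ?S" by auto
    define m where "m = (LEAST i. i \<notin> ?S)"
    have m: "m \<notin> ?S" unfolding m_def by (rule LeastI[of _ "length \<alpha>"]) auto
    have "i \<in> ?S" if "i < m" for i using not_less_Least[of i "\<lambda>i. i \<notin> ?S"] that by (auto simp: m_def)
    moreover have "i < m" if "i \<in> ?S" for i using down[of i m] that m by (meson not_le)
    ultimately have "?S = {..<m}" by blast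
    thus ?thesis by simp
  qed
  thus "(card ?S)\<^sup>2 = (\<Sum>i\<in>?S. 2 * i + 1)" by (metis sum_odd_lessThan)
qed

lemma abel_summation:
  fixes c d :: "nat \<Rightarrow> int"
  shows "(\<Sum>i<k. c i * d i) = (\<Sum>i<k. (c i - c (Suc i)) * (\<Sum>j<Suc i. d j)) + c k * (\<Sum>j<k. d j)"
  by (induction k) (auto simp: algebra_simps)

text \<open>
  Dominance in the form in which it occurs in the expansion of a determinant: for lists of the same
  length, where \<open>\<alpha>\<close> need not be decreasing.
\<close>

definition prefix_dominates :: "nat list \<Rightarrow> nat list \<Rightarrow> bool" where
  "prefix_dominates \<alpha> \<nu> \<longleftrightarrow> length \<alpha> = length \<nu> \<and> sum_list \<alpha> = sum_list \<nu> \<and>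
     (\<forall>r\<le>length \<nu>. (\<Sum>i<r. \<nu> ! i) \<le> (\<Sum>i<r. \<alpha> ! i))"

lemma sum_squares_le: "sum_list (map (\<lambda>x. x\<^sup>2) xs) \<le> (sum_list xs :: nat)\<^sup>2"
  by (induction xs) (auto simp: power2_sum)

context
  fixes \<alpha> \<nu> :: "nat list"
  assumes dom: "prefix_dominates \<alpha> \<nu>" and sorted: "sorted_wrt (\<ge>) \<nu>"
begin

private definition "k = length \<nu>"
private definition "d i = int (\<alpha> ! i) - int (\<nu> ! i)"
private definition "S r = (\<Sum>i<r. d i)"

private lemma S_eq: "S r = int (\<Sum>i<r. \<alpha> ! i) - int (\<Sum>i<r. \<nu> ! i)"
  by (simp add: S_def d_def sum_subtractf)

private lemma S_nonneg: "r \<le> k \<Longrightarrow> 0 \<le> S r"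
proof -
  assume "r \<le> k"
  hence "int (\<Sum>i<r. \<nu> ! i) \<le> int (\<Sum>i<r. \<alpha> ! i)"
    using dom by (intro of_nat_mono) (auto simp: prefix_dominates_def k_def)
  thus ?thesis by (simp only: S_eq diff_ge_0_iff_ge)
qed

private lemma S_k: "S k = 0"
proof -
  have "(\<Sum>i<k. \<alpha> ! i) = (\<Sum>i<k. \<nu> ! i)"
    using dom by (auto simp: prefix_dominates_def k_def sum_list_sum_nth atLeast0LessThan)
  thus ?thesis by (simp only: S_eq diff_self)
qed

private lemma eq_if_S_zero:
  assumes "\<And>r. r \<le> k \<Longrightarrow> S r = 0"
  shows "\<alpha> = \<nu>"
proof (rule nth_equalityI)
  fix i assume "i < length \<alpha>"
  hence "i < k" using dom by (auto simp: prefix_dominates_def k_def)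
  hence "S (Suc i) - S i = 0" using assms[of i] assms[of "Suc i"] by simp
  thus "\<alpha> ! i = \<nu> ! i" by (simp add: S_def d_def)
qed (use dom in \<open>auto simp: prefix_dominates_def\<close>)

private lemma len: "length \<alpha> = k"
  using dom by (auto simp: prefix_dominates_def k_def)

text \<open>
  After replacing the statistic by the weighted sum of \<open>col_stat_le\<close>, summation by parts expresses the
  difference by the sums of the prefix differences, which are nonnegative.
\<close>

lemma col_stat_prefix_dominates: "col_stat \<alpha> \<le> col_stat \<nu> \<and> (\<alpha> \<noteq> \<nu> \<longrightarrow> col_stat \<alpha> < col_stat \<nu>)"
proof -
  have "(\<Sum>i<k. int (2 * i + 1) * d i) = (\<Sum>i<k. - 2 * S (Suc i))"
    using S_k by (subst abel_summation) (simp add: S_def)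
  moreover have "int (\<Sum>i<k. (2 * i + 1) * \<alpha> ! i) - int (\<Sum>i<k. (2 * i + 1) * \<nu> ! i) = (\<Sum>i<k. int (2 * i + 1) * d i)"
    unfolding of_nat_sum of_nat_mult d_def right_diff_distrib sum_subtractf ..
  moreover have "int (col_stat \<alpha>) \<le> int (\<Sum>i<k. (2 * i + 1) * \<alpha> ! i)"
    using col_stat_le[of \<alpha>] unfolding len by (simp only: of_nat_le_iff)
  moreover have "int (col_stat \<nu>) = int (\<Sum>i<k. (2 * i + 1) * \<nu> ! i)"
    using col_stat_decreasing[OF sorted] unfolding k_def by (simp only:)
  ultimately have le: "int (col_stat \<alpha>) + 2 * (\<Sum>i<k. S (Suc i)) \<le> int (col_stat \<nu>)"
    by (simp add: sum_negf sum_distrib_left)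
  have nn: "0 \<le> (\<Sum>i<k. S (Suc i))" by (rule sum_nonneg) (auto intro: S_nonneg)
  moreover have "0 < (\<Sum>i<k. S (Suc i))" if ne: "\<alpha> \<noteq> \<nu>"
  proof -
    obtain r where r: "r \<le> k" "S r \<noteq> 0" using eq_if_S_zero ne by metis
    hence "r \<noteq> 0" by (auto simp: S_def intro: Nat.gr0I)
    hence "S r \<le> (\<Sum>i<k. S (Suc i))"
      using r member_le_sum[of "r - 1" "{..<k}" "\<lambda>i. S (Suc i)"] S_nonneg by auto
    thus ?thesis using S_nonneg[of r] r by auto
  qed
  ultimately show ?thesis using le by auto
qed

text \<open>
  With \<open>\<alpha> = \<nu> + d\<close>, the sum of squares changes by \<open>2 \<Sum> \<nu>\<^sub>i d\<^sub>i + \<Sum> d\<^sub>i\<^sup>2\<close>.  Since \<open>\<nu>\<close> decreases,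
  summation by parts shows that the first sum is nonnegative.
\<close>

lemma row_stat_prefix_dominates: "row_stat \<alpha> \<le> row_stat \<nu> \<and> (\<alpha> \<noteq> \<nu> \<longrightarrow> row_stat \<alpha> < row_stat \<nu>)"
proof -
  define q where "q = (\<lambda>xs::nat list. sum_list (map (\<lambda>x. x\<^sup>2) xs))"
  have q: "int (q xs) = (\<Sum>i<length xs. (int (xs ! i))\<^sup>2)" for xs
    by (simp add: q_def sum_list_sum_nth atLeast0LessThan)
  define c where "c = (\<lambda>i. if i < k then int (\<nu> ! i) else 0)"
  have "(\<Sum>i<k. int (\<nu> ! i) * d i) = (\<Sum>i<k. c i * d i)" by (simp add: c_def)
  also have "\<dots> = (\<Sum>i<k. (c i - c (Suc i)) * S (Suc i))"
    using S_k by (subst abel_summation) (simp add: S_def)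
  also have "\<dots> \<ge> 0"
  proof (intro sum_nonneg mult_nonneg_nonneg)
    fix i assume "i \<in> {..<k}"
    thus "0 \<le> S (Suc i)" by (intro S_nonneg) auto
    show "0 \<le> c i - c (Suc i)"
      using sorted \<open>i \<in> {..<k}\<close> by (auto simp: c_def k_def sorted_wrt_iff_nth_less)
  qed
  finally have 1: "0 \<le> (\<Sum>i<k. int (\<nu> ! i) * d i)" .
  have "int (\<alpha> ! i) = int (\<nu> ! i) + d i" for i by (simp add: d_def)
  hence "int (q \<alpha>) = int (q \<nu>) + 2 * (\<Sum>i<k. int (\<nu> ! i) * d i) + (\<Sum>i<k. (d i)\<^sup>2)"
    unfolding q len by (simp add: k_def power2_sum sum.distrib sum_distrib_left mult_ac)
  moreover have "0 \<le> (\<Sum>i<k. (d i)\<^sup>2)" by (rule sum_nonneg) auto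
  moreover have "0 < (\<Sum>i<k. (d i)\<^sup>2)" if ne: "\<alpha> \<noteq> \<nu>"
  proof -
    obtain i where i: "i < k" "d i \<noteq> 0"
      using ne len by (auto simp: d_def k_def list_eq_iff_nth_eq)
    hence "(d i)\<^sup>2 \<le> (\<Sum>i<k. (d i)\<^sup>2)" by (intro member_le_sum) auto
    moreover have "0 < (d i)\<^sup>2" using i by simp
    ultimately show ?thesis by linarith
  qed
  ultimately have "q \<nu> \<le> q \<alpha> \<and> (\<alpha> \<noteq> \<nu> \<longrightarrow> q \<nu> < q \<alpha>)" using 1 by auto
  moreover have "q \<alpha> \<le> (sum_list \<alpha>)\<^sup>2" unfolding q_def by (rule sum_squares_le)
  moreover have "sum_list \<alpha> = sum_list \<nu>" using dom by (simp add: prefix_dominates_def)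
  ultimately show ?thesis unfolding row_stat_def q_def by auto
qed

end

section \<open>Triangularity of the Macdonald operator on Schur functions\<close>

definition pnorm :: "nat list \<Rightarrow> nat list" where
  "pnorm \<alpha> = rev (sort (filter (\<lambda>x. x \<noteq> 0) \<alpha>))"

lemma is_partition_pnorm: "is_partition (pnorm \<alpha>)"
  by (auto simp: is_partition_def pnorm_def sorted_wrt_rev)

lemma mset_pnorm: "mset (pnorm \<alpha>) = filter_mset (\<lambda>x. x \<noteq> 0) (mset \<alpha>)"
  by (simp add: pnorm_def)

lemma pnorm_append_zeros: "pnorm (\<alpha> @ replicate m 0) = pnorm \<alpha>"
  by (simp add: pnorm_def)

lemma pnorm_partition:
  assumes "is_partition \<nu>"
  shows "pnorm \<nu> = \<nu>"
proof -
  have "filter (\<lambda>x. x \<noteq> 0) \<nu> = \<nu>" using assms by (auto simp: is_partition_def filter_id_conv) (metis gr0I)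
  moreover have "sort \<nu> = rev \<nu>"
    by (rule properties_for_sort) (use assms in \<open>auto simp: is_partition_def sorted_wrt_rev\<close>)
  ultimately show ?thesis by (simp add: pnorm_def)
qed

lemma sum_list_filter_nonzero: "sum_list (filter (\<lambda>x. x \<noteq> 0) \<alpha>) = sum_list (\<alpha> :: nat list)"
  by (induction \<alpha>) auto

lemma sum_list_pnorm: "sum_list (pnorm \<alpha>) = sum_list \<alpha>"
proof -
  have "sum_list (pnorm \<alpha>) = sum_mset (mset (filter (\<lambda>x. x \<noteq> 0) \<alpha>))"
    unfolding sum_mset_sum_list[symmetric] mset_pnorm by simp
  thus ?thesis by (simp only: sum_mset_sum_list sum_list_filter_nonzero)
qed

lemma col_stat_pnorm: "col_stat (pnorm \<alpha>) = col_stat \<alpha>"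
proof -
  have "length (filter (\<lambda>x. c < x) xs) = size (filter_mset (\<lambda>x. c < x) (mset xs))" for c and xs :: "nat list"
    by (simp flip: mset_filter)
  moreover have "filter_mset (\<lambda>x. c < x) (filter_mset (\<lambda>x. x \<noteq> 0) M) = filter_mset (\<lambda>x. c < x) M" for c and M :: "nat multiset"
    by (auto simp: filter_filter_mset intro!: filter_mset_cong)
  ultimately show ?thesis
    by (simp add: col_stat_def sum_list_pnorm mset_pnorm)
qed

lemma row_stat_pnorm: "row_stat (pnorm \<alpha>) = row_stat \<alpha>"
proof -
  have "sum_list (map (\<lambda>x. x\<^sup>2) (pnorm \<alpha>)) = sum_mset (image_mset (\<lambda>x. x\<^sup>2) (mset (filter (\<lambda>x. x \<noteq> 0) \<alpha>)))"
    by (simp add: pnorm_def flip: sum_mset_sum_list)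
  also have "\<dots> = sum_list (map (\<lambda>x. x\<^sup>2) (filter (\<lambda>x. x \<noteq> 0) \<alpha>))"
    by (simp only: mset_map[symmetric] sum_mset_sum_list)
  also have "\<dots> = sum_list (map (\<lambda>x. x\<^sup>2) \<alpha>)" by (induction \<alpha>) auto
  finally show ?thesis by (simp add: row_stat_def sum_list_pnorm)
qed

definition phprod :: "nat list \<Rightarrow> 'k::field_char_0 psym" where
  "phprod \<alpha> = prod_list (map phom \<alpha>)"

lemma phprod_nth: "phprod \<alpha> = (\<Prod>i<length \<alpha>. phom (\<alpha> ! i))"
  unfolding phprod_def prod.list_conv_set_nth by (rule prod.cong) auto

lemma phprod_pnorm: "phprod (pnorm \<alpha>) = phprod \<alpha>"
proof -
  have "phprod (pnorm \<alpha>) = prod_mset (image_mset phom (mset (filter (\<lambda>x. x \<noteq> 0) \<alpha>)))"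
    by (simp add: phprod_def pnorm_def flip: prod_mset_prod_list)
  also have "\<dots> = prod_list (map phom (filter (\<lambda>x. x \<noteq> 0) \<alpha>))"
    by (simp only: mset_map[symmetric] prod_mset_prod_list)
  also have "\<dots> = phprod \<alpha>" unfolding phprod_def by (induction \<alpha>) auto
  finally show ?thesis .
qed

definition pschur :: "nat list \<Rightarrow> 'k::field_char_0 psym" where
  "pschur \<nu> = det (jt_mat (length \<nu>) (\<lambda>i. int (\<nu> ! i) - int i))"

definition jt_term :: "nat list \<Rightarrow> (nat \<Rightarrow> nat) \<Rightarrow> 'k::field_char_0 psym" where
  "jt_term \<nu> \<sigma> = (\<Prod>i<length \<nu>. phomz (int (\<nu> ! i) - int i + int (\<sigma> i)))"

lemma pschur_expand: "pschur \<nu> = (\<Sum>\<sigma> | \<sigma> permutes {0..<length \<nu>}. signof \<sigma> * jt_term \<nu> \<sigma>)"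
  unfolding pschur_def jt_mat_def jt_term_def
  by (subst det_def'[of _ "length \<nu>"], simp, rule sum.cong)
     (auto simp: atLeast0LessThan permutes_in_image intro!: prod.cong)

lemma jt_term_id: "jt_term \<nu> id = phprod \<nu>"
proof -
  have "jt_term \<nu> id = (\<Prod>i<length \<nu>. phom (\<nu> ! i))"
    unfolding jt_term_def by (rule prod.cong) (auto simp: phomz_def)
  also have "\<dots> = phprod \<nu>"
    by (simp add: phprod_nth)
  finally show ?thesis .
qed

text \<open>
  A permutation other than the identity moves degree towards the first rows: the sum of \<open>r\<close> distinct
  values \<open>\<sigma>(i)\<close> is at least \<open>0 + \<dots> + (r - 1)\<close>.
\<close>

lemma jt_term_dominates:
  assumes \<sigma>: "\<sigma> permutes {0..<length \<nu>}" "\<sigma> \<noteq> id"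
  shows "jt_term \<nu> \<sigma> = 0 \<or> (\<exists>\<alpha>. jt_term \<nu> \<sigma> = phprod \<alpha> \<and> prefix_dominates \<alpha> \<nu> \<and> \<alpha> \<noteq> \<nu>)"
proof (cases "\<exists>i<length \<nu>. int (\<nu> ! i) - int i + int (\<sigma> i) < 0")
  case True
  then obtain i where "i < length \<nu>" "int (\<nu> ! i) - int i + int (\<sigma> i) < 0" by blast
  hence "jt_term \<nu> \<sigma> = 0"
    unfolding jt_term_def by (intro prod_zero) (auto simp: phomz_def intro!: bexI[of _ i])
  thus ?thesis ..
next
  case False
  define k where "k = length \<nu>"
  define \<alpha> where "\<alpha> = map (\<lambda>i. nat (int (\<nu> ! i) - int i + int (\<sigma> i))) [0..<k]"
  have len: "length \<alpha> = k" by (simp add: \<alpha>_def)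
  have nth: "int (\<alpha> ! i) = int (\<nu> ! i) - int i + int (\<sigma> i)" if "i < k" for i
    using False that by (force simp: \<alpha>_def k_def)
  have prefix: "int (\<Sum>i<r. \<alpha> ! i) = int (\<Sum>i<r. \<nu> ! i) + (int (\<Sum>i<r. \<sigma> i) - int (\<Sum>i<r. i))" if "r \<le> k" for r
  proof -
    have "int (\<Sum>i<r. \<alpha> ! i) = (\<Sum>i<r. int (\<nu> ! i) - int i + int (\<sigma> i))"
      unfolding of_nat_sum by (rule sum.cong) (use nth that in auto)
    thus ?thesis by (simp add: sum.distrib sum_subtractf)
  qed
  have inj: "inj_on \<sigma> A" for A using permutes_inj_on[OF \<sigma>(1)] .
  have "sum_list \<alpha> = sum_list \<nu>"
  proof -
    have "(\<Sum>i<k. \<sigma> i) = (\<Sum>i<k. i)"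
      using sum.permute[OF \<sigma>(1), of "\<lambda>x. x"] by (simp add: k_def atLeast0LessThan comp_def)
    hence "int (\<Sum>i<k. \<alpha> ! i) = int (\<Sum>i<k. \<nu> ! i)"
      using prefix[of k] by simp
    hence "(\<Sum>i<k. \<alpha> ! i) = (\<Sum>i<k. \<nu> ! i)" by (simp only: of_nat_eq_iff)
    thus ?thesis by (simp add: sum_list_sum_nth len atLeast0LessThan k_def)
  qed
  moreover have "(\<Sum>i<r. \<nu> ! i) \<le> (\<Sum>i<r. \<alpha> ! i)" if "r \<le> k" for r
  proof -
    have "(\<Sum>i<r. i) \<le> (\<Sum>i<r. \<sigma> i)"
      using sum_lower_bound_card[of "\<sigma> ` {..<r}"] inj[of "{..<r}"] by (simp add: card_image sum.reindex)
    thus ?thesis using prefix[OF that] by linarith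
  qed
  ultimately have "prefix_dominates \<alpha> \<nu>"
    using len by (simp add: prefix_dominates_def k_def)
  moreover have "\<alpha> \<noteq> \<nu>"
  proof
    assume "\<alpha> = \<nu>"
    hence "\<sigma> i = i" for i
      using nth[of i] permutes_not_in[OF \<sigma>(1), of i] by (cases "i < k") (auto simp: k_def)
    thus False using \<sigma>(2) by auto
  qed
  moreover have "jt_term \<nu> \<sigma> = phprod \<alpha>"
  proof -
    have "jt_term \<nu> \<sigma> = (\<Prod>i<k. phom (\<alpha> ! i))"
      unfolding jt_term_def k_def[symmetric]
    proof (rule prod.cong [OF refl])
      fix i assume "i \<in> {..<k}"
      hence "int (\<nu> ! i) - int i + int (\<sigma> i) = int (\<alpha> ! i)" using nth by simp
      thus "phomz (int (\<nu> ! i) - int i + int (\<sigma> i)) = phom (\<alpha> ! i)" by (simp add: phomz_def)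
    qed
    also have "\<dots> = phprod \<alpha>" by (simp add: phprod_nth len)
    finally show ?thesis .
  qed
  ultimately show ?thesis by blast
qed

definition partitions_of :: "nat \<Rightarrow> nat list set" where
  "partitions_of n = {\<nu>. is_partition \<nu> \<and> sum_list \<nu> = n}"

lemma length_le_sum_list: "0 \<notin> set xs \<Longrightarrow> length xs \<le> sum_list (xs :: nat list)"
  by (induction xs) auto

lemma finite_partitions_of [simp, intro]: "finite (partitions_of n)"
proof (rule finite_subset)
  show "partitions_of n \<subseteq> {xs. set xs \<subseteq> {..n} \<and> length xs \<le> n}"
    using length_le_sum_list by (auto simp: partitions_of_def is_partition_def intro: member_le_sum_list)
  show "finite {xs. set xs \<subseteq> {..n} \<and> length xs \<le> n}"
    by (rule finite_lists_length_le) auto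
qed

text \<open>
  The polynomial \<open>B\<^sub>\<nu>(q, t)\<close>.
\<close>

definition cell_sum :: "'k \<Rightarrow> 'k \<Rightarrow> nat list \<Rightarrow> 'k::comm_ring_1" where
  "cell_sum q t \<nu> = (\<Sum>i<length \<nu>. t ^ i * (\<Sum>j<\<nu> ! i. q ^ j))"

definition macdonald_eigenvalue :: "'k \<Rightarrow> 'k \<Rightarrow> nat list \<Rightarrow> 'k::comm_ring_1" where
  "macdonald_eigenvalue q t \<nu> = 1 - (1 - q) * (1 - t) * cell_sum q t \<nu>"

lemma macdonald_eigenvalue_alt:
  "macdonald_eigenvalue q t \<nu> = t ^ length \<nu> + (1 - t) * (\<Sum>i<length \<nu>. t ^ i * q ^ (\<nu> ! i))"
proof -
  have "(1 - q) * cell_sum q t \<nu> = (\<Sum>i<length \<nu>. t ^ i * ((1 - q) * (\<Sum>j<\<nu> ! i. q ^ j)))"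
    unfolding cell_sum_def sum_distrib_left by (rule sum.cong) (auto simp: mult_ac sum_distrib_left)
  also have "\<dots> = (\<Sum>i<length \<nu>. t ^ i) - (\<Sum>i<length \<nu>. t ^ i * q ^ (\<nu> ! i))"
    by (simp add: one_diff_power_eq[symmetric] right_diff_distrib sum_subtractf)
  finally have "(1 - q) * (1 - t) * cell_sum q t \<nu> =
      (1 - t) * (\<Sum>i<length \<nu>. t ^ i) - (1 - t) * (\<Sum>i<length \<nu>. t ^ i * q ^ (\<nu> ! i))"
    by (metis mult.assoc mult.commute right_diff_distrib)
  also have "(1 - t) * (\<Sum>i<length \<nu>. t ^ i) = 1 - t ^ length \<nu>"
    by (simp add: one_diff_power_eq)
  finally show ?thesis by (simp add: macdonald_eigenvalue_def)
qed

text \<open>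
  A statistic that is strictly monotone with respect to dominance and can therefore order a triangular
  system.  Two of them are needed: one for the \<open>q\<close>-plethysm and one for the \<open>t\<close>-plethysm, because the
  eigenvalues of the two systems are separated by comparing a statistic of the one with a statistic of
  the other.
\<close>

locale partition_statistic =
  fixes st :: "nat list \<Rightarrow> nat"
  assumes pnorm: "st (pnorm \<alpha>) = st \<alpha>"
    and dom: "prefix_dominates \<alpha> \<nu> \<Longrightarrow> sorted_wrt (\<ge>) \<nu> \<Longrightarrow> st \<alpha> \<le> st \<nu> \<and> (\<alpha> \<noteq> \<nu> \<longrightarrow> st \<alpha> < st \<nu>)"
begin

text \<open>
  Both partitions are padded with zeros to the same length in order to compare them as in
  \<open>prefix_dominates\<close>.
\<close>

lemma dominates_le:
  assumes "\<nu> \<unrhd> \<mu>" "sorted_wrt (\<ge>) \<mu>"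
  shows "st \<nu> \<le> st \<mu> \<and> (is_partition \<nu> \<longrightarrow> is_partition \<mu> \<longrightarrow> \<nu> \<noteq> \<mu> \<longrightarrow> st \<nu> < st \<mu>)"
proof -
  define k where "k = max (length \<nu>) (length \<mu>)"
  define pad where "pad = (\<lambda>xs::nat list. xs @ replicate (k - length xs) 0)"
  have st_pad: "st (pad xs) = st xs" for xs
    using pnorm[of "pad xs"] pnorm[of xs] by (simp add: pad_def pnorm_append_zeros)
  have len: "length (pad \<nu>) = k" "length (pad \<mu>) = k" by (auto simp: pad_def k_def)
  have pre: "(\<Sum>i<r. pad xs ! i) = sum_list (take r xs)" if "r \<le> length (pad xs)" for r xs
  proof -
    have "(\<Sum>i<r. pad xs ! i) = sum_list (take r (pad xs))"
      using that by (simp add: sum_list_sum_nth atLeast0LessThan min_absorb2)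
    thus ?thesis by (simp add: pad_def sum_list_replicate take_replicate)
  qed
  have "prefix_dominates (pad \<nu>) (pad \<mu>)"
    unfolding prefix_dominates_def
  proof (intro conjI allI impI)
    show "sum_list (pad \<nu>) = sum_list (pad \<mu>)"
      using assms(1) by (simp add: pad_def dominates_def sum_list_replicate)
    fix r assume "r \<le> length (pad \<mu>)"
    thus "(\<Sum>i<r. pad \<mu> ! i) \<le> (\<Sum>i<r. pad \<nu> ! i)"
      using assms(1) len by (simp add: pre dominates_def)
  qed (use len in auto)
  moreover have "sorted_wrt (\<ge>) (pad \<mu>)"
    using assms(2) by (auto simp: pad_def sorted_wrt_append sorted_wrt_iff_nth_less[of _ "replicate _ _"])
  ultimately have "st (pad \<nu>) \<le> st (pad \<mu>) \<and> (pad \<nu> \<noteq> pad \<mu> \<longrightarrow> st (pad \<nu>) < st (pad \<mu>))"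
    by (rule dom)
  moreover have "pad \<nu> \<noteq> pad \<mu>" if "is_partition \<nu>" "is_partition \<mu>" "\<nu> \<noteq> \<mu>"
    using pnorm_partition[OF that(1)] pnorm_partition[OF that(2)] that(3)
    by (metis pad_def pnorm_append_zeros)
  ultimately show ?thesis by (auto simp: st_pad)
qed

lemma jt_term_lower:
  assumes "\<sigma> permutes {0..<length \<nu>}" "\<sigma> \<noteq> id" "is_partition \<nu>"
  shows "jt_term \<nu> \<sigma> = 0 \<or> (\<exists>\<alpha>. jt_term \<nu> \<sigma> = phprod \<alpha> \<and> sum_list \<alpha> = sum_list \<nu> \<and> st \<alpha> < st \<nu>)"
  using jt_term_dominates[OF assms(1,2)] dom[of _ \<nu>] assms(3)
  by (auto simp: prefix_dominates_def is_partition_def)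

text \<open>
  The Jacobi--Trudi determinant expresses a Schur function as a product of complete functions plus
  such products with a smaller statistic.  This is solved for the product by induction on the statistic.
\<close>

lemma phprod_in_span:
  "(phprod \<alpha> :: 'k::field_char_0 psym) \<in> psym.span (pschur ` {\<kappa> \<in> partitions_of (sum_list \<alpha>). st \<kappa> \<le> st \<alpha>})"
proof (induction "st \<alpha>" arbitrary: \<alpha> rule: less_induct)
  case less
  define \<nu> where "\<nu> = pnorm \<alpha>"
  have \<nu>: "is_partition \<nu>" "sum_list \<nu> = sum_list \<alpha>" "st \<nu> = st \<alpha>"
    by (auto simp: \<nu>_def is_partition_pnorm sum_list_pnorm pnorm)
  let ?V = "psym.span (pschur ` {\<kappa> \<in> partitions_of (sum_list \<alpha>). st \<kappa> \<le> st \<alpha>}) :: 'k psym set"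
  let ?P = "{\<sigma>. \<sigma> permutes {0..<length \<nu>}}"
  have fin: "finite ?P" by (simp add: finite_permutations)
  have lower: "signof \<sigma> * jt_term \<nu> \<sigma> \<in> ?V" if \<sigma>: "\<sigma> \<in> ?P - {id}" for \<sigma>
  proof -
    have "jt_term \<nu> \<sigma> \<in> ?V"
    proof (cases "jt_term \<nu> \<sigma> = (0 :: 'k psym)")
      case False
      then obtain \<beta> where \<beta>: "jt_term \<nu> \<sigma> = (phprod \<beta> :: 'k psym)" "sum_list \<beta> = sum_list \<alpha>" "st \<beta> < st \<alpha>"
        using jt_term_lower[of \<sigma> \<nu>] \<sigma> \<nu> by auto
      have "(phprod \<beta> :: 'k psym) \<in> psym.span (pschur ` {\<kappa> \<in> partitions_of (sum_list \<beta>). st \<kappa> \<le> st \<beta>})"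
        by (rule less) (use \<beta> in auto)
      also have "\<dots> \<subseteq> ?V" by (rule psym.span_mono) (use \<beta> in auto)
      finally show ?thesis using \<beta> by simp
    qed (simp add: psym.span_zero)
    thus ?thesis using psym.span_scale[of "jt_term \<nu> \<sigma>" _ "signof \<sigma>"] by simp
  qed
  have "pschur \<nu> = phprod \<nu> + (\<Sum>\<sigma>\<in>?P - {id}. signof \<sigma> * (jt_term \<nu> \<sigma> :: 'k psym))"
    unfolding pschur_expand
    by (subst sum.remove[of _ id]) (auto simp: fin permutes_id jt_term_id)
  hence "phprod \<alpha> = pschur \<nu> - (\<Sum>\<sigma>\<in>?P - {id}. signof \<sigma> * (jt_term \<nu> \<sigma> :: 'k psym))"
    using phprod_pnorm[of \<alpha>, where ?'a = 'k] by (simp add: \<nu>_def)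
  also have "\<dots> \<in> ?V"
    using \<nu> by (intro psym.span_diff psym.span_sum lower psym.span_base) (auto simp: partitions_of_def)
  finally show ?case .
qed

text \<open>
  Each off-diagonal term of the determinant is multiplied by some scalar, and all these terms are
  lower; the diagonal one is multiplied by the eigenvalue.
\<close>

lemma macdonald_op'_pschur:
  assumes "is_partition \<nu>" "sum_list \<nu> = n"
  shows "macdonald_op' q t (pschur \<nu>) - pconst (macdonald_eigenvalue q t \<nu>) * pschur \<nu> \<in>
    psym.span (pschur ` {\<kappa> \<in> partitions_of n. st \<kappa> < st \<nu>})"
proof -
  let ?k = "length \<nu>"
  define E where "E = (\<lambda>\<sigma>. t ^ ?k + (1 - t) * (\<Sum>i<?k. t ^ \<sigma> i * q ^ nat (int (\<nu> ! i) - int i + int (\<sigma> i))))"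
  have E_id: "E id = macdonald_eigenvalue q t \<nu>"
    by (simp add: E_def macdonald_eigenvalue_alt)
  have "macdonald_op' q t (pschur \<nu>) - pconst (E id) * pschur \<nu> =
     (\<Sum>\<sigma> | \<sigma> permutes {0..<?k}. signof \<sigma> * pconst (E \<sigma>) * jt_term \<nu> \<sigma>) -
     (\<Sum>\<sigma> | \<sigma> permutes {0..<?k}. pconst (E id) * (signof \<sigma> * jt_term \<nu> \<sigma>))"
    unfolding pschur_expand[symmetric] sum_distrib_left[symmetric]
    unfolding pschur_def macdonald_op'_jt E_def jt_term_def ..
  also have "\<dots> = (\<Sum>\<sigma> | \<sigma> permutes {0..<?k}. pconst (E \<sigma> - E id) * (signof \<sigma> * jt_term \<nu> \<sigma>))"
    unfolding sum_subtractf[symmetric] pconst.hom_minus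
    by (rule sum.cong) (simp_all add: algebra_simps)
  also have "\<dots> \<in> psym.span (pschur ` {\<kappa> \<in> partitions_of n. st \<kappa> < st \<nu>})" (is "_ \<in> ?V")
  proof (rule psym.span_sum)
    fix \<sigma> assume \<sigma>: "\<sigma> \<in> {\<sigma>. \<sigma> permutes {0..<?k}}"
    show "pconst (E \<sigma> - E id) * (signof \<sigma> * jt_term \<nu> \<sigma>) \<in> ?V"
    proof (cases "\<sigma> = id \<or> jt_term \<nu> \<sigma> = (0 :: 'a psym)")
      case False
      then obtain \<beta> where \<beta>: "jt_term \<nu> \<sigma> = (phprod \<beta> :: 'a psym)" "sum_list \<beta> = n" "st \<beta> < st \<nu>"
        using jt_term_lower[of \<sigma> \<nu>] \<sigma> assms by auto
      have "(phprod \<beta> :: 'a psym) \<in> psym.span (pschur ` {\<kappa> \<in> partitions_of (sum_list \<beta>). st \<kappa> \<le> st \<beta>})"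
        by (rule phprod_in_span)
      also have "\<dots> \<subseteq> ?V" by (rule psym.span_mono) (use \<beta> in auto)
      finally have "pconst (signof \<sigma>) * jt_term \<nu> \<sigma> \<in> ?V"
        using \<beta> by (intro psym.span_scale) auto
      hence "signof \<sigma> * jt_term \<nu> \<sigma> \<in> ?V" by simp
      thus ?thesis by (rule psym.span_scale)
    qed (auto simp: psym.span_zero)
  qed
  finally show ?thesis by (simp only: E_id)
qed

end

interpretation col: partition_statistic col_stat
  by unfold_locales (auto simp: col_stat_pnorm col_stat_prefix_dominates)

interpretation row: partition_statistic row_stat
  by unfold_locales (auto simp: row_stat_pnorm row_stat_prefix_dominates)

section \<open>Macdonald functions are eigenvectors\<close>

lemma macdonald_op'_add: "macdonald_op' q t (f + g) = macdonald_op' q t f + macdonald_op' q t g"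
proof -
  interpret comm_ring_hom "add_alphabet (\<lambda>i. 1 - t ^ Suc i)" by (rule add_alphabet_hom)
  show ?thesis by (simp only: macdonald_op'_def hom_add ct_add)
qed

lemma macdonald_op'_scale: "macdonald_op' q t (pconst c * f) = pconst c * macdonald_op' q t f"
proof -
  interpret comm_ring_hom "add_alphabet (\<lambda>i. 1 - t ^ Suc i)" by (rule add_alphabet_hom)
  show ?thesis by (simp only: macdonald_op'_def hom_mult add_alphabet_pconst ct_pconst_mult)
qed

lemma macdonald_op_add: "macdonald_op q t (f + g) = macdonald_op q t f + macdonald_op q t g"
proof -
  interpret comm_ring_hom "add_alphabet (\<lambda>i. (1 - q ^ Suc i) * (1 - t ^ Suc i))" by (rule add_alphabet_hom)
  show ?thesis by (simp only: macdonald_op_def hom_add ct_add)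
qed

lemma macdonald_op_scale: "macdonald_op q t (pconst c * f) = pconst c * macdonald_op q t f"
proof -
  interpret comm_ring_hom "add_alphabet (\<lambda>i. (1 - q ^ Suc i) * (1 - t ^ Suc i))" by (rule add_alphabet_hom)
  show ?thesis by (simp only: macdonald_op_def hom_mult add_alphabet_pconst ct_pconst_mult)
qed

text \<open>
  This symmetry, which the conjugated operator \<open>macdonald_op'\<close> does not have, lets both span conditions
  act on the same operator.
\<close>

lemma macdonald_op_commute: "macdonald_op q t f = macdonald_op t q f"
  by (simp only: macdonald_op_def mult.commute)

lemma pscale_pscale: "pscale b (pscale c f) = pscale (\<lambda>i. b i * c i) f"
proof (rule psym_hom_eqI[where f = f])
  interpret comm_ring_hom "pscale b" by (rule pscale_hom)
  show "comm_ring_hom (\<lambda>f. pscale b (pscale c f))"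
    by (rule comm_ring_hom_comp[OF pscale_hom pscale_hom])
  show "pscale b (pscale c (pvar i)) = pscale (\<lambda>i. b i * c i) (pvar i)" for i
    by (simp add: hom_mult pconst.hom_mult mult_ac)
qed (auto intro: pscale_hom)

lemma pscale_id:
  assumes "\<And>i. b i = 1"
  shows "pscale b f = f"
proof (rule psym_hom_eqI[where f = f and \<psi> = "\<lambda>f. f"])
  show "comm_ring_hom (\<lambda>f. f :: 'a psym)" by unfold_locales auto
qed (auto intro: pscale_hom simp: assms)

text \<open>
  The plethysm \<open>X \<mapsto> X / (1 - q)\<close>, defined if \<open>q\<close> is not a root of unity.
\<close>

definition unscale :: "'k \<Rightarrow> 'k psym \<Rightarrow> 'k::field_char_0 psym" where
  "unscale q = pscale (\<lambda>i. inverse (1 - q ^ Suc i))"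

lemma unscale_pscale:
  assumes "\<And>i. q ^ Suc i \<noteq> 1"
  shows "unscale q (pscale (\<lambda>i. 1 - q ^ Suc i) f) = f"
  unfolding unscale_def pscale_pscale
  by (rule pscale_id) (use assms in \<open>simp del: power_Suc\<close>)

lemma pscale_unscale:
  assumes "\<And>i. q ^ Suc i \<noteq> 1"
  shows "pscale (\<lambda>i. 1 - q ^ Suc i) (unscale q f) = f"
  unfolding unscale_def pscale_pscale
  by (rule pscale_id) (use assms in \<open>simp del: power_Suc\<close>)

lemma pscale_in_span:
  assumes "f \<in> psym.span S"
  shows "pscale b f \<in> psym.span (pscale b ` S)"
proof -
  interpret comm_ring_hom "pscale b" by (rule pscale_hom)
  show ?thesis
    using assms
  proof (induction rule: psym.span_induct_alt)
    case (step c x y)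
    thus ?case
      unfolding hom_add hom_mult pscale_pconst
      by (intro psym.span_add psym.span_scale) (auto intro: psym.span_base)
  qed (simp add: psym.span_zero)
qed

context partition_statistic
begin

lemma triangular_on_pschur:
  assumes q: "\<And>i. q ^ Suc i \<noteq> (1 :: 'k::field_char_0)"
    and P: "\<And>a b. a < b \<Longrightarrow> P b \<Longrightarrow> P a"
  shows "psym.triangular_on (macdonald_op q t) (\<lambda>\<nu>. unscale q (pschur \<nu>)) (macdonald_eigenvalue q t) st
     {\<kappa> \<in> partitions_of n. P (st \<kappa>)}"
  unfolding psym.triangular_on_def
proof (intro conjI ballI)
  fix \<nu> assume \<nu>: "\<nu> \<in> {\<kappa> \<in> partitions_of n. P (st \<kappa>)}"
  let ?e = "macdonald_eigenvalue q t \<nu>" and ?s = "pschur \<nu> :: 'k psym"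
  interpret comm_ring_hom "unscale q" unfolding unscale_def by (rule pscale_hom)
  have "macdonald_op q t (unscale q ?s) = unscale q (pscale (\<lambda>i. 1 - q ^ Suc i) (macdonald_op q t (unscale q ?s)))"
    by (rule unscale_pscale[OF q, symmetric])
  also have "\<dots> = unscale q (macdonald_op' q t ?s)"
    by (simp only: pscale_macdonald_op pscale_unscale[OF q])
  finally have "macdonald_op q t (unscale q ?s) - pconst ?e * unscale q ?s =
      unscale q (macdonald_op' q t ?s - pconst ?e * ?s)"
    by (simp add: hom_minus hom_mult) (simp add: unscale_def)
  also have "\<dots> \<in> psym.span (unscale q ` (pschur ` {\<kappa> \<in> partitions_of n. st \<kappa> < st \<nu>}))"
    unfolding unscale_def by (intro pscale_in_span macdonald_op'_pschur) (use \<nu> in \<open>auto simp: partitions_of_def\<close>)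
  also have "\<dots> \<subseteq> psym.span ((\<lambda>\<nu>. unscale q (pschur \<nu>)) ` {\<kappa> \<in> {\<kappa> \<in> partitions_of n. P (st \<kappa>)}. st \<kappa> < st \<nu>})"
    by (rule psym.span_mono) (use \<nu> P in auto)
  finally show "macdonald_op q t (unscale q ?s) - pconst ?e * unscale q ?s \<in>
    psym.span ((\<lambda>\<nu>. unscale q (pschur \<nu>)) ` {\<kappa> \<in> {\<kappa> \<in> partitions_of n. P (st \<kappa>)}. st \<kappa> < st \<nu>})" .
qed auto

end

lemma conjugate_nth:
  assumes "is_partition \<mu>" "j < length (conjugate \<mu>)"
  shows "conjugate \<mu> ! j = length (filter (\<lambda>x. j < x) \<mu>)"
proof -
  have "{i. (i, j) \<in> cells \<mu>} = {i. i < length \<mu> \<and> j < \<mu> ! i}" by (auto simp: cells_def)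
  thus ?thesis using assms by (simp add: conjugate_def length_filter_conv_card)
qed

lemma sum_list_eq_sum_levels: "sum_list \<mu> \<le> N \<or> (\<forall>x\<in>set \<mu>. x \<le> N) \<Longrightarrow> sum_list \<mu> = (\<Sum>c<N. length (filter (\<lambda>x. c < x) \<mu>))"
proof (induction \<mu>)
  case (Cons a \<mu>)
  have "a \<le> N" using Cons.prems by auto
  have "(\<Sum>c<N. if c < a then 1 else 0) = (\<Sum>c<a. 1::nat)"
    by (rule sum.mono_neutral_cong_right) (use \<open>a \<le> N\<close> in auto)
  hence a: "(\<Sum>c<N. if c < a then 1 else 0) = a" by simp
  have "(\<Sum>c<N. length (filter (\<lambda>x. c < x) (a # \<mu>))) =
      (\<Sum>c<N. (if c < a then 1 else 0) + length (filter (\<lambda>x. c < x) \<mu>))"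
    by (rule sum.cong) auto
  also have "\<dots> = a + (\<Sum>c<N. length (filter (\<lambda>x. c < x) \<mu>))" by (simp add: sum.distrib a)
  finally show ?case using Cons by auto
qed simp

lemma conjugate_props:
  assumes "is_partition \<mu>"
  shows "sum_list (conjugate \<mu>) = sum_list \<mu>" "sorted_wrt (\<ge>) (conjugate \<mu>)"
    "sum_list (map (\<lambda>x. x\<^sup>2) (conjugate \<mu>)) = col_stat \<mu>"
proof -
  define l where "l = length (conjugate \<mu>)"
  have l: "l = sum_list (take 1 \<mu>)" by (simp add: l_def conjugate_def)
  have le: "\<forall>x\<in>set \<mu>. x \<le> l"
    using assms by (cases \<mu>) (auto simp: l is_partition_def)
  have nth: "conjugate \<mu> ! j = length (filter (\<lambda>x. j < x) \<mu>)" if "j < l" for j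
    using conjugate_nth[OF assms] that by (simp add: l_def)
  have zero: "filter (\<lambda>x. j < x) \<mu> = []" if "l \<le> j" for j
    using le that by (auto simp: filter_empty_conv)
  have "sum_list (conjugate \<mu>) = (\<Sum>j<l. length (filter (\<lambda>x. j < x) \<mu>))"
    unfolding sum_list_sum_nth l_def[symmetric] atLeast0LessThan by (rule sum.cong) (auto simp: nth)
  also have "\<dots> = sum_list \<mu>" by (rule sum_list_eq_sum_levels[symmetric]) (use le in auto)
  finally show "sum_list (conjugate \<mu>) = sum_list \<mu>" .
  show "sorted_wrt (\<ge>) (conjugate \<mu>)"
    unfolding sorted_wrt_iff_nth_less
  proof (intro allI impI)
    fix i j assume ij: "i < j" "j < length (conjugate \<mu>)"
    have "length (filter (\<lambda>x. j < x) \<mu>) \<le> length (filter (\<lambda>x. i < x) \<mu>)"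
      unfolding length_filter_conv_card by (rule card_mono) (use ij in auto)
    thus "conjugate \<mu> ! i \<ge> conjugate \<mu> ! j" using ij by (simp add: nth l_def)
  qed
  have "l \<le> sum_list \<mu>" unfolding l by (cases \<mu>) auto
  have "sum_list (map (\<lambda>x. x\<^sup>2) (conjugate \<mu>)) = (\<Sum>j<l. (length (filter (\<lambda>x. j < x) \<mu>))\<^sup>2)"
    unfolding sum_list_sum_nth length_map l_def[symmetric] atLeast0LessThan
    by (rule sum.cong) (auto simp: nth l_def)
  also have "\<dots> = col_stat \<mu>"
    unfolding col_stat_def by (rule sum.mono_neutral_left) (use \<open>l \<le> sum_list \<mu>\<close> zero in auto)
  finally show "sum_list (map (\<lambda>x. x\<^sup>2) (conjugate \<mu>)) = col_stat \<mu>" .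
qed

text \<open>
  By the first span condition, \<open>R = D H - e\<^sub>\<mu> H\<close> is a combination of the functions
  \<open>s\<^sub>\<nu>[X / (1 - q)]\<close> with \<open>col_stat \<nu> < col_stat \<mu>\<close>; by the second one it is a combination of the
  functions \<open>s\<^sub>\<kappa>[X / (1 - t)]\<close> with \<open>row_stat \<kappa> \<le> row_stat \<mu>'\<close> for the conjugate \<open>\<mu>'\<close>.  The eigenvalues of
  \<open>D\<close> on these families are \<open>e\<^sub>\<nu>(q, t)\<close> and \<open>e\<^sub>\<kappa>(t, q)\<close>.  If two of them were equal, \<open>sep\<close> would give
  \<open>col_stat \<nu> = \<Sum> \<kappa>\<^sub>i\<^sup>2 \<ge> \<Sum> \<mu>'\<^sub>i\<^sup>2 = col_stat \<mu>\<close>.  Hence the spans meet trivially and \<open>R = 0\<close>.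
\<close>

lemma macdonald_op_eigenvector:
  fixes q t :: "'k::field_char_0"
  assumes q: "\<And>i. q ^ Suc i \<noteq> 1" and t: "\<And>i. t ^ Suc i \<noteq> 1"
    and \<mu>: "is_partition \<mu>"
    and sep: "\<And>\<nu> \<kappa>. is_partition \<nu> \<Longrightarrow> is_partition \<kappa> \<Longrightarrow> cell_sum q t \<nu> = cell_sum t q \<kappa> \<Longrightarrow>
        sum_list \<nu> = sum_list \<kappa> \<Longrightarrow> col_stat \<nu> = sum_list (map (\<lambda>x. x\<^sup>2) \<kappa>)"
    and Hq: "pscale (\<lambda>i. 1 - q ^ Suc i) H \<in> psym.span (pschur ` {\<nu>. is_partition \<nu> \<and> \<nu> \<unrhd> \<mu>})"
    and Ht: "pscale (\<lambda>i. 1 - t ^ Suc i) H \<in> psym.span (pschur ` {\<nu>. is_partition \<nu> \<and> \<nu> \<unrhd> conjugate \<mu>})"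
  shows "macdonald_op q t H = pconst (macdonald_eigenvalue q t \<mu>) * H"
proof -
  define n where "n = sum_list \<mu>"
  define e where "e = macdonald_eigenvalue q t \<mu>"
  define bq where "bq = (\<lambda>\<nu>. unscale q (pschur \<nu>))"
  define bt where "bt = (\<lambda>\<nu>. unscale t (pschur \<nu>))"
  define Aq where "Aq = {\<kappa> \<in> partitions_of n. col_stat \<kappa> < col_stat \<mu>}"
  define At where "At = {\<kappa> \<in> partitions_of n. row_stat \<kappa> \<le> row_stat (conjugate \<mu>)}"
  have triq: "psym.triangular_on (macdonald_op q t) bq (macdonald_eigenvalue q t) col_stat Aq"
    unfolding bq_def Aq_def by (rule col.triangular_on_pschur[OF q]) auto
  have "psym.triangular_on (macdonald_op t q) bt (macdonald_eigenvalue t q) row_stat At"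
    unfolding bt_def At_def by (rule row.triangular_on_pschur[OF t]) auto
  hence trit: "psym.triangular_on (macdonald_op q t) bt (macdonald_eigenvalue t q) row_stat At"
    unfolding psym.triangular_on_def by (subst macdonald_op_commute)
  define R where "R = macdonald_op q t H - pconst e * H"
  let ?\<phi> = "pscale (\<lambda>i. 1 - q ^ Suc i)"
  have part: "\<nu> \<in> partitions_of n" if "is_partition \<nu>" "\<nu> \<unrhd> \<mu>" for \<nu>
    using that by (auto simp: partitions_of_def dominates_def n_def)
  \<comment> \<open>The term of \<open>\<mu>\<close> itself is removed by subtracting its eigenvalue; only strictly lower terms remain.\<close>
  have low: "macdonald_op' q t x - pconst e * x \<in> psym.span (pschur ` Aq)"
    if "x \<in> psym.span (pschur ` {\<nu>. is_partition \<nu> \<and> \<nu> \<unrhd> \<mu>})" for x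
    using that
  proof (induction rule: psym.span_induct_alt)
    case base
    have "macdonald_op' q t (0 :: 'k psym) = 0" using macdonald_op'_scale[of q t 0 0] by simp
    thus ?case by (simp add: psym.span_zero)
  next
    case (step c x y)
    then obtain \<nu> where \<nu>: "is_partition \<nu>" "\<nu> \<unrhd> \<mu>" "x = pschur \<nu>" by auto
    let ?e = "macdonald_eigenvalue q t \<nu>"
    have st: "col_stat \<nu> \<le> col_stat \<mu>" "\<nu> \<noteq> \<mu> \<Longrightarrow> col_stat \<nu> < col_stat \<mu>"
      using col.dominates_le[OF \<nu>(2)] \<mu> \<nu> by (auto simp: is_partition_def)
    have "macdonald_op' q t x - pconst ?e * x \<in> psym.span (pschur ` {\<kappa> \<in> partitions_of n. col_stat \<kappa> < col_stat \<nu>})"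
      unfolding \<nu>(3) by (rule col.macdonald_op'_pschur) (use part[OF \<nu>(1,2)] in \<open>auto simp: partitions_of_def\<close>)
    also have "\<dots> \<subseteq> psym.span (pschur ` Aq)"
      by (rule psym.span_mono) (use st in \<open>auto simp: Aq_def\<close>)
    finally have 1: "macdonald_op' q t x - pconst ?e * x \<in> psym.span (pschur ` Aq)" .
    have 2: "pconst (?e - e) * x \<in> psym.span (pschur ` Aq)"
    proof (cases "\<nu> = \<mu>")
      case False
      thus ?thesis using st part[OF \<nu>(1,2)] \<nu>(3)
        by (intro psym.span_scale psym.span_base) (auto simp: Aq_def)
    qed (simp add: e_def psym.span_zero)
    have "macdonald_op' q t (pconst c * x + y) - pconst e * (pconst c * x + y) =
       pconst c * ((macdonald_op' q t x - pconst ?e * x) + pconst (?e - e) * x) +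
       (macdonald_op' q t y - pconst e * y)"
      unfolding macdonald_op'_add macdonald_op'_scale pconst.hom_minus by (simp add: algebra_simps)
    also have "\<dots> \<in> psym.span (pschur ` Aq)"
      by (intro psym.span_add psym.span_scale 1 2 step.IH)
    finally show ?case .
  qed
  have "?\<phi> R = macdonald_op' q t (?\<phi> H) - pconst e * ?\<phi> H"
  proof -
    interpret h: comm_ring_hom "pscale (\<lambda>i. 1 - q ^ Suc i)" by (rule pscale_hom)
    show ?thesis by (simp only: R_def h.hom_minus h.hom_mult pscale_pconst pscale_macdonald_op)
  qed
  hence "?\<phi> R \<in> psym.span (pschur ` Aq)" using low[OF Hq] by simp
  hence "unscale q (?\<phi> R) \<in> psym.span (unscale q ` pschur ` Aq)"
    unfolding unscale_def by (rule pscale_in_span)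
  hence Rq: "R \<in> psym.span (bq ` Aq)"
    by (simp only: unscale_pscale[OF q] bq_def image_image)
  have "unscale t (pscale (\<lambda>i. 1 - t ^ Suc i) H) \<in> psym.span (unscale t ` pschur ` {\<nu>. is_partition \<nu> \<and> \<nu> \<unrhd> conjugate \<mu>})"
    unfolding unscale_def by (rule pscale_in_span) (rule Ht)
  also have "\<dots> \<subseteq> psym.span (bt ` At)"
    by (rule psym.span_mono)
       (use row.dominates_le[of _ "conjugate \<mu>"] conjugate_props[OF \<mu>]
          in \<open>auto simp: bt_def At_def partitions_of_def dominates_def n_def intro!: imageI\<close>)
  finally have Ht': "H \<in> psym.span (bt ` At)" by (simp only: unscale_pscale[OF t])
  hence "macdonald_op q t H \<in> psym.span (bt ` At)"
    by (rule psym.triangular_on_span_invariant[OF trit macdonald_op_add macdonald_op_scale])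
  hence Rt: "R \<in> psym.span (bt ` At)"
    unfolding R_def using Ht' by (intro psym.span_diff psym.span_scale)
  have "R = 0"
  proof (rule psym.triangular_spans_disjoint[OF macdonald_op_add macdonald_op_scale triq trit _ Rq Rt])
    fix \<nu> \<kappa> assume *: "\<nu> \<in> Aq" "\<kappa> \<in> At"
    show "macdonald_eigenvalue q t \<nu> \<noteq> macdonald_eigenvalue t q \<kappa>"
    proof
      assume "macdonald_eigenvalue q t \<nu> = macdonald_eigenvalue t q \<kappa>"
      hence "cell_sum q t \<nu> = cell_sum t q \<kappa>"
        using q[of 0] t[of 0] by (simp add: macdonald_eigenvalue_def mult.commute[of "1 - t"])
      hence "col_stat \<nu> = sum_list (map (\<lambda>x. x\<^sup>2) \<kappa>)"
        using * by (intro sep) (auto simp: Aq_def At_def partitions_of_def)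
      moreover have "row_stat \<kappa> \<le> row_stat (conjugate \<mu>)" "sum_list \<kappa> = n" "col_stat \<nu> < col_stat \<mu>"
        using * by (auto simp: Aq_def At_def partitions_of_def)
      moreover have "sum_list (map (\<lambda>x. x\<^sup>2) \<kappa>) \<le> (sum_list \<kappa>)\<^sup>2" 
        "sum_list (map (\<lambda>x. x\<^sup>2) (conjugate \<mu>)) \<le> (sum_list (conjugate \<mu>))\<^sup>2"
        by (rule sum_squares_le)+
      ultimately show False
        using conjugate_props(1,3)[OF \<mu>] by (simp add: row_stat_def n_def)
    qed
  qed
  thus ?thesis by (simp add: R_def e_def)
qed

section \<open>Power sum polynomials as symmetric functions\<close>

lemma xcoeff_mult: "xcoeff (f * g) m = (\<Sum>(a, b) | a + b = m. xcoeff f a * xcoeff g b)"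
  by (simp add: times_xps.rep_eq)

lemma xcoeff_simps [simp]:
  "xcoeff 0 m = 0" "xcoeff (f + g) m = xcoeff f m + xcoeff g m" "xcoeff (f - g) m = xcoeff f m - xcoeff g m"
  "xcoeff (- f) m = - xcoeff f m" "xcoeff 1 m = (if m = {#} then 1 else 0)"
  by (simp_all add: zero_xps.rep_eq plus_xps.rep_eq minus_xps.rep_eq uminus_xps.rep_eq one_xps.rep_eq)

lemma xcoeff_sum: "xcoeff (sum f A) m = (\<Sum>x\<in>A. xcoeff (f x) m)"
  by (induction A rule: infinite_finite_induct) auto

lemma xcoeff_xconst_mult [simp]: "xcoeff (xconst c * f) m = c * xcoeff f m"
proof -
  have "xcoeff (xconst c * f) m = (\<Sum>(a, b)\<in>{({#}, m)}. xcoeff (xconst c) a * xcoeff f b)"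
    unfolding xcoeff_mult
    by (intro sum.mono_neutral_right finite_multiset_splittings) (auto simp: xconst_def split: if_splits)
  thus ?thesis by (simp add: xconst_def)
qed

lemma xcoeff_xconst: "xcoeff (xconst c) m = (if m = {#} then c else 0)"
  by (simp add: xconst_def)

lemma xconst_hom: "comm_ring_hom (xconst :: 'a::comm_ring_1 \<Rightarrow> 'a xps)"
proof
  show "xconst (x * y) = xconst x * (xconst y :: 'a xps)" for x y
    by (rule xps_eqI) (simp add: xcoeff_xconst)
qed (auto intro!: xps_eqI simp: xcoeff_xconst)

lemma xcoeff_power_sum_mult:
  assumes "0 < r"
  shows "xcoeff (power_sum r * f) m = (\<Sum>i | i \<in># m \<and> r \<le> count m i. xcoeff f (m - replicate_mset r i))"
proof -
  let ?I = "{i. i \<in># m \<and> r \<le> count m i}" and ?g = "\<lambda>i. (replicate_mset r i, m - replicate_mset r i)"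
  have inj: "inj_on ?g ?I"
    using assms by (intro inj_onI) (auto simp: replicate_mset_eq_iff)
  have sub: "replicate_mset r i \<subseteq># m" if "r \<le> count m i" for i
    using that by (auto simp: subseteq_mset_def)
  have "xcoeff (power_sum r * f) m = (\<Sum>(a, b)\<in>?g ` ?I. xcoeff (power_sum r) a * xcoeff f b)"
    unfolding xcoeff_mult
  proof (intro sum.mono_neutral_right finite_multiset_splittings ballI)
    show "?g ` ?I \<subseteq> {(a, b). a + b = m}" using sub by auto
    fix x assume x: "x \<in> {(a, b). a + b = m} - ?g ` ?I"
    obtain a b where ab: "x = (a, b)" "a + b = m" using x by auto
    have "\<not> (\<exists>i. a = replicate_mset r i)"
    proof
      assume "\<exists>i. a = replicate_mset r i"
      then obtain i where i: "a = replicate_mset r i" by blast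
      hence "r \<le> count m i" "b = m - a" "i \<in># m" using ab assms by auto
      hence "x \<in> ?g ` ?I" using i ab by auto
      thus False using x by auto
    qed
    thus "(case x of (a, b) \<Rightarrow> xcoeff (power_sum r) a * xcoeff f b) = 0"
      by (auto simp: ab power_sum_def)
  qed
  also have "\<dots> = (\<Sum>i\<in>?I. xcoeff f (m - replicate_mset r i))"
    by (subst sum.reindex[OF inj]) (auto simp: power_sum_def intro!: sum.cong)
  finally show ?thesis .
qed

definition sym_of :: "'k::comm_ring_1 psym \<Rightarrow> 'k xps" where
  "sym_of = peval xconst (\<lambda>i. power_sum (Suc i))"

lemma sym_of_hom: "comm_ring_hom sym_of"
  unfolding sym_of_def by (rule peval_hom) (rule xconst_hom)

interpretation sym_of: comm_ring_hom sym_of by (rule sym_of_hom)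

lemma sym_of_pconst [simp]: "sym_of (pconst c) = xconst c"
  by (simp add: sym_of_def xconst_hom)

lemma sym_of_pvar [simp]: "sym_of (pvar i) = power_sum (Suc i)"
  by (simp add: sym_of_def xconst_hom)

definition pmono :: "nat multiset \<Rightarrow> 'k::comm_ring_1 xps" where
  "pmono M = prod_mset (image_mset (\<lambda>i. power_sum (Suc i)) M)"

lemma sym_of_single: "sym_of (Poly_Mapping.single M c) = xconst c * pmono M"
  by (simp add: sym_of_def peval_single[OF xconst_hom] pmono_def)

lemma xcoeff_sym_of:
  "xcoeff (sym_of f) m = (\<Sum>M\<in>Poly_Mapping.keys f. Poly_Mapping.lookup f M * xcoeff (pmono M) m)"
  by (subst psym_expand[of f]) (simp add: sym_of.hom_sum sym_of_single xcoeff_sum)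

lemma xcoeff_pmono_empty: "xcoeff (pmono {#}) m = (if m = {#} then 1 else 0)"
  by (simp add: pmono_def)

lemma xcoeff_pmono_add:
  "xcoeff (pmono (add_mset r M)) m =
     (\<Sum>i | i \<in># m \<and> Suc r \<le> count m i. xcoeff (pmono M) (m - replicate_mset (Suc r) i))"
  by (simp add: pmono_def xcoeff_power_sum_mult del: replicate_mset_Suc)

text \<open>
  The degree in the variables \<open>x\<^sub>i\<close>, in which \<open>pvar i\<close> has degree \<open>i + 1\<close>.
\<close>

definition pdeg :: "nat multiset \<Rightarrow> nat" where
  "pdeg M = (\<Sum>i\<in>#M. Suc i)"

lemma pdeg_simps [simp]: "pdeg {#} = 0" "pdeg (add_mset r M) = Suc r + pdeg M" "pdeg (M + N) = pdeg M + pdeg N"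
  by (simp_all add: pdeg_def)

lemma xcoeff_pmono_degree:
  assumes "xcoeff (pmono M :: 'k::comm_ring_1 xps) m \<noteq> 0"
  shows "size m = pdeg M"
  using assms
proof (induction M arbitrary: m)
  case (add r M)
  obtain i where i: "i \<in># m" "Suc r \<le> count m i" "xcoeff (pmono M :: 'k xps) (m - replicate_mset (Suc r) i) \<noteq> 0"
    using add.prems unfolding xcoeff_pmono_add by (auto elim: sum.not_neutral_contains_not_neutral)
  have "replicate_mset (Suc r) i \<subseteq># m" using i by (auto simp: subseteq_mset_def simp del: replicate_mset_Suc)
  hence "size m = Suc r + size (m - replicate_mset (Suc r) i)"
    using size_mset_mono[of "replicate_mset (Suc r) i" m] by (simp add: size_Diff_submset del: replicate_mset_Suc)
  thus ?case using add.IH[OF i(3)] by simp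
qed (auto simp: xcoeff_pmono_empty split: if_splits)

text \<open>
  The multiset of the exponents of a monomial, each shifted by one to match the index of a power sum.
\<close>

definition mtype :: "nat multiset \<Rightarrow> nat multiset" where
  "mtype m = image_mset (\<lambda>i. count m i - 1) (mset_set (set_mset m))"

lemma size_mtype: "size (mtype m) = card (set_mset m)"
  by (simp add: mtype_def)

lemma mtype_empty [simp]: "mtype {#} = {#}"
  by (simp add: mtype_def)

lemma mtype_remove:
  assumes "count m i = Suc r"
  shows "mtype m = add_mset r (mtype (m - replicate_mset (Suc r) i))"
    "set_mset (m - replicate_mset (Suc r) i) = set_mset m - {i}" "i \<in># m"
proof -
  show i: "i \<in># m" using assms by (metis count_greater_zero_iff zero_less_Suc)
  show set: "set_mset (m - replicate_mset (Suc r) i) = set_mset m - {i}"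
  proof (rule Set.set_eqI)
    fix x show "x \<in># m - replicate_mset (Suc r) i \<longleftrightarrow> x \<in> set_mset m - {i}"
      unfolding count_greater_zero_iff[symmetric] using assms
      by (cases "x = i") (auto simp del: count_greater_zero_iff replicate_mset_Suc simp: count_greater_zero_iff[symmetric, of _ m])
  qed
  have "mset_set (set_mset m) = add_mset i (mset_set (set_mset m - {i}))"
    using i by (simp add: mset_set.remove)
  hence "mtype m = add_mset r (image_mset (\<lambda>i. count m i - 1) (mset_set (set_mset m - {i})))"
    by (simp add: mtype_def assms)
  also have "image_mset (\<lambda>i. count m i - 1) (mset_set (set_mset m - {i})) = mtype (m - replicate_mset (Suc r) i)"
    unfolding mtype_def set by (rule image_mset_cong) auto
  finally show "mtype m = add_mset r (mtype (m - replicate_mset (Suc r) i))" .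
qed

lemma mtype_add:
  assumes "mtype m = add_mset r M"
  obtains i where "count m i = Suc r" "mtype (m - replicate_mset (Suc r) i) = M"
proof -
  have "r \<in># mtype m" using assms by simp
  then obtain i where i: "i \<in># m" "count m i - 1 = r" by (auto simp: mtype_def)
  hence c: "count m i = Suc r" by (metis Suc_pred' count_greater_zero_iff)
  thus ?thesis using that mtype_remove(1)[OF c] assms by simp
qed

lemma mtype_surj: "\<exists>m. mtype m = M"
proof (induction M)
  case (add r M)
  then obtain m where m: "mtype m = M" by blast
  obtain i where i: "i \<notin> set_mset m" using ex_new_if_finite[of "set_mset m"] by auto
  let ?m = "m + replicate_mset (Suc r) i"
  have "count ?m i = Suc r" using i by (simp add: not_in_iff del: replicate_mset_Suc)
  from mtype_remove(1)[OF this] m show ?case by (intro exI[of _ ?m]) (simp del: replicate_mset_Suc)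
qed (auto intro: exI[of _ "{#}"])

text \<open>
  Each factor of a product of power sums contributes a power of a single variable, so the product of
  \<open>k\<close> power sums has no monomial with more than \<open>k\<close> variables.  In a monomial with exactly \<open>k\<close>
  variables, the factors use different variables and their degrees are the exponents.
\<close>

lemma xcoeff_pmono_nonzero:
  assumes "xcoeff (pmono M :: 'k::comm_ring_1 xps) m \<noteq> 0"
  shows "card (set_mset m) \<le> size M \<and> (card (set_mset m) = size M \<longrightarrow> mtype m = M)"
  using assms
proof (induction M arbitrary: m)
  case empty
  thus ?case by (auto simp: xcoeff_pmono_empty split: if_splits)
next
  case (add r M)
  obtain i where i: "i \<in># m" "Suc r \<le> count m i" "xcoeff (pmono M :: 'k xps) (m - replicate_mset (Suc r) i) \<noteq> 0"
    using add.prems unfolding xcoeff_pmono_add by (auto elim: sum.not_neutral_contains_not_neutral)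
  define m' where "m' = m - replicate_mset (Suc r) i"
  have IH: "card (set_mset m') \<le> size M" "card (set_mset m') = size M \<Longrightarrow> mtype m' = M"
    using add.IH[OF i(3)] by (auto simp: m'_def)
  show ?case
  proof (cases "count m i = Suc r")
    case True
    have "card (set_mset m) = Suc (card (set_mset m'))"
      unfolding m'_def mtype_remove(2)[OF True] by (rule card_Suc_Diff1[symmetric]) (use i in auto)
    thus ?thesis using IH mtype_remove(1)[OF True] by (auto simp: m'_def simp del: replicate_mset_Suc)
  next
    case False
    have "x \<in># m'" if "x \<in># m" for x
    proof -
      have "0 < count m x - (if i = x then Suc r else 0)" using i False that by auto
      thus ?thesis unfolding m'_def count_greater_zero_iff[symmetric] by (auto simp del: count_greater_zero_iff replicate_mset_Suc)
    qed
    hence "card (set_mset m) \<le> card (set_mset m')" by (intro card_mono) auto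
    thus ?thesis using IH by simp
  qed
qed

lemma xcoeff_pmono_nat:
  "\<exists>c::nat. xcoeff (pmono M :: 'k::comm_ring_1 xps) m = of_nat c \<and> (mtype m = M \<longrightarrow> c > 0)"
proof (induction M arbitrary: m)
  case empty
  have "m = {#}" if "mtype m = {#}"
    using that size_mtype[of m] by simp
  thus ?case by (intro exI[of _ "if m = {#} then 1 else 0"]) (auto simp: xcoeff_pmono_empty)
next
  case (add r M)
  then obtain c where c: "\<And>m. xcoeff (pmono M :: 'k xps) m = of_nat (c m)" "\<And>m. mtype m = M \<Longrightarrow> c m > 0"
    by metis
  let ?I = "{i. i \<in># m \<and> Suc r \<le> count m i}"
  have "xcoeff (pmono (add_mset r M) :: 'k xps) m = of_nat (\<Sum>i\<in>?I. c (m - replicate_mset (Suc r) i))"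
    unfolding xcoeff_pmono_add by (simp add: c del: replicate_mset_Suc)
  moreover have "0 < (\<Sum>i\<in>?I. c (m - replicate_mset (Suc r) i))" if ty: "mtype m = add_mset r M"
  proof -
    obtain i where i: "count m i = Suc r" "mtype (m - replicate_mset (Suc r) i) = M"
      using mtype_add[OF ty] by blast
    have "0 < c (m - replicate_mset (Suc r) i)" by (rule c(2)) (rule i(2))
    also have "\<dots> \<le> (\<Sum>i\<in>?I. c (m - replicate_mset (Suc r) i))"
      using i mtype_remove(3)[OF i(1)] by (intro member_le_sum) auto
    finally show ?thesis .
  qed
  ultimately show ?case by blast
qed

text \<open>
  Algebraic independence of the power sums.  In a linear combination of products of power sums,
  choose a product with the largest number of factors; a monomial with the same exponents occurs in no
  other product of the combination.
\<close>

lemma sym_of_inj: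
  assumes "sym_of f = sym_of (g :: 'k::field_char_0 psym)"
  shows "f = g"
proof (rule ccontr)
  assume "f \<noteq> g"
  define h where "h = f - g"
  have "h \<noteq> 0" "sym_of h = 0" using \<open>f \<noteq> g\<close> assms by (auto simp: h_def sym_of.hom_minus)
  let ?K = "Poly_Mapping.keys h"
  have "?K \<noteq> {}" using \<open>h \<noteq> 0\<close> by simp
  hence "Max (size ` ?K) \<in> size ` ?K" by (intro Max_in) auto
  then obtain M where M: "M \<in> ?K" "size M = Max (size ` ?K)" by auto
  obtain m where m: "mtype m = M" using mtype_surj by blast
  have "xcoeff (sym_of h) m = (\<Sum>N\<in>{M}. Poly_Mapping.lookup h N * xcoeff (pmono N) m)"
    unfolding xcoeff_sym_of
  proof (intro sum.mono_neutral_right ballI)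
    fix N assume N: "N \<in> ?K - {M}"
    have "xcoeff (pmono N :: 'k xps) m = 0"
    proof (rule ccontr)
      assume "\<not> ?thesis"
      from xcoeff_pmono_nonzero[OF this] have "size M \<le> size N" "size M = size N \<Longrightarrow> M = N"
        using size_mtype[of m] m by auto
      moreover have "size N \<le> size M" using N unfolding M(2) by (intro Max_ge) auto
      ultimately show False using N by auto
    qed
    thus "Poly_Mapping.lookup h N * xcoeff (pmono N) m = 0" by simp
  qed (use M in auto)
  moreover obtain c :: nat where "xcoeff (pmono M :: 'k xps) m = of_nat c" "c > 0"
    using xcoeff_pmono_nat[of M m] m by auto
  ultimately show False using \<open>sym_of h = 0\<close> M by (auto simp: in_keys_iff)
qed

lemma xcoeff_pmono_permute:
  assumes "bij \<pi>"
  shows "xcoeff (pmono M :: 'k::comm_ring_1 xps) (image_mset \<pi> m) = xcoeff (pmono M) m"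
proof (induction M arbitrary: m)
  case (add r M)
  have inj: "inj \<pi>" using assms by (rule bij_is_inj)
  have c: "count (image_mset \<pi> m) (\<pi> i) = count m i" for i m
    by (induction m) (use inj in \<open>auto dest: injD\<close>)
  have "{i. i \<in># image_mset \<pi> m \<and> Suc r \<le> count (image_mset \<pi> m) i} = \<pi> ` {i. i \<in># m \<and> Suc r \<le> count m i}"
    using c by auto
  moreover have "image_mset \<pi> m - replicate_mset (Suc r) (\<pi> i) = image_mset \<pi> (m - replicate_mset (Suc r) i)"
    if "Suc r \<le> count m i" for i
    using that by (subst image_mset_Diff) (auto simp: subseteq_mset_def simp del: replicate_mset_Suc)
  ultimately show ?case
    unfolding xcoeff_pmono_add
    by (simp add: sum.reindex inj_on_subset[OF inj] add.IH del: replicate_mset_Suc)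
qed (auto simp: xcoeff_pmono_empty)

lemma mtype_eq_imp_permute:
  "mtype m = mtype m' \<Longrightarrow> \<exists>\<pi>. bij \<pi> \<and> image_mset \<pi> m = m'"
proof (induction "mtype m" arbitrary: m m')
  case empty
  hence "m = {#}" "m' = {#}" using size_mtype[of m] size_mtype[of m'] by auto
  thus ?case by (intro exI[of _ id]) (auto simp: bij_def)
next
  case (add r M)
  obtain i where i: "count m i = Suc r" "mtype (m - replicate_mset (Suc r) i) = M"
    using mtype_add[of m r M] add.hyps(2) by metis
  obtain i' where i': "count m' i' = Suc r" "mtype (m' - replicate_mset (Suc r) i') = M"
    using mtype_add[of m' r M] add.hyps(2) add.prems by metis
  define n n' where "n = m - replicate_mset (Suc r) i" and "n' = m' - replicate_mset (Suc r) i'"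
  obtain \<pi> where \<pi>: "bij \<pi>" "image_mset \<pi> n = n'"
    using add.hyps(1)[of n n'] i i' by (auto simp: n_def n'_def)
  have sub: "replicate_mset (Suc r) i \<subseteq># m" "replicate_mset (Suc r) i' \<subseteq># m'"
    using i(1) i'(1) by (auto simp: subseteq_mset_def simp del: replicate_mset_Suc)
  have nin: "i \<notin># n" "i' \<notin># n'"
    using i(1) i'(1) by (auto simp: n_def n'_def not_in_iff simp del: replicate_mset_Suc)
  have pin: "\<pi> i \<notin># n'"
  proof
    assume "\<pi> i \<in># n'"
    then obtain j where "j \<in># n" "\<pi> j = \<pi> i" unfolding \<pi>(2)[symmetric] by auto
    thus False using nin bij_is_inj[OF \<pi>(1)] by (auto dest: injD)
  qed
  define \<tau> where "\<tau> = Transposition.transpose (\<pi> i) i'"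
  have "bij (\<tau> \<circ> \<pi>)" unfolding \<tau>_def by (intro bij_comp \<pi>) simp
  moreover have "image_mset (\<tau> \<circ> \<pi>) m = m'"
  proof -
    have "m = n + replicate_mset (Suc r) i" "m' = n' + replicate_mset (Suc r) i'"
      using sub by (auto simp: n_def n'_def simp del: replicate_mset_Suc)
    moreover have "image_mset \<tau> n' = n'"
    proof -
      have "image_mset \<tau> n' = image_mset id n'"
        by (rule image_mset_cong) (use nin pin in \<open>auto simp: \<tau>_def Transposition.transpose_def\<close>)
      thus ?thesis by simp
    qed
    moreover have "\<tau> (\<pi> i) = i'" by (simp add: \<tau>_def)
    moreover have "image_mset (\<tau> \<circ> \<pi>) m = image_mset \<tau> (image_mset \<pi> m)"
      by (simp add: multiset.map_comp)
    ultimately show ?thesis by (simp add: \<pi>(2) del: replicate_mset_Suc)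
  qed
  ultimately show ?case by blast
qed

lemma finite_msets_bounded: "finite {M :: nat multiset. set_mset M \<subseteq> {..N} \<and> size M \<le> N}"
proof (rule finite_subset)
  show "{M :: nat multiset. set_mset M \<subseteq> {..N} \<and> size M \<le> N} \<subseteq> {a. a \<subseteq># (\<Sum>i\<le>N. replicate_mset N i)}"
  proof (clarify, rule mset_subset_eqI)
    fix M :: "nat multiset" and x assume M: "set_mset M \<subseteq> {..N}" "size M \<le> N"
    have c: "count (\<Sum>i\<le>N. replicate_mset N i) x = (if x \<le> N then N else 0)"
      by (simp add: count_sum)
    show "count M x \<le> count (\<Sum>i\<le>N. replicate_mset N i) x"
      using M count_le_size[of M x] unfolding c by (auto simp: not_in_iff)
  qed
  show "finite {a. a \<subseteq># (\<Sum>i\<le>N. replicate_mset N i)}" by (rule finite_submultisets)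
qed

text \<open>
  Induction on a bound for the number of variables in a monomial: the coefficients at monomials with
  the largest number of variables can be removed by subtracting products of that many power sums.
\<close>

lemma sym_of_surj:
  fixes F :: "'k::field_char_0 xps"
  assumes "F \<in> sym_functions"
  shows "\<exists>f. sym_of f = F"
proof -
  obtain N where N: "\<And>m. xcoeff F m \<noteq> 0 \<Longrightarrow> size m \<le> N"
    and sym: "\<And>\<pi> m. bij \<pi> \<Longrightarrow> xcoeff F (image_mset \<pi> m) = xcoeff F m"
    using assms by (auto simp: sym_functions_def)
  have "\<exists>f. sym_of f = F"
    if "\<And>\<pi> m. bij \<pi> \<Longrightarrow> xcoeff F (image_mset \<pi> m) = xcoeff F m"
      "\<And>m. xcoeff F m \<noteq> 0 \<Longrightarrow> size m \<le> N \<and> card (set_mset m) < l" for l and F :: "'k xps"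
    using that
  proof (induction l arbitrary: F)
    case 0
    hence "F = 0" by (intro xps_eqI) auto
    thus ?case by (intro exI[of _ 0]) simp
  next
    case (Suc l)
    define rep where "rep = (\<lambda>M. SOME m. mtype m = M)"
    have rep: "mtype (rep M) = M" for M unfolding rep_def by (rule someI_ex) (rule mtype_surj)
    define b :: "nat multiset \<Rightarrow> 'k" where "b = (\<lambda>M. xcoeff (pmono M) (rep M))"
    have b: "b M \<noteq> 0" for M using xcoeff_pmono_nat[of M "rep M", where ?'k = 'k] rep[of M] by (auto simp: b_def)
    have type: "xcoeff G m = xcoeff G (rep (mtype m))"
      if "\<And>\<pi> m. bij \<pi> \<Longrightarrow> xcoeff G (image_mset \<pi> m) = xcoeff G m" for G :: "'k xps" and m
    proof -
      obtain \<pi> where "bij \<pi>" "image_mset \<pi> (rep (mtype m)) = m"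
        using mtype_eq_imp_permute[of "rep (mtype m)" m] rep by auto
      thus ?thesis using that by metis
    qed
    define S where "S = {M. set_mset M \<subseteq> {..N} \<and> size M \<le> N \<and> size M = l}"
    have "finite S" unfolding S_def by (rule finite_subset[OF _ finite_msets_bounded[of N]]) auto
    define g where "g = (\<Sum>M\<in>S. Poly_Mapping.single M (xcoeff F (rep M) / b M))"
    have g: "xcoeff (sym_of g) m = (\<Sum>M\<in>S. xcoeff F (rep M) / b M * xcoeff (pmono M) m)" for m
      by (simp add: g_def sym_of.hom_sum sym_of_single xcoeff_sum)
    have "\<exists>f. sym_of f = F - sym_of g"
    proof (rule Suc.IH)
      show "xcoeff (F - sym_of g) (image_mset \<pi> m) = xcoeff (F - sym_of g) m" if "bij \<pi>" for \<pi> m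
        using Suc.prems(1)[OF that] by (simp add: g xcoeff_pmono_permute[OF that])
    next
      fix m assume nz: "xcoeff (F - sym_of g) m \<noteq> 0"
      have bound: "mtype m \<in> {M. set_mset M \<subseteq> {..N} \<and> size M \<le> N}" if "size m \<le> N" for m
      proof -
        have "count m i - 1 \<le> N" for i using count_le_size[of m i] that by simp
        moreover have "card (set_mset m) \<le> size m" by (metis size_mset_set mset_set_set_mset_msubset size_mset_mono)
        ultimately show ?thesis using that by (auto simp: mtype_def)
      qed
      have size_le: "size m \<le> N"
      proof (cases "xcoeff F m = 0")
        case True
        hence "(\<Sum>M\<in>S. xcoeff F (rep M) / b M * xcoeff (pmono M) m) \<noteq> 0" using nz g by simp
        then obtain M where "xcoeff F (rep M) / b M * xcoeff (pmono M) m \<noteq> 0"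
          by (meson sum.not_neutral_contains_not_neutral)
        hence M: "xcoeff F (rep M) \<noteq> 0" "xcoeff (pmono M :: 'k xps) m \<noteq> 0" by auto
        have "size m = size (rep M)" using xcoeff_pmono_degree[OF M(2)] xcoeff_pmono_degree[of M "rep M", where ?'k = 'k] b[of M] by (simp add: b_def)
        thus ?thesis using Suc.prems(2)[OF M(1)] by simp
      qed (use Suc.prems(2) in blast)
      have card_le: "card (set_mset m) \<le> l"
      proof (cases "xcoeff F m = 0")
        case True
        hence "(\<Sum>M\<in>S. xcoeff F (rep M) / b M * xcoeff (pmono M) m) \<noteq> 0" using nz g by simp
        then obtain M where "M \<in> S" "xcoeff F (rep M) / b M * xcoeff (pmono M) m \<noteq> 0"
          by (meson sum.not_neutral_contains_not_neutral)
        hence M: "M \<in> S" "xcoeff (pmono M :: 'k xps) m \<noteq> 0" by auto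
        thus ?thesis using xcoeff_pmono_nonzero[OF M(2)] by (auto simp: S_def)
      qed (use Suc.prems(2)[of m] in auto)
      have "card (set_mset m) \<noteq> l"
      proof
        assume l: "card (set_mset m) = l"
        hence S: "mtype m \<in> S" using bound[OF size_le] by (simp add: S_def size_mtype)
        have "xcoeff (sym_of g) m = (\<Sum>M\<in>{mtype m}. xcoeff F (rep M) / b M * xcoeff (pmono M) m)"
          unfolding g
        proof (intro sum.mono_neutral_right ballI)
          fix M assume M: "M \<in> S - {mtype m}"
          hence "xcoeff (pmono M :: 'k xps) m = 0"
            using xcoeff_pmono_nonzero[of M m, where ?'k = 'k] l by (auto simp: S_def)
          thus "xcoeff F (rep M) / b M * xcoeff (pmono M) m = 0" by simp
        qed (use S \<open>finite S\<close> in auto)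
        also have "\<dots> = xcoeff F (rep (mtype m)) / b (mtype m) * xcoeff (pmono (mtype m)) m" by simp
        also have "xcoeff (pmono (mtype m)) m = b (mtype m)"
          unfolding b_def by (rule type) (rule xcoeff_pmono_permute)
        also have "xcoeff F (rep (mtype m)) = xcoeff F m"
          by (rule type[symmetric]) (rule Suc.prems(1))
        finally have "xcoeff (sym_of g) m = xcoeff F m" using b by simp
        thus False using nz by simp
      qed
      thus "size m \<le> N \<and> card (set_mset m) < l" using size_le card_le by simp
    qed
    then obtain f where "sym_of f = F - sym_of g" by blast
    hence "sym_of (f + g) = F" by (simp add: sym_of.hom_add)
    thus ?case by blast
  qed
  note * = this
  show ?thesis
  proof (rule *[of F "Suc N"])
    show "size m \<le> N \<and> card (set_mset m) < Suc N" if "xcoeff F m \<noteq> 0" for m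
    proof -
      have "card (set_mset m) \<le> size m"
        by (metis size_mset_set mset_set_set_mset_msubset size_mset_mono)
      thus ?thesis using N[OF that] by simp
    qed
  qed (rule sym)
qed

section \<open>Complete and Schur functions as power sum polynomials\<close>

text \<open>
  A monomial \<open>m\<close> of degree \<open>n\<close> arises on the right once for each variable \<open>i\<close> and each
  \<open>r \<le> count m i\<close>, which is \<open>n\<close> times in total.
\<close>

lemma newton_complete_sym:
  "of_nat n * complete_sym n = (\<Sum>r=1..n. power_sum r * (complete_sym (n - r) :: 'k::comm_ring_1 xps))"
proof (rule xps_eqI)
  fix m :: "nat multiset"
  have of_nat: "xcoeff (of_nat k * f) m = of_nat k * xcoeff f m" for k and f :: "'k xps"
    by (induction k) (auto simp: distrib_right)
  have "xcoeff (\<Sum>r=1..n. power_sum r * (complete_sym (n - r) :: 'k xps)) m =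
      (\<Sum>r=1..n. \<Sum>i | i \<in># m \<and> r \<le> count m i. if size (m - replicate_mset r i) = n - r then 1 else 0)"
    unfolding xcoeff_sum by (rule sum.cong) (auto simp: xcoeff_power_sum_mult complete_sym_def)
  also have "\<dots> = (\<Sum>r=1..n. \<Sum>i\<in>set_mset m. if r \<le> count m i \<and> size m = n then 1 else 0)"
  proof (rule sum.cong [OF refl])
    fix r assume r: "r \<in> {1..n}"
    have "size (m - replicate_mset r i) = n - r \<longleftrightarrow> size m = n" if "r \<le> count m i" for i
    proof -
      have sub: "replicate_mset r i \<subseteq># m" using that by (auto simp: subseteq_mset_def)
      hence "size m = size (m - replicate_mset r i) + r"
        using size_mset_mono[OF sub] by (simp add: size_Diff_submset)
      thus ?thesis using r by auto
    qed
    thus "(\<Sum>i | i \<in># m \<and> r \<le> count m i. if size (m - replicate_mset r i) = n - r then 1 else 0) =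
        (\<Sum>i\<in>set_mset m. if r \<le> count m i \<and> size m = n then 1 else (0::'k))"
      by (intro sum.mono_neutral_cong_left) auto
  qed
  also have "\<dots> = (\<Sum>i\<in>set_mset m. \<Sum>r=1..n. if r \<le> count m i \<and> size m = n then 1 else 0)"
    by (rule sum.swap)
  also have "\<dots> = (\<Sum>i\<in>set_mset m. if size m = n then of_nat (count m i) else 0)"
  proof (rule sum.cong [OF refl])
    fix i
    show "(\<Sum>r=1..n. if r \<le> count m i \<and> size m = n then 1 else 0) =
        (if size m = n then of_nat (count m i) else (0::'k))"
    proof (cases "size m = n")
      case True
      have "(\<Sum>r=1..n. if r \<le> count m i \<and> size m = n then 1 else 0) = (\<Sum>r=1..count m i. (1::'k))"
        using count_le_size[of m i] True by (intro sum.mono_neutral_cong_right) auto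
      thus ?thesis using True by simp
    qed simp
  qed
  also have "\<dots> = of_nat n * (if size m = n then 1 else 0)"
    by (auto simp: size_multiset_overloaded_eq simp flip: of_nat_sum)
  also have "\<dots> = xcoeff (of_nat n * complete_sym n) m"
    unfolding of_nat by (simp add: complete_sym_def)
  finally show "xcoeff (of_nat n * complete_sym n) m =
    xcoeff (\<Sum>r=1..n. power_sum r * (complete_sym (n - r) :: 'k xps)) m" ..
qed

lemma sym_of_phom: "sym_of (phom n) = complete_sym n"
proof -
  have "complete_sym 0 = (1 :: 'a xps)"
    by (rule xps_eqI) (auto simp: complete_sym_def)
  hence "exp_series power_sum (Abs_fps complete_sym :: 'a xps fps)"
    by (simp add: exp_series_iff newton_complete_sym)
  moreover have "exp_series power_sum (Abs_fps (\<lambda>n. sym_of (phom n)) :: 'a xps fps)"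
    unfolding sym_of_def by (rule exp_series_cong[OF exp_series_peval[OF xconst_hom]]) auto
  ultimately have "Abs_fps (\<lambda>n. sym_of (phom n)) = (Abs_fps complete_sym :: 'a xps fps)"
    by (metis exp_series_unique[OF xconst_hom])
  thus ?thesis by (simp add: fps_eq_iff)
qed

lemma sym_of_pschur: "sym_of (pschur \<nu>) = schur \<nu>"
proof -
  have "map_mat sym_of (jt_mat (length \<nu>) (\<lambda>i. int (\<nu> ! i) - int i) :: 'a psym mat) =
     mat (length \<nu>) (length \<nu>) (\<lambda>(i, j). let k = int (\<nu> ! i) - int i + int j in
        if k < 0 then 0 else complete_sym (nat k))"
    by (rule eq_matI) (auto simp: jt_mat_def phomz_def sym_of_phom Let_def)
  thus ?thesis unfolding pschur_def schur_def by (simp flip: sym_of.hom_det)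
qed

text \<open>
  The endomorphism \<open>p\<^sub>n \<mapsto> h\<^sub>n\<close>.  Its injectivity is the algebraic independence of the complete
  symmetric functions, which makes the coordinates in the basis \<open>h\<^sub>\<mu>\<close> unique.
\<close>

definition hom_endo :: "'k::field_char_0 psym \<Rightarrow> 'k psym" where
  "hom_endo = peval pconst (\<lambda>i. phom (Suc i))"

text \<open>
  The polynomial that expresses \<open>p\<^bsub>n+1\<^esub>\<close> by the complete symmetric functions, where the variable \<open>i\<close>
  stands for \<open>h\<^bsub>i+1\<^esub>\<close>.  It gives a left inverse of \<open>hom_endo\<close>.
\<close>

fun pnewton :: "nat \<Rightarrow> 'k::field_char_0 psym" where
  "pnewton n = of_nat (Suc n) * pvar n - (\<Sum>r<n. pnewton r * pvar (n - Suc r))"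

declare pnewton.simps [simp del]

lemma hom_endo_hom: "comm_ring_hom hom_endo"
  unfolding hom_endo_def by (rule peval_hom[OF pconst_hom])

lemma peval_pnewton_phom:
  "peval pconst pnewton (phom n) = (if n = 0 then 1 else pvar (n - 1))"
proof -
  let ?F = "Abs_fps (\<lambda>n. if n = 0 then 1 else pvar (n - 1)) :: 'a psym fps"
  have "exp_series (\<lambda>r. pnewton (r - 1)) (Abs_fps (\<lambda>n. peval pconst pnewton (phom n :: 'a psym)))"
    by (rule exp_series_peval[OF pconst_hom])
  moreover have "exp_series (\<lambda>r. pnewton (r - 1)) ?F"
    unfolding exp_series_iff
  proof (intro conjI allI)
    fix n
    show "of_nat n * fps_nth ?F n = (\<Sum>r = 1..n. pnewton (r - 1) * fps_nth ?F (n - r))"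
    proof (cases n)
      case (Suc k)
      have "(\<Sum>r = 1..n. pnewton (r - 1) * fps_nth ?F (n - r)) = (\<Sum>r\<le>k. pnewton r * fps_nth ?F (k - r))"
        by (rule sum.reindex_bij_witness[of _ Suc "\<lambda>r. r - 1"]) (auto simp: Suc)
      also have "\<dots> = pnewton k + (\<Sum>r<k. pnewton r * fps_nth ?F (k - r))"
        by (simp add: lessThan_Suc_atMost[symmetric])
      also have "(\<Sum>r<k. pnewton r * fps_nth ?F (k - r)) = (\<Sum>r<k. pnewton r * pvar (k - Suc r))"
        by (rule sum.cong) auto
      finally show ?thesis by (simp add: Suc pnewton.simps[of k])
    qed simp
  qed simp
  ultimately have "Abs_fps (\<lambda>n. peval pconst pnewton (phom n)) = ?F"
    by (rule exp_series_unique[OF pconst_hom])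
  thus ?thesis by (simp add: fps_eq_iff)
qed

lemma hom_endo_inj:
  assumes "hom_endo f = hom_endo g"
  shows "f = g"
proof -
  have "peval pconst pnewton (hom_endo f) = f" for f :: "'a psym"
  proof (rule psym_hom_eqI[where f = f and \<psi> = "\<lambda>f. f"])
    show "comm_ring_hom (\<lambda>f. peval pconst pnewton (hom_endo f) :: 'a psym)"
      by (rule comm_ring_hom_comp[OF peval_hom[OF pconst_hom] hom_endo_hom])
    show "comm_ring_hom (\<lambda>f :: 'a psym. f)" by unfold_locales auto
    show "peval pconst pnewton (hom_endo (pconst c)) = (pconst c :: 'a psym)" for c
      by (simp add: hom_endo_def pconst_hom)
    show "peval pconst pnewton (hom_endo (pvar i)) = (pvar i :: 'a psym)" for i
      by (simp add: hom_endo_def pconst_hom peval_pnewton_phom)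
  qed
  thus ?thesis using assms by metis
qed

section \<open>Plethysm and the Hall pairing in power sum coordinates\<close>

text \<open>
  The index set of power sum polynomials, multisets, and that of the bases, partitions, correspond to
  each other with a shift by one.
\<close>

definition part_mset :: "nat list \<Rightarrow> nat multiset" where
  "part_mset \<rho> = mset (map (\<lambda>r. r - 1) \<rho>)"

definition mset_part :: "nat multiset \<Rightarrow> nat list" where
  "mset_part M = rev (map Suc (sorted_list_of_multiset M))"

lemma is_partition_mset_part: "is_partition (mset_part M)"
proof -
  have "sorted (map Suc (sorted_list_of_multiset M))"
    by (auto simp: sorted_map sorted_sorted_list_of_multiset intro: sorted_wrt_mono_rel[of _ "(\<le>)"])
  thus ?thesis by (auto simp: is_partition_def mset_part_def sorted_wrt_rev)
qed

lemma part_mset_mset_part: "part_mset (mset_part M) = M"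
proof -
  have "part_mset (mset_part M) = mset (rev (map (\<lambda>x. x) (sorted_list_of_multiset M)))"
    unfolding part_mset_def mset_part_def by (simp add: rev_map comp_def)
  thus ?thesis by simp
qed

lemma part_mset_inj:
  assumes "is_partition \<mu>" "is_partition \<nu>" "part_mset \<mu> = part_mset \<nu>"
  shows "\<mu> = \<nu>"
proof -
  have "image_mset Suc (part_mset \<rho>) = mset \<rho>" if "is_partition \<rho>" for \<rho>
  proof -
    have "map (\<lambda>r. Suc (r - 1)) \<rho> = map (\<lambda>r. r) \<rho>"
      using that by (intro map_cong refl) (auto simp: is_partition_def intro!: Suc_pred gr0I)
    thus ?thesis by (simp add: part_mset_def multiset.map_comp comp_def flip: mset_map)
  qed
  hence "mset \<mu> = mset \<nu>" using assms by metis
  hence "pnorm \<mu> = pnorm \<nu>"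
    unfolding pnorm_def by (metis mset_filter mset_eq_setD properties_for_sort sorted_sort mset_sort)
  thus ?thesis using pnorm_partition assms by metis
qed

definition coords_psym :: "(nat list \<Rightarrow>\<^sub>0 'k) \<Rightarrow> 'k::comm_ring_1 psym" where
  "coords_psym c = (\<Sum>\<rho>\<in>Poly_Mapping.keys c. Poly_Mapping.single (part_mset \<rho>) (Poly_Mapping.lookup c \<rho>))"

lemma coords_psym_inj:
  assumes "\<forall>\<mu>\<in>Poly_Mapping.keys c. is_partition \<mu>" "\<forall>\<mu>\<in>Poly_Mapping.keys d. is_partition \<mu>"
    "coords_psym c = coords_psym d"
  shows "c = d"
proof (rule poly_mapping_eqI)
  have lookup: "Poly_Mapping.lookup (coords_psym e) (part_mset \<rho>) = Poly_Mapping.lookup e \<rho>"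
    if "\<forall>\<mu>\<in>Poly_Mapping.keys e. is_partition \<mu>" "is_partition \<rho>" for e :: "nat list \<Rightarrow>\<^sub>0 'a" and \<rho>
  proof -
    have "Poly_Mapping.lookup (coords_psym e) (part_mset \<rho>) =
        (\<Sum>\<mu>\<in>Poly_Mapping.keys e. if \<mu> = \<rho> then Poly_Mapping.lookup e \<rho> else 0)"
      unfolding coords_psym_def lookup_sum
      by (rule sum.cong) (use that in \<open>auto simp: lookup_single when_def dest: part_mset_inj\<close>)
    also have "\<dots> = Poly_Mapping.lookup e \<rho>" by (auto simp: in_keys_iff)
    finally show ?thesis .
  qed
  fix \<rho>
  show "Poly_Mapping.lookup c \<rho> = Poly_Mapping.lookup d \<rho>"
  proof (cases "is_partition \<rho>")
    case True
    thus ?thesis using lookup assms by metis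
  next
    case False
    hence "\<rho> \<notin> Poly_Mapping.keys c" "\<rho> \<notin> Poly_Mapping.keys d" using assms(1,2) by auto
    thus ?thesis by (simp add: in_keys_iff)
  qed
qed

lemma coords_psym_surj:
  "\<exists>c. (\<forall>\<mu>\<in>Poly_Mapping.keys c. is_partition \<mu>) \<and> coords_psym c = f"
proof -
  define c where "c = (\<Sum>M\<in>Poly_Mapping.keys f. Poly_Mapping.single (mset_part M) (Poly_Mapping.lookup f M))"
  have add: "coords_psym (a + b) = coords_psym a + coords_psym b" for a b :: "nat list \<Rightarrow>\<^sub>0 'a"
  proof -
    have sup: "coords_psym x = (\<Sum>\<rho>\<in>A. Poly_Mapping.single (part_mset \<rho>) (Poly_Mapping.lookup x \<rho>))"
      if "finite A" "Poly_Mapping.keys x \<subseteq> A" for A and x :: "nat list \<Rightarrow>\<^sub>0 'a"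
      unfolding coords_psym_def using that by (intro sum.mono_neutral_left) (auto simp: in_keys_iff)
    let ?A = "Poly_Mapping.keys a \<union> Poly_Mapping.keys b"
    show ?thesis
      by (subst (1 2 3) sup[of ?A]) (auto simp: lookup_add single_add sum.distrib dest: set_mp[OF keys_add])
  qed
  have "coords_psym (\<Sum>M\<in>A. Poly_Mapping.single (mset_part M) (g M)) = (\<Sum>M\<in>A. Poly_Mapping.single M (g M))"
    for A and g :: "nat multiset \<Rightarrow> 'a"
  proof (induction A rule: infinite_finite_induct)
    case (insert M A)
    have "coords_psym (Poly_Mapping.single (mset_part M) (g M)) = Poly_Mapping.single M (g M)"
      by (cases "g M = 0") (auto simp: coords_psym_def part_mset_mset_part)
    thus ?case using insert by (simp add: add)
  qed (auto simp: coords_psym_def)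
  hence "coords_psym c = f" unfolding c_def by (subst (2) psym_expand[of f])
  moreover have "is_partition \<mu>" if "\<mu> \<in> Poly_Mapping.keys c" for \<mu>
  proof -
    have "Poly_Mapping.lookup c \<mu> \<noteq> 0" using that by (simp add: in_keys_iff)
    then obtain M where "Poly_Mapping.lookup (Poly_Mapping.single (mset_part M) (Poly_Mapping.lookup f M)) \<mu> \<noteq> 0"
      unfolding c_def lookup_sum by (meson sum.not_neutral_contains_not_neutral)
    hence "\<mu> = mset_part M" by (auto simp: lookup_single when_def split: if_splits)
    thus ?thesis by (simp add: is_partition_mset_part)
  qed
  ultimately show ?thesis by blast
qed

lemma pmono_part_mset:
  assumes "is_partition \<rho>"
  shows "pmono (part_mset \<rho>) = p_fun \<rho>"
proof -
  have "pmono (part_mset \<rho>) = prod_mset (mset (map (\<lambda>r. power_sum (Suc (r - 1))) \<rho>))"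
    by (simp add: pmono_def part_mset_def multiset.map_comp comp_def)
  also have "map (\<lambda>r. power_sum (Suc (r - 1))) \<rho> = map power_sum \<rho>"
    using assms by (intro map_cong refl arg_cong[of _ _ power_sum]) (auto simp: is_partition_def intro!: Suc_pred gr0I)
  finally show ?thesis by (simp only: prod_mset_prod_list p_fun_def)
qed

lemma sym_of_coords_psym:
  assumes "\<forall>\<mu>\<in>Poly_Mapping.keys c. is_partition \<mu>"
  shows "sym_of (coords_psym c) = (\<Sum>\<mu>\<in>Poly_Mapping.keys c. xconst (Poly_Mapping.lookup c \<mu>) * p_fun \<mu>)"
  unfolding coords_psym_def sym_of.hom_sum sym_of_single
  by (rule sum.cong) (use assms in \<open>auto simp: pmono_part_mset\<close>)

lemma basis_coords_p_fun:
  fixes f :: "'k::field_char_0 psym"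
  shows "(\<forall>\<mu>\<in>Poly_Mapping.keys (basis_coords p_fun (sym_of f)). is_partition \<mu>) \<and>
    coords_psym (basis_coords p_fun (sym_of f)) = f"
proof -
  let ?P = "\<lambda>c. (\<forall>\<mu>\<in>Poly_Mapping.keys c. is_partition \<mu>) \<and>
     sym_of f = (\<Sum>\<mu>\<in>Poly_Mapping.keys c. xconst (Poly_Mapping.lookup c \<mu>) * p_fun \<mu>)"
  have iff: "?P c \<longleftrightarrow> (\<forall>\<mu>\<in>Poly_Mapping.keys c. is_partition \<mu>) \<and> coords_psym c = f" for c
    using sym_of_coords_psym[of c] sym_of_inj[of f "coords_psym c"] by auto
  have "\<exists>!c. ?P c"
    unfolding iff using coords_psym_surj[of f] coords_psym_inj by (metis (no_types))
  hence "?P (basis_coords p_fun (sym_of f))"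
    unfolding basis_coords_def by (rule theI')
  thus ?thesis unfolding iff .
qed

lemma plethysm_sym_of:
  fixes f :: "'k::field_char_0 psym"
  shows "plethysm_one_minus a (sym_of f) = sym_of (pscale (\<lambda>i. 1 - a ^ Suc i) f)"
proof -
  define c where "c = basis_coords p_fun (sym_of f)"
  have c: "\<forall>\<mu>\<in>Poly_Mapping.keys c. is_partition \<mu>" "coords_psym c = f"
    using basis_coords_p_fun[of f] by (auto simp: c_def)
  interpret h: comm_ring_hom "pscale (\<lambda>i. 1 - a ^ Suc i)" by (rule pscale_hom)
  have single: "pscale (\<lambda>i. 1 - a ^ Suc i) (Poly_Mapping.single M d) =
      pconst d * prod_mset (image_mset (\<lambda>i. pconst (1 - a ^ Suc i) * pvar i) M)" for M d
    by (simp add: pscale_def peval_single pconst_hom)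
  have sym_prod: "sym_of (prod_mset (image_mset (\<lambda>i. pconst (1 - a ^ Suc i) * pvar i) M)) =
      prod_mset (image_mset (\<lambda>i. xconst (1 - a ^ Suc i) * power_sum (Suc i)) M)" for M
    by (induction M) (auto simp: sym_of.hom_mult simp del: power_Suc sym_of.prod_mset_image)
  have "sym_of (pscale (\<lambda>i. 1 - a ^ Suc i) f) =
     (\<Sum>\<rho>\<in>Poly_Mapping.keys c. xconst (Poly_Mapping.lookup c \<rho>) *
       prod_mset (image_mset (\<lambda>i. xconst (1 - a ^ Suc i) * power_sum (Suc i)) (part_mset \<rho>)))"
    by (subst c(2)[symmetric])
       (simp only: coords_psym_def h.hom_sum single sym_of.hom_sum sym_of.hom_mult sym_prod sym_of_pconst)
  also have "\<dots> = plethysm_one_minus a (sym_of f)"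
    unfolding plethysm_one_minus_def c_def[symmetric]
  proof (rule sum.cong [OF refl])
    fix \<rho> assume "\<rho> \<in> Poly_Mapping.keys c"
    hence \<rho>: "is_partition \<rho>" using c by blast
    have "prod_mset (image_mset (\<lambda>i. xconst (1 - a ^ Suc i) * power_sum (Suc i)) (part_mset \<rho>)) =
        prod_mset (mset (map (\<lambda>r. xconst (1 - a ^ Suc (r - 1)) * power_sum (Suc (r - 1))) \<rho>))"
      by (simp add: part_mset_def multiset.map_comp comp_def del: power_Suc)
    also have "map (\<lambda>r. xconst (1 - a ^ Suc (r - 1)) * power_sum (Suc (r - 1))) \<rho> =
        map (\<lambda>r. xconst (1 - a ^ r) * power_sum r) \<rho>"
    proof (rule map_cong [OF refl])
      fix r assume "r \<in> set \<rho>"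
      hence "Suc (r - 1) = r" using \<rho> by (auto simp: is_partition_def intro!: Suc_pred gr0I)
      thus "xconst (1 - a ^ Suc (r - 1)) * power_sum (Suc (r - 1)) = xconst (1 - a ^ r) * power_sum r" by simp
    qed
    finally show "xconst (Poly_Mapping.lookup c \<rho>) *
         prod_mset (image_mset (\<lambda>i. xconst (1 - a ^ Suc i) * power_sum (Suc i)) (part_mset \<rho>)) =
       xconst (Poly_Mapping.lookup c \<rho>) * prod_list (map (\<lambda>r. xconst (1 - a ^ r) * power_sum r) \<rho>)"
      by (simp only: prod_mset_prod_list)
  qed
  finally show ?thesis ..
qed

text \<open>
  The function \<open>h\<^sub>\<mu>\<close> has only one coordinate in the basis \<open>h\<close>, since the coordinates are unique.
\<close>

lemma hall_h_fun:
  assumes "is_partition \<mu>"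
  shows "hall F (h_fun \<mu> :: 'k::field_char_0 xps) = xcoeff F (part_monomial \<mu>)"
proof -
  interpret e: comm_ring_hom hom_endo by (rule hom_endo_hom)
  have h: "sym_of (hom_endo (Poly_Mapping.single (part_mset \<rho>) d)) = xconst d * (h_fun \<rho> :: 'k xps)"
    if "is_partition \<rho>" for \<rho> d
  proof -
    have "prod_mset (image_mset (\<lambda>i. phom (Suc i)) (part_mset \<rho>)) = (phprod \<rho> :: 'k psym)"
    proof -
      have "prod_mset (image_mset (\<lambda>i. phom (Suc i)) (part_mset \<rho>)) =
          (prod_mset (mset (map (\<lambda>r. phom (Suc (r - 1))) \<rho>)) :: 'k psym)"
        by (simp add: part_mset_def multiset.map_comp comp_def)
      also have "map (\<lambda>r. phom (Suc (r - 1)) :: 'k psym) \<rho> = map phom \<rho>"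
        using that by (intro map_cong refl arg_cong[of _ _ phom]) (auto simp: is_partition_def intro!: Suc_pred gr0I)
      finally show ?thesis by (simp only: prod_mset_prod_list phprod_def)
    qed
    hence "hom_endo (Poly_Mapping.single (part_mset \<rho>) d) = pconst d * phprod \<rho>"
      by (simp add: hom_endo_def peval_single[OF pconst_hom])
    moreover have "sym_of (phprod \<rho>) = (h_fun \<rho> :: 'k xps)"
      unfolding phprod_def h_fun_def by (induction \<rho>) (auto simp: sym_of.hom_mult sym_of_phom)
    ultimately show ?thesis by (simp add: sym_of.hom_mult)
  qed
  let ?P = "\<lambda>c. (\<forall>\<nu>\<in>Poly_Mapping.keys c. is_partition \<nu>) \<and>
     h_fun \<mu> = (\<Sum>\<nu>\<in>Poly_Mapping.keys c. xconst (Poly_Mapping.lookup c \<nu>) * (h_fun \<nu> :: 'k xps))"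
  have coords: "sym_of (hom_endo (coords_psym c)) =
      (\<Sum>\<nu>\<in>Poly_Mapping.keys c. xconst (Poly_Mapping.lookup c \<nu>) * (h_fun \<nu> :: 'k xps))"
    if "\<forall>\<nu>\<in>Poly_Mapping.keys c. is_partition \<nu>" for c :: "nat list \<Rightarrow>\<^sub>0 'k"
    unfolding coords_psym_def e.hom_sum sym_of.hom_sum by (rule sum.cong) (use that h in auto)
  define s where "s = Poly_Mapping.single \<mu> (1::'k)"
  have xconst1: "xconst 1 = (1 :: 'k xps)" by (rule xps_eqI) (simp add: xcoeff_xconst)
  have s: "?P s" using assms by (simp add: s_def xconst1)
  have "c = s" if "?P c" for c
  proof (rule coords_psym_inj)
    show "coords_psym c = coords_psym s"
      by (rule hom_endo_inj, rule sym_of_inj) (use that s coords[of c] coords[of s] in simp)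
  qed (use that s in auto)
  hence "basis_coords h_fun (h_fun \<mu>) = s"
    unfolding basis_coords_def using s by (intro the_equality)
  thus ?thesis by (simp add: hall_def s_def)
qed

lemma schur_span_imp_span:
  fixes f :: "'k::field_char_0 psym"
  assumes "sym_of f \<in> schur_span A"
  shows "f \<in> psym.span (pschur ` A)"
proof -
  obtain S c where S: "finite S" "S \<subseteq> A" "sym_of f = (\<Sum>\<nu>\<in>S. xconst (c \<nu>) * schur \<nu>)"
    using assms by (auto simp: schur_span_def)
  have "sym_of f = sym_of (\<Sum>\<nu>\<in>S. pconst (c \<nu>) * pschur \<nu>)"
    by (simp add: S(3) sym_of.hom_sum sym_of.hom_mult sym_of_pschur)
  hence "f = (\<Sum>\<nu>\<in>S. pconst (c \<nu>) * pschur \<nu>)" by (rule sym_of_inj)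
  also have "\<dots> \<in> psym.span (pschur ` A)"
    using S by (intro psym.span_sum psym.span_scale psym.span_base) auto
  finally show ?thesis .
qed

lemma schur_row_partition: "schur (row_partition n) = h_fun (row_partition n)"
proof (cases "n = 0")
  case False
  have "schur [n] = det (mat 1 1 (\<lambda>(i, j). complete_sym n))"
    unfolding schur_def by (intro arg_cong[of _ _ det] eq_matI) auto
  thus ?thesis using False by (simp add: row_partition_def h_fun_def det_single)
qed (simp add: row_partition_def h_fun_def schur_def)

section \<open>Specialization of the power sums at one\<close>

definition homog :: "nat \<Rightarrow> 'k::comm_ring_1 psym \<Rightarrow> bool" where
  "homog n f \<longleftrightarrow> (\<forall>M\<in>Poly_Mapping.keys f. pdeg M = n)"

lemma homog_0 [simp]: "homog n 0"
  by (simp add: homog_def)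

lemma homog_add: "homog n f \<Longrightarrow> homog n g \<Longrightarrow> homog n (f + g)"
  using keys_add[of f g] by (auto simp: homog_def)

lemma homog_sum: "(\<And>x. x \<in> A \<Longrightarrow> homog n (f x)) \<Longrightarrow> homog n (sum f A)"
  by (induction A rule: infinite_finite_induct) (auto intro: homog_add)

lemma homog_mult: "homog a f \<Longrightarrow> homog b g \<Longrightarrow> homog (a + b) (f * g)"
  using keys_mult[of f g] by (fastforce simp: homog_def)

lemma homog_pconst: "homog 0 (pconst c)"
  by (simp add: homog_def pconst_def)

lemma homog_pconst_mult: "homog n f \<Longrightarrow> homog n (pconst c * f)"
  using homog_mult[OF homog_pconst, of n f c] by simp

lemma homog_pvar: "homog (Suc i) (pvar i)"
  by (simp add: homog_def pvar_def)

lemma homog_phom: "homog n (phom n)"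
proof (induction n rule: less_induct)
  case (less n)
  show ?case
  proof (cases n)
    case 0
    thus ?thesis using homog_pconst[of 1] by simp
  next
    case (Suc k)
    have "homog n (pvar r * phom (k - r) :: 'a psym)" if "r \<le> k" for r
      using homog_mult[OF homog_pvar[of r] less[of "k - r"]] that Suc by simp
    thus ?thesis unfolding Suc phom.simps(2)
      by (intro homog_pconst_mult homog_sum) (auto simp: Suc)
  qed
qed

lemma homog_phprod: "homog (sum_list \<alpha>) (phprod \<alpha>)"
proof (induction \<alpha>)
  case Nil
  show ?case using homog_pconst[of 1] by (simp add: phprod_def)
next
  case (Cons a \<alpha>)
  show ?case using homog_mult[OF homog_phom[of a] Cons] by (simp add: phprod_def)
qed

lemma homog_pschur: "homog (sum_list \<nu>) (pschur \<nu>)"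
  unfolding pschur_expand
proof (rule homog_sum)
  fix \<sigma> assume \<sigma>: "\<sigma> \<in> {\<sigma>. \<sigma> permutes {0..<length \<nu>}}"
  have "homog (sum_list \<nu>) (jt_term \<nu> \<sigma> :: 'a psym)"
  proof (cases "\<sigma> = id \<or> jt_term \<nu> \<sigma> = (0 :: 'a psym)")
    case False
    then obtain \<alpha> where "jt_term \<nu> \<sigma> = (phprod \<alpha> :: 'a psym)" "sum_list \<alpha> = sum_list \<nu>"
      using jt_term_dominates[of \<sigma> \<nu>] \<sigma> by (auto simp: prefix_dominates_def)
    thus ?thesis using homog_phprod[of \<alpha>, where ?'a = 'a] by simp
  qed (auto simp: jt_term_id homog_phprod)
  hence "homog (sum_list \<nu>) (pconst (signof \<sigma>) * jt_term \<nu> \<sigma> :: 'a psym)"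
    by (rule homog_pconst_mult)
  thus "homog (sum_list \<nu>) (signof \<sigma> * jt_term \<nu> \<sigma> :: 'a psym)" by simp
qed

lemma homog_pscale:
  assumes "homog n f"
  shows "homog n (pscale b f)"
proof -
  interpret comm_ring_hom "pscale b" by (rule pscale_hom)
  have "pscale b (Poly_Mapping.single M c) = Poly_Mapping.single M (c * prod_mset (image_mset b M))" for M c
  proof -
    have "prod_mset (image_mset (\<lambda>i. pconst (b i) * pvar i) M) =
        pconst (prod_mset (image_mset b M)) * prod_mset (image_mset pvar M)"
      by (induction M) (auto simp: pconst.hom_mult mult_ac simp del: pconst.prod_mset_image)
    thus ?thesis
      by (simp add: pscale_def peval_single[OF pconst_hom] single_conv_pvar[of M "c * _"] pconst.hom_mult mult_ac
          del: pconst.prod_mset_image)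
  qed
  hence "homog n (pscale b (Poly_Mapping.single M (Poly_Mapping.lookup f M)))" if "M \<in> Poly_Mapping.keys f" for M
    using that assms by (auto simp: homog_def)
  thus ?thesis by (subst psym_expand[of f]) (auto simp: hom_sum intro: homog_sum)
qed

lemma homog_span:
  assumes "f \<in> psym.span (pschur ` A)" "\<And>\<nu>. \<nu> \<in> A \<Longrightarrow> sum_list \<nu> = n"
  shows "homog n f"
  using assms(1)
proof (induction rule: psym.span_induct_alt)
  case (step c x y)
  then obtain \<nu> where "\<nu> \<in> A" "x = pschur \<nu>" by auto
  hence "homog n x" using homog_pschur[of \<nu>] assms(2) by metis
  thus ?case using step by (intro homog_add homog_pconst_mult)
qed simp

lemma xcoeff_pmono_row:
  "xcoeff (pmono M :: 'k::comm_ring_1 xps) (replicate_mset n 0) = (if pdeg M = n then 1 else 0)"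
proof (induction M arbitrary: n)
  case (add r M)
  have "{i. i \<in># replicate_mset n 0 \<and> Suc r \<le> count (replicate_mset n 0) i} = (if Suc r \<le> n then {0::nat} else {})"
    by (auto split: if_splits)
  moreover have "replicate_mset n 0 - replicate_mset (Suc r) 0 = (replicate_mset (n - Suc r) 0 :: nat multiset)"
    by (rule multiset_eqI) auto
  ultimately show ?case
    unfolding xcoeff_pmono_add by (auto simp: add.IH simp del: replicate_mset_Suc)
qed (auto simp: xcoeff_pmono_empty)

text \<open>
  The variable \<open>x\<^sub>1\<close> must come from one of the factors \<open>p\<^sub>1\<close>, and all other factors contribute
  powers of \<open>x\<^sub>0\<close>.
\<close>

lemma xcoeff_pmono_hook:
  "xcoeff (pmono M :: 'k::comm_ring_1 xps) (add_mset (Suc 0) (replicate_mset n 0)) =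
     (if pdeg M = Suc n then of_nat (count M 0) else 0)"
proof (induction M arbitrary: n)
  case (add r M)
  let ?m = "add_mset (Suc 0) (replicate_mset n 0) :: nat multiset"
  have I: "{i. i \<in># ?m \<and> Suc r \<le> count ?m i} = (if Suc r \<le> n then {0} else {}) \<union> (if r = 0 then {Suc 0} else {})"
    by (auto split: if_splits)
  have 0: "?m - replicate_mset (Suc r) 0 = add_mset (Suc 0) (replicate_mset (n - Suc r) 0)"
    by (rule multiset_eqI) auto
  have 1: "?m - replicate_mset (Suc r) (Suc 0) = replicate_mset n 0" if "r = 0"
    using that by (intro multiset_eqI) auto
  have M: "M = {#}" if "pdeg M = 0" using that by (cases M) auto
  have "xcoeff (pmono (add_mset r M) :: 'k xps) ?m =
      (if Suc r \<le> n then xcoeff (pmono M) (?m - replicate_mset (Suc r) 0) else 0) +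
      (if r = 0 then xcoeff (pmono M) (?m - replicate_mset (Suc r) (Suc 0)) else 0)"
    unfolding xcoeff_pmono_add I by (subst sum.union_disjoint) (auto simp del: replicate_mset_Suc)
  also have "\<dots> = (if Suc r \<le> n \<and> pdeg M = Suc (n - Suc r) then of_nat (count M 0) else 0) +
      (if r = 0 \<and> pdeg M = n then 1 else 0)"
    unfolding 0 using 1 by (auto simp: add.IH xcoeff_pmono_row simp del: replicate_mset_Suc)
  also have "\<dots> = (if pdeg (add_mset r M) = Suc n then of_nat (count (add_mset r M) 0) else 0)"
    using M by (cases "pdeg M = 0") auto
  finally show ?case .
qed (auto simp: xcoeff_pmono_empty)

text \<open>
  The specialization of all power sums to \<open>1\<close>, that is, to the alphabet with the single variable
  \<open>1\<close>.
\<close>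

definition eps :: "'k::comm_ring_1 psym \<Rightarrow> 'k" where
  "eps f = (\<Sum>M\<in>Poly_Mapping.keys f. Poly_Mapping.lookup f M)"

text \<open>
  The specialization of the derivative with respect to \<open>p\<^sub>1\<close>.
\<close>

definition eps_deriv :: "'k::comm_ring_1 psym \<Rightarrow> 'k" where
  "eps_deriv f = (\<Sum>M\<in>Poly_Mapping.keys f. Poly_Mapping.lookup f M * of_nat (count M 0))"

lemma xcoeff_row:
  assumes "homog n f"
  shows "xcoeff (sym_of f) (replicate_mset n 0) = eps f"
  unfolding xcoeff_sym_of eps_def
  by (rule sum.cong) (use assms in \<open>auto simp: xcoeff_pmono_row homog_def\<close>)

lemma xcoeff_hook:
  assumes "homog (Suc n) f"
  shows "xcoeff (sym_of f) (add_mset (Suc 0) (replicate_mset n 0)) = eps_deriv f"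
  unfolding xcoeff_sym_of eps_deriv_def
  by (rule sum.cong) (use assms in \<open>auto simp: xcoeff_pmono_hook homog_def\<close>)

lemma eps_peval: "eps f = peval (\<lambda>x. x) (\<lambda>_. 1) f"
  by (simp add: eps_def peval_def)

lemma id_ring_hom: "comm_ring_hom (\<lambda>x. x)"
  by unfold_locales auto

lemma eps_hom: "comm_ring_hom eps"
  using peval_hom[OF id_ring_hom, of "\<lambda>_. 1"] by (simp add: eps_peval[abs_def])

text \<open>
  For a single variable, \<open>\<Sum>\<^sub>m (-1)\<^sup>m e\<^sub>m s\<^sup>m = 1 - s\<close>.
\<close>

lemma eps_neg_hom: "eps (neg_hom (\<lambda>_. 1) m) = (if m = 0 then 1 else if m = 1 then -1 else (0::'k::field_char_0))"
proof -
  interpret comm_ring_hom "eps :: 'k psym \<Rightarrow> 'k" by (rule eps_hom)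
  have E: "exp_series (\<lambda>r. - pvar (r - 1)) (Abs_fps (neg_hom (\<lambda>_. 1) :: nat \<Rightarrow> 'k psym))"
    unfolding neg_hom_def by (rule exp_series_cong[OF exp_series_peval[OF pconst_hom]]) auto
  have v: "eps (pvar i :: 'k psym) = 1" for i
    by (simp add: eps_peval id_ring_hom)
  have "exp_series (\<lambda>r. - (1 ^ r)) (Abs_fps (\<lambda>m. eps (neg_hom (\<lambda>_. 1) m :: 'k psym)))"
    using exp_series_hom[OF eps_hom E] by (simp add: hom_uminus v)
  moreover have "exp_series (\<lambda>r. - (1 ^ r)) (1 - fps_const 1 * fps_X :: 'k fps)"
    by (rule exp_series_linear)
  ultimately have "Abs_fps (\<lambda>m. eps (neg_hom (\<lambda>_. 1) m :: 'k psym)) = 1 - fps_const 1 * fps_X"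
    by (rule exp_series_unique[OF id_ring_hom])
  hence "fps_nth (Abs_fps (\<lambda>m. eps (neg_hom (\<lambda>_. 1) m :: 'k psym))) m = fps_nth (1 - fps_const 1 * fps_X) m"
    by simp
  thus ?thesis by (auto simp: fps_X_def)
qed

text \<open>
  By \<open>eps_neg_hom\<close> only the coefficients of \<open>z\<^sup>0\<close> and \<open>z\<^sup>1\<close> survive.  The alphabet enters the latter
  through the factors \<open>p\<^sub>1 + (1 - q) (1 - t) z\<close> only.
\<close>

lemma eps_macdonald_op: "eps (macdonald_op q t f) = eps f - (1 - q) * (1 - t) * eps_deriv f"
proof -
  let ?T = "add_alphabet (\<lambda>i. (1 - q ^ Suc i) * (1 - t ^ Suc i))"
  interpret e: comm_ring_hom eps by (rule eps_hom)
  interpret T: comm_ring_hom ?T by (rule add_alphabet_hom)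
  interpret m: comm_ring_hom "map_poly (eps :: 'a psym \<Rightarrow> 'a)" by (rule map_poly_hom[OF eps_hom])
  have ct: "ct (\<lambda>m. eps (neg_hom (\<lambda>_. 1) m)) a = coeff a 0 - coeff a 1" for a :: "'a poly"
  proof -
    have "ct (\<lambda>m. eps (neg_hom (\<lambda>_. 1) m)) a = (\<Sum>m\<le>Suc (degree a). coeff a m * eps (neg_hom (\<lambda>_. 1) m))"
      by (rule ct_superset) simp
    also have "\<dots> = (\<Sum>m\<in>{0, 1}. coeff a m * eps (neg_hom (\<lambda>_. 1) m))"
      by (rule sum.mono_neutral_right) (auto simp: eps_neg_hom)
    finally show ?thesis by (simp add: eps_neg_hom)
  qed
  have v: "map_poly eps (?T (pvar i)) = [:1:] + monom ((1 - q ^ Suc i) * (1 - t ^ Suc i)) (Suc i)" for i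
  proof -
    have "eps (pvar i :: 'a psym) = 1" "eps (pconst c) = c" for c :: 'a
      by (simp_all add: eps_peval id_ring_hom)
    thus ?thesis
      by (simp add: m.hom_add map_poly_pCons map_poly_monom del: power_Suc)
  qed
  have c: "map_poly eps (?T (pconst d)) = [:d:]" for d
  proof -
    have "eps (pconst c) = c" for c :: 'a by (simp add: eps_peval id_ring_hom)
    thus ?thesis by (simp add: map_poly_pCons)
  qed
  have prod: "coeff (map_poly eps (?T (prod_mset (image_mset pvar M)))) 0 = 1 \<and>
     coeff (map_poly eps (?T (prod_mset (image_mset pvar M)))) 1 = of_nat (count M 0) * ((1 - q) * (1 - t))" for M
  proof (induction M)
    case (add i M)
    have *: "map_poly eps (?T (prod_mset (image_mset pvar (add_mset i M)))) =
       ([:1:] + monom ((1 - q ^ Suc i) * (1 - t ^ Suc i)) (Suc i)) * map_poly eps (?T (prod_mset (image_mset pvar M)))"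
      by (simp add: T.hom_mult m.hom_mult v del: add_alphabet_pvar power_Suc T.prod_mset_image m.prod_mset_image)
    have "coeff (monom x (Suc i) * p) 0 = 0" "coeff (monom x (Suc i) * p) (Suc 0) = (if i = 0 then x * coeff p 0 else 0)" for x :: 'a and p
      by (auto simp: coeff_monom_mult)
    thus ?case using add.IH unfolding * by (auto simp: distrib_right simp del: T.prod_mset_image m.prod_mset_image)
  qed (simp del: power_Suc)
  have "eps (macdonald_op q t f) = coeff (map_poly eps (?T f)) 0 - coeff (map_poly eps (?T f)) 1"
    unfolding macdonald_op_def ct_hom[OF eps_hom] ct ..
  also have "?T f = (\<Sum>M\<in>Poly_Mapping.keys f. ?T (pconst (Poly_Mapping.lookup f M) * prod_mset (image_mset pvar M)))"
    by (subst psym_expand[of f]) (simp only: T.hom_sum single_conv_pvar)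
  also have "map_poly eps \<dots> = (\<Sum>M\<in>Poly_Mapping.keys f.
      Polynomial.smult (Poly_Mapping.lookup f M) (map_poly eps (?T (prod_mset (image_mset pvar M)))))"
    by (simp add: m.hom_sum T.hom_mult m.hom_mult c del: power_Suc T.prod_mset_image m.prod_mset_image add_alphabet_pconst)
  also have "coeff \<dots> 0 - coeff \<dots> 1 = eps f - (1 - q) * (1 - t) * eps_deriv f"
    using prod by (simp add: coeff_sum eps_def eps_deriv_def sum_distrib_left mult_ac
      del: T.prod_mset_image m.prod_mset_image)
  finally show ?thesis .
qed


section \<open>Two coefficients of the modified Macdonald functions\<close>

definition qpoly :: "rat poly poly" where "qpoly = [:[:0, 1:]:]"
definition tpoly :: "rat poly poly" where "tpoly = [:0, 1:]"

lemma fract_hom: "comm_ring_hom (\<lambda>p::rat poly poly. Fract p 1)"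
  by unfold_locales (auto simp: One_fract_def Zero_fract_def)

lemma fract_eq_iff: "Fract p 1 = Fract q (1 :: rat poly poly) \<longleftrightarrow> p = q"
  by (simp add: eq_fract)

lemma cell_sum_fract:
  "cell_sum var1 var2 \<nu> = Fract (cell_sum qpoly tpoly \<nu>) 1"
  "cell_sum var2 var1 \<nu> = Fract (cell_sum tpoly qpoly \<nu>) 1"
proof -
  interpret comm_ring_hom "\<lambda>p::rat poly poly. Fract p 1" by (rule fract_hom)
  show "cell_sum var1 var2 \<nu> = Fract (cell_sum qpoly tpoly \<nu>) 1"
    "cell_sum var2 var1 \<nu> = Fract (cell_sum tpoly qpoly \<nu>) 1"
    unfolding cell_sum_def var1_def var2_def qpoly_def tpoly_def
    by (simp_all only: hom_sum hom_mult hom_power)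
qed

lemma power_var_neq_1: "var1 ^ Suc i \<noteq> 1" "var2 ^ Suc i \<noteq> 1"
proof -
  interpret comm_ring_hom "\<lambda>p::rat poly poly. Fract p 1" by (rule fract_hom)
  have "1 < (2::rat) ^ Suc i" by (rule one_less_power) auto
  hence 2: "(2::rat) ^ Suc i \<noteq> 1" by (simp only: less_irrefl order.strict_iff_not) auto
  \<comment> \<open>At \<open>q = t = 2\<close> a power of a variable takes a value different from 1.\<close>
  have "poly (poly (qpoly ^ Suc i) [:2:]) 2 \<noteq> poly (poly 1 [:2:]) 2"
    "poly (poly (tpoly ^ Suc i) [:2:]) 2 \<noteq> poly (poly 1 [:2:]) 2"
    using 2 by (simp_all add: qpoly_def tpoly_def poly_power del: power_Suc)
  hence "qpoly ^ Suc i \<noteq> 1" "tpoly ^ Suc i \<noteq> 1" by metis+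
  thus "var1 ^ Suc i \<noteq> 1" "var2 ^ Suc i \<noteq> 1"
    unfolding var1_def var2_def qpoly_def[symmetric] tpoly_def[symmetric]
    by (metis fract_eq_iff hom_one hom_power)+
qed

text \<open>
  Compare the derivatives with respect to \<open>t\<close> at \<open>q = t = 1\<close>: these are \<open>\<Sum> i \<nu>\<^sub>i\<close> and
  \<open>\<Sum> \<kappa>\<^sub>i (\<kappa>\<^sub>i - 1) / 2\<close>, and for a partition \<open>\<nu>\<close> they determine the two statistics.
\<close>

lemma cell_sum_separates:
  assumes "cell_sum var1 var2 \<nu> = cell_sum var2 var1 \<kappa>" "is_partition \<nu>" "sum_list \<nu> = sum_list \<kappa>"
  shows "col_stat \<nu> = sum_list (map (\<lambda>x. x\<^sup>2) \<kappa>)"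
proof -
  \<comment> \<open>The outer polynomial variable is \<open>t\<close>, so \<open>pderiv\<close> is the derivative with respect to \<open>t\<close>.\<close>
  define \<delta> :: "rat poly poly \<Rightarrow> rat" where "\<delta> = (\<lambda>p. poly (poly (pderiv p) 1) 1)"
  have \<delta>_sum: "\<delta> (sum f A) = (\<Sum>x\<in>A. \<delta> (f x))" for f :: "nat \<Rightarrow> _" and A
    by (induction A rule: infinite_finite_induct) (auto simp: \<delta>_def pderiv_add)
  have pq: "pderiv (qpoly ^ j) = 0" for j
    by (induction j) (auto simp: qpoly_def pderiv_mult pderiv_pCons pderiv_smult)
  have "pderiv tpoly = 1" by (simp add: tpoly_def pderiv_pCons)
  hence pt: "pderiv (tpoly ^ i) = Polynomial.smult (of_nat i) (tpoly ^ (i - 1))" for i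
    by (cases i) (simp_all add: pderiv_power_Suc del: of_nat_Suc power_Suc)
  have one: "poly (poly tpoly 1) 1 = 1" "poly (poly qpoly 1) 1 = 1"
    by (simp_all add: tpoly_def qpoly_def)
  have \<delta>: "\<delta> (tpoly ^ i * qpoly ^ j) = of_nat i" for i j
    by (simp add: \<delta>_def pderiv_mult pq pt one of_nat_poly poly_power)
  have "cell_sum qpoly tpoly \<nu> = cell_sum tpoly qpoly \<kappa>"
    using assms(1) by (simp only: cell_sum_fract fract_eq_iff)
  hence "\<delta> (cell_sum qpoly tpoly \<nu>) = \<delta> (cell_sum tpoly qpoly \<kappa>)" by simp
  moreover have "\<delta> (cell_sum qpoly tpoly \<nu>) = of_nat (\<Sum>i<length \<nu>. i * \<nu> ! i)"
    unfolding cell_sum_def sum_distrib_left by (simp add: \<delta>_sum \<delta>) (simp only: mult.commute)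
  moreover have "\<delta> (cell_sum tpoly qpoly \<kappa>) = of_nat (\<Sum>i<length \<kappa>. \<Sum>j<\<kappa> ! i. j)"
    unfolding cell_sum_def sum_distrib_left
    by (simp add: \<delta>_sum \<delta> mult.commute[of "qpoly ^ _" "tpoly ^ _"])
  ultimately have eq: "(\<Sum>i<length \<nu>. i * \<nu> ! i) = (\<Sum>i<length \<kappa>. \<Sum>j<\<kappa> ! i. j)"
    by (metis of_nat_eq_iff)
  have "col_stat \<nu> = (\<Sum>i<length \<nu>. (2 * i + 1) * \<nu> ! i)"
    using assms(2) by (intro col_stat_decreasing) (simp add: is_partition_def)
  also have "\<dots> = 2 * (\<Sum>i<length \<nu>. i * \<nu> ! i) + sum_list \<nu>"
    by (simp add: sum_list_sum_nth atLeast0LessThan sum.distrib sum_distrib_left algebra_simps)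
  also have "\<dots> = 2 * (\<Sum>i<length \<kappa>. \<Sum>j<\<kappa> ! i. j) + sum_list \<kappa>"
    by (simp only: eq assms(3))
  also have "\<dots> = (\<Sum>i<length \<kappa>. 2 * (\<Sum>j<\<kappa> ! i. j) + \<kappa> ! i)"
    by (simp add: sum_list_sum_nth atLeast0LessThan sum.distrib sum_distrib_left)
  also have "\<dots> = sum_list (map (\<lambda>x. x\<^sup>2) \<kappa>)"
  proof -
    have "2 * (\<Sum>j<m. j) + m = m\<^sup>2" for m :: nat
      by (induction m) (auto simp: power2_eq_square)
    thus ?thesis by (simp add: sum_list_sum_nth atLeast0LessThan)
  qed
  finally show ?thesis .
qed

text \<open>
  Applying \<open>eps\<close> to the eigenvector equation gives
  \<open>eps f - (1 - q) (1 - t) eps_deriv f = e\<^sub>\<mu> eps f\<close>, where \<open>eps f = 1\<close> is the normalization and \<open>eps_deriv f\<close>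
  is the coefficient in question.
\<close>

lemma modified_macdonald_coefficients:
  assumes \<mu>: "is_partition \<mu>" and H: "is_modified_macdonald \<mu> H"
  shows "xcoeff H m \<noteq> 0 \<Longrightarrow> size m = sum_list \<mu>"
    and "xcoeff H (replicate_mset (sum_list \<mu>) 0) = 1"
    and "sum_list \<mu> = Suc n \<Longrightarrow> xcoeff H (add_mset (Suc 0) (replicate_mset n 0)) = cell_sum var1 var2 \<mu>"
proof -
  define N where "N = sum_list \<mu>"
  obtain f where f: "sym_of f = H"
    using sym_of_surj H by (auto simp: is_modified_macdonald_def)
  have q: "pscale (\<lambda>i. 1 - var1 ^ Suc i) f \<in> psym.span (pschur ` {\<nu>. is_partition \<nu> \<and> \<nu> \<unrhd> \<mu>})"
    using H unfolding is_modified_macdonald_def f[symmetric] plethysm_sym_of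
    by (intro schur_span_imp_span) auto
  have t: "pscale (\<lambda>i. 1 - var2 ^ Suc i) f \<in> psym.span (pschur ` {\<nu>. is_partition \<nu> \<and> \<nu> \<unrhd> conjugate \<mu>})"
    using H unfolding is_modified_macdonald_def f[symmetric] plethysm_sym_of
    by (intro schur_span_imp_span) auto
  have "homog N (pscale (\<lambda>i. 1 - var1 ^ Suc i) f)"
    using q by (rule homog_span) (auto simp: dominates_def N_def)
  hence "homog N (unscale var1 (pscale (\<lambda>i. 1 - var1 ^ Suc i) f))"
    unfolding unscale_def by (rule homog_pscale)
  hence hom: "homog N f" by (simp only: unscale_pscale[OF power_var_neq_1(1)])
  show "size m = sum_list \<mu>" if "xcoeff H m \<noteq> 0"
  proof -
    have "(\<Sum>M\<in>Poly_Mapping.keys f. Poly_Mapping.lookup f M * xcoeff (pmono M) m) \<noteq> 0"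
      using that by (simp only: f[symmetric] xcoeff_sym_of not_False_eq_True)
    then obtain M where M: "M \<in> Poly_Mapping.keys f" "Poly_Mapping.lookup f M * xcoeff (pmono M) m \<noteq> 0"
      by (rule sum.not_neutral_contains_not_neutral)
    hence "xcoeff (pmono M :: ratfun xps) m \<noteq> 0" by (simp only: mult_eq_0_iff de_Morgan_disj simp_thms)
    hence "size m = pdeg M" by (rule xcoeff_pmono_degree)
    thus ?thesis using hom M(1) by (simp only: homog_def N_def)
  qed
  have row: "is_partition (row_partition N)" "part_monomial (row_partition N) = replicate_mset N 0"
    by (auto simp: row_partition_def is_partition_def part_monomial_def)
  have "hall H (h_fun (row_partition N)) = 1"
    using H by (simp add: is_modified_macdonald_def schur_row_partition N_def)
  hence one: "xcoeff H (replicate_mset N 0) = 1"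
    by (simp add: hall_h_fun[OF row(1)] row(2))
  thus "xcoeff H (replicate_mset (sum_list \<mu>) 0) = 1" by (simp add: N_def)
  have eps: "eps f = 1" using xcoeff_row[OF hom] one f by simp
  have "macdonald_op var1 var2 f = pconst (macdonald_eigenvalue var1 var2 \<mu>) * f"
    by (rule macdonald_op_eigenvector[OF power_var_neq_1 \<mu> _ q t]) (rule cell_sum_separates)
  hence "eps (macdonald_op var1 var2 f) = eps (pconst (macdonald_eigenvalue var1 var2 \<mu>) * f)" by simp
  also have "\<dots> = macdonald_eigenvalue var1 var2 \<mu>"
  proof -
    interpret comm_ring_hom "eps :: ratfun psym \<Rightarrow> _" by (rule eps_hom)
    show ?thesis by (simp add: hom_mult eps) (simp add: eps_peval id_ring_hom)
  qed
  finally have "(1 - var1) * (1 - var2) * eps_deriv f = (1 - var1) * (1 - var2) * cell_sum var1 var2 \<mu>"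
    by (simp add: eps_macdonald_op eps macdonald_eigenvalue_def)
  hence "eps_deriv f = cell_sum var1 var2 \<mu>"
    using power_var_neq_1[of 0] by simp
  thus "xcoeff H (add_mset (Suc 0) (replicate_mset n 0)) = cell_sum var1 var2 \<mu>" if "sum_list \<mu> = Suc n"
    using xcoeff_hook[of n f] hom that f by (simp add: N_def)
qed

section \<open>The average of the eigenvalue over partitions\<close>

definition trunc_eq :: "nat \<Rightarrow> 'a fps \<Rightarrow> 'a fps \<Rightarrow> bool" where
  "trunc_eq N F G \<longleftrightarrow> (\<forall>n\<le>N. fps_nth F n = fps_nth G n)"

lemma trunc_eq_refl [simp]: "trunc_eq N F F"
  by (simp add: trunc_eq_def)

lemma trunc_eq_trans [trans]: "trunc_eq N F G \<Longrightarrow> trunc_eq N G H \<Longrightarrow> trunc_eq N F H"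
  by (simp add: trunc_eq_def)

lemma trunc_eq_sym: "trunc_eq N F G \<Longrightarrow> trunc_eq N G F"
  by (simp add: trunc_eq_def)

lemma trunc_eq_mult:
  fixes F G :: "'a::comm_ring_1 fps"
  assumes "trunc_eq N F F'" "trunc_eq N G G'"
  shows "trunc_eq N (F * G) (F' * G')"
  using assms by (auto simp: trunc_eq_def fps_mult_nth intro!: sum.cong)

lemma trunc_eq_power_X_mult:
  fixes F G :: "'a::comm_ring_1 fps"
  assumes "N < k"
  shows "trunc_eq N (F + fps_X ^ k * G) F"
  using assms by (auto simp: trunc_eq_def fps_X_power_mult_nth)

text \<open>
  Partitions with at most \<open>N\<close> parts, padded with zeros to length \<open>N\<close>.  The fixed length gives simple
  recursions: either the last entry is 0, or all entries can be decreased by one.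
\<close>

definition decreasing_vectors :: "nat \<Rightarrow> nat \<Rightarrow> nat list set" where
  "decreasing_vectors N n = {xs. length xs = N \<and> sorted_wrt (\<ge>) xs \<and> sum_list xs = n}"

lemma finite_decreasing_vectors [simp]: "finite (decreasing_vectors N n)"
  by (rule finite_subset[of _ "{xs. set xs \<subseteq> {..n} \<and> length xs = N}"])
     (auto simp: decreasing_vectors_def finite_lists_length_eq intro: member_le_sum_list)

lemma decreasing_vectors_0: "decreasing_vectors 0 n = (if n = 0 then {[]} else {})"
  by (auto simp: decreasing_vectors_def)

lemma decreasing_vectors_Suc:
  "decreasing_vectors (Suc N) n = (\<lambda>xs. xs @ [0]) ` decreasing_vectors N n \<union>
     (if Suc N \<le> n then map Suc ` decreasing_vectors (Suc N) (n - Suc N) else {})" (is "?L = ?R")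
proof (rule Set.set_eqI, rule iffI)
  fix xs assume xs: "xs \<in> ?L"
  show "xs \<in> ?R"
  proof (cases "last xs = 0")
    case True
    have "xs \<noteq> []" using xs by (auto simp: decreasing_vectors_def)
    hence "xs = butlast xs @ [0]" using True by (metis append_butlast_last_id)
    moreover have "butlast xs \<in> decreasing_vectors N n"
      using xs \<open>xs = butlast xs @ [0]\<close>
      by (auto simp: decreasing_vectors_def butlast_conv_take sorted_wrt_take)
         (metis add.right_neutral sum_list.Cons sum_list.Nil sum_list_append butlast_conv_take diff_Suc_1)
    ultimately show ?thesis by blast
  next
    case False
    have len: "length xs = Suc N" and sorted: "sorted_wrt (\<ge>) xs" and sum: "sum_list xs = n"
      using xs by (auto simp: decreasing_vectors_def)
    have pos: "x \<noteq> 0" if "x \<in> set xs" for x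
    proof -
      have "xs = butlast xs @ [last xs]" using len by (metis append_butlast_last_id list.size(3) nat.distinct(1))
      hence "last xs \<le> x" using sorted that
        by (metis (no_types, lifting) Un_iff list.set(1) list.set_intros(1) order_refl set_append set_ConsD sorted_wrt_append empty_iff)
      thus ?thesis using False by auto
    qed
    define ys where "ys = map (\<lambda>x. x - 1) xs"
    have xs_eq: "xs = map Suc ys"
      unfolding ys_def map_map comp_def
    proof (rule nth_equalityI)
      fix i assume "i < length xs"
      hence "xs ! i \<noteq> 0" using pos nth_mem by blast
      thus "xs ! i = map (\<lambda>x. Suc (x - 1)) xs ! i" using \<open>i < length xs\<close> by simp
    qed simp
    have sumS: "sum_list (map Suc ys) = sum_list ys + length ys" by (induction ys) auto
    have "n = sum_list ys + Suc N" using sum len sumS unfolding xs_eq by simp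
    moreover have "sorted_wrt (\<ge>) ys" using sorted unfolding xs_eq by (simp add: sorted_wrt_map)
    ultimately have "Suc N \<le> n" "ys \<in> decreasing_vectors (Suc N) (n - Suc N)"
      using len by (auto simp: decreasing_vectors_def ys_def)
    thus ?thesis using xs_eq by auto
  qed
next
  have sumS: "sum_list (map Suc ys) = sum_list ys + length ys" for ys by (induction ys) auto
  fix xs assume "xs \<in> ?R"
  thus "xs \<in> ?L"
    by (auto simp: decreasing_vectors_def sorted_wrt_append sorted_wrt_map sumS split: if_splits)
qed

lemma sum_decreasing_vectors_Suc:
  fixes f :: "nat list \<Rightarrow> 'a::comm_monoid_add"
  shows "(\<Sum>xs\<in>decreasing_vectors (Suc N) n. f xs) = (\<Sum>xs\<in>decreasing_vectors N n. f (xs @ [0])) +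
    (if Suc N \<le> n then \<Sum>xs\<in>decreasing_vectors (Suc N) (n - Suc N). f (map Suc xs) else 0)"
proof -
  let ?B = "if Suc N \<le> n then map Suc ` decreasing_vectors (Suc N) (n - Suc N) else {}"
  have "(\<lambda>xs. xs @ [0]) ` decreasing_vectors N n \<inter> ?B = {}"
  proof -
    have "xs @ [0] \<noteq> map Suc ys" for xs ys :: "nat list"
      by (metis in_set_conv_decomp list.set_map image_iff nat.distinct(1))
    thus ?thesis by auto
  qed
  hence "(\<Sum>xs\<in>decreasing_vectors (Suc N) n. f xs) =
      (\<Sum>xs\<in>(\<lambda>xs. xs @ [0]) ` decreasing_vectors N n. f xs) + (\<Sum>xs\<in>?B. f xs)"
    unfolding decreasing_vectors_Suc[of N n] by (intro sum.union_disjoint) auto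
  thus ?thesis by (simp add: sum.reindex inj_on_def inj_on_mapI)
qed

definition vec_count :: "nat \<Rightarrow> 'k::field_char_0 fps" where
  "vec_count N = Abs_fps (\<lambda>n. \<Sum>xs\<in>decreasing_vectors N n. 1)"

text \<open>
  The \<open>N\<close>-variable form of the sum in \<open>macdonald_eigenvalue_alt\<close> at \<open>t = 1/q\<close>, up to the factor
  \<open>q - 1\<close>.
\<close>

definition vec_weight :: "'k \<Rightarrow> nat \<Rightarrow> 'k::field_char_0 fps" where
  "vec_weight q N = Abs_fps (\<lambda>n. \<Sum>xs\<in>decreasing_vectors N n. \<Sum>i<N. q ^ (xs ! i) * inverse q ^ Suc i)"

lemma vec_count_0: "vec_count 0 = 1"
  by (rule fps_ext) (simp add: vec_count_def decreasing_vectors_0)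

lemma vec_weight_0: "vec_weight q 0 = 0"
  by (rule fps_ext) (simp add: vec_weight_def)

lemma vec_count_Suc: "vec_count (Suc N) * (1 - fps_X ^ Suc N) = vec_count N"
proof -
  have "vec_count (Suc N) = vec_count N + fps_X ^ Suc N * (vec_count (Suc N) :: 'a fps)"
  proof (rule fps_ext)
    fix n
    show "fps_nth (vec_count (Suc N)) n = fps_nth (vec_count N + fps_X ^ Suc N * (vec_count (Suc N) :: 'a fps)) n"
      unfolding fps_add_nth fps_X_power_mult_nth vec_count_def fps_nth_Abs_fps
      by (subst sum_decreasing_vectors_Suc) (auto simp: not_less simp del: sum_constant)
  qed
  thus ?thesis by (simp add: algebra_simps)
qed

lemma vec_weight_Suc:
  assumes "q \<noteq> 0"
  shows "vec_weight q (Suc N) * (1 - fps_const q * fps_X ^ Suc N) =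
    vec_weight q N + fps_const (inverse q ^ Suc N) * vec_count N"
proof -
  have 1: "(\<Sum>i<Suc N. q ^ ((xs @ [0]) ! i) * inverse q ^ Suc i) =
      (\<Sum>i<N. q ^ (xs ! i) * inverse q ^ Suc i) + inverse q ^ Suc N" if "xs \<in> decreasing_vectors N n" for xs n
    using that by (auto simp: decreasing_vectors_def nth_append simp del: power_Suc intro!: sum.cong)
  have 2: "(\<Sum>i<Suc N. q ^ (map Suc xs ! i) * inverse q ^ Suc i) = q * (\<Sum>i<Suc N. q ^ (xs ! i) * inverse q ^ Suc i)"
    if "xs \<in> decreasing_vectors (Suc N) n" for xs n
    unfolding sum_distrib_left using that by (intro sum.cong) (auto simp: decreasing_vectors_def)
  have "vec_weight q (Suc N) = vec_weight q N + fps_const (inverse q ^ Suc N) * vec_count N +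
      fps_const q * (fps_X ^ Suc N * vec_weight q (Suc N))"
  proof (rule fps_ext)
    fix n
    have "fps_nth (vec_weight q (Suc N)) n =
        (\<Sum>xs\<in>decreasing_vectors N n. (\<Sum>i<N. q ^ (xs ! i) * inverse q ^ Suc i) + inverse q ^ Suc N) +
        (if Suc N \<le> n then \<Sum>xs\<in>decreasing_vectors (Suc N) (n - Suc N). q * (\<Sum>i<Suc N. q ^ (xs ! i) * inverse q ^ Suc i) else 0)"
      unfolding vec_weight_def fps_nth_Abs_fps
      by (subst sum_decreasing_vectors_Suc) (simp add: 1 2 cong: sum.cong del: power_Suc sum.lessThan_Suc)
    thus "fps_nth (vec_weight q (Suc N)) n = fps_nth (vec_weight q N + fps_const (inverse q ^ Suc N) * vec_count N +
      fps_const q * (fps_X ^ Suc N * vec_weight q (Suc N))) n"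
      by (simp add: vec_weight_def vec_count_def fps_X_power_mult_nth sum.distrib sum_distrib_left[symmetric] mult.commute
        del: power_Suc sum.lessThan_Suc)
  qed
  thus ?thesis by (simp add: algebra_simps)
qed

definition q_factors :: "'k \<Rightarrow> nat \<Rightarrow> 'k::field_char_0 fps" where
  "q_factors c N = (\<Prod>n=1..N. 1 - fps_const c * fps_X ^ n)"

lemma q_factors_0 [simp]: "q_factors c 0 = 1"
  by (simp add: q_factors_def)

lemma q_factors_Suc: "q_factors c (Suc N) = q_factors c N * (1 - fps_const c * fps_X ^ Suc N)"
  by (simp add: q_factors_def)

lemma vec_count_q_factors: "vec_count N * q_factors 1 N = 1"
proof (induction N)
  case (Suc N)
  have "vec_count (Suc N) * q_factors 1 (Suc N) = (vec_count (Suc N) * (1 - fps_X ^ Suc N)) * (q_factors 1 N :: 'a fps)"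
    by (simp only: q_factors_Suc fps_const_1_eq_1 mult_1_left mult_ac)
  thus ?case by (simp only: vec_count_Suc Suc.IH)
qed (simp add: vec_count_0)

text \<open>
  The quotient \<open>\<Prod>\<^bsub>j<M\<^esub> (1 - q T\<^sup>j) / (1 - T\<^bsup>j+1\<^esup>)\<close>, the coefficient of \<open>y\<^sup>M\<close> in the \<open>q\<close>-binomial
  series with base \<open>T\<close> and parameter \<open>q\<close>.
\<close>

definition qbin_coeff :: "'k \<Rightarrow> nat \<Rightarrow> 'k::field_char_0 fps" where
  "qbin_coeff q M = (if M = 0 then 1 else fps_const (1 - q) * q_factors q (M - 1) * vec_count M)"

lemma qbin_coeff_Suc:
  "qbin_coeff q (Suc M) * (1 - fps_X ^ Suc M) = qbin_coeff q M * (1 - fps_const q * fps_X ^ M)"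
proof -
  have "qbin_coeff q (Suc M) * (1 - fps_X ^ Suc M) = fps_const (1 - q) * q_factors q M * vec_count M"
    unfolding qbin_coeff_def by (simp only: nat.distinct(2) if_False diff_Suc_1 mult.assoc vec_count_Suc)
  also have "\<dots> = qbin_coeff q M * (1 - fps_const q * fps_X ^ M)"
    by (cases M) (simp_all add: qbin_coeff_def vec_count_0 q_factors_Suc mult_ac fps_const_sub[symmetric] del: fps_const_sub power_Suc)
  finally show ?thesis .
qed

text \<open>
  The generating function of the eigenvalues of \<open>N\<close>-vectors, cleared of denominators, grows by exactly
  one term of the \<open>q\<close>-binomial series when \<open>N\<close> increases by one.
\<close>

lemma average_telescope:
  assumes "q \<noteq> 0"
  shows "q_factors q N * (fps_const (inverse q ^ N) * vec_count N + fps_const (q - 1) * vec_weight q N) =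
    (\<Sum>M\<le>N. qbin_coeff q M * (fps_const (inverse q) * fps_X) ^ M)"
proof (induction N)
  case 0
  show ?case by (simp add: vec_count_0 vec_weight_0 qbin_coeff_def)
next
  case (Suc N)
  let ?A = "q_factors q N" and ?x = "fps_const (inverse q ^ Suc N)"
  have x: "fps_const (inverse q ^ N) = fps_const q * ?x" using assms by simp
  have Z: "vec_count N = vec_count (Suc N) * (1 - fps_X ^ Suc N :: 'a fps)" by (rule vec_count_Suc[symmetric])
  have "q_factors q (Suc N) * vec_weight q (Suc N) = ?A * (vec_weight q (Suc N) * (1 - fps_const q * fps_X ^ Suc N))"
    by (simp only: q_factors_Suc mult_ac)
  also have "\<dots> = ?A * (vec_weight q N + ?x * vec_count N)" by (simp only: vec_weight_Suc[OF assms])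
  finally have G: "q_factors q (Suc N) * vec_weight q (Suc N) = ?A * vec_weight q N + ?A * ?x * vec_count N"
    by (simp only: distrib_left mult.assoc)
  have c: "fps_const (q - 1) = fps_const q - 1" by (simp add: fps_const_sub[symmetric] del: fps_const_sub)
  have "q_factors q (Suc N) * (?x * vec_count (Suc N) + fps_const (q - 1) * vec_weight q (Suc N)) =
      q_factors q (Suc N) * ?x * vec_count (Suc N) + fps_const (q - 1) * (q_factors q (Suc N) * vec_weight q (Suc N))"
    by (simp only: distrib_left mult_ac)
  also have "\<dots> = ?A * (fps_const (inverse q ^ N) * vec_count N + fps_const (q - 1) * vec_weight q N) +
     (?A * (1 - fps_const q * fps_X ^ Suc N) * ?x * vec_count (Suc N) - ?A * ?x * vec_count N)"
  proof -
    have "B * y * Z' + (r - 1) * (A * w + A * y * Z) = A * (r * y * Z + (r - 1) * w) + (B * y * Z' - A * y * Z)"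
      for A B y Z Z' w r :: "'a fps" by (simp add: algebra_simps)
    from this[of "q_factors q (Suc N)"] show ?thesis unfolding G x c unfolding q_factors_Suc .
  qed
  also have "?A * (1 - fps_const q * fps_X ^ Suc N) * ?x * vec_count (Suc N) - ?A * ?x * vec_count N =
     ?A * ?x * vec_count (Suc N) * ((1 - fps_const q) * fps_X ^ Suc N)"
  proof -
    have "A * (1 - r * X) * y * Z' - A * y * (Z' * (1 - X)) = A * y * Z' * ((1 - r) * X)"
      for A r X y Z' :: "'a fps" by (simp add: algebra_simps)
    thus ?thesis unfolding Z .
  qed
  also have "\<dots> = qbin_coeff q (Suc N) * (fps_const (inverse q) * fps_X) ^ Suc N"
  proof -
    have "fps_const (1 - q) = 1 - fps_const q" by (simp add: fps_const_sub[symmetric] del: fps_const_sub)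
    thus ?thesis
      unfolding qbin_coeff_def power_mult_distrib fps_const_power
      by (simp only: nat.distinct(2) if_False diff_Suc_1 mult_ac)
  qed
  finally show ?case unfolding Suc.IH by simp
qed

text \<open>
  A partial sum of the functional equation \<open>(1 - y) U(y) = (1 - q y) U(T y)\<close> of the \<open>q\<close>-binomial series
  \<open>U\<close>, with its error term.
\<close>

lemma qbin_partial_step:
  fixes y :: "'k::field_char_0 fps"
  shows "(1 - y) * (\<Sum>M\<le>N. qbin_coeff q M * y ^ M) =
    (1 - fps_const q * y) * (\<Sum>M\<le>N. qbin_coeff q M * (fps_X * y) ^ M) -
    (1 - fps_const q * fps_X ^ N) * qbin_coeff q N * y ^ Suc N"
proof (induction N)
  case 0
  show ?case by (simp add: qbin_coeff_def algebra_simps)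
next
  case (Suc N)
  have q: "(1 - fps_const q * fps_X ^ N) * qbin_coeff q N = qbin_coeff q (Suc N) * (1 - fps_X ^ Suc N)"
    by (simp only: qbin_coeff_Suc mult.commute)
  have "(1 - y) * (\<Sum>M\<le>Suc N. qbin_coeff q M * y ^ M) =
     (1 - y) * (\<Sum>M\<le>N. qbin_coeff q M * y ^ M) + (1 - y) * (qbin_coeff q (Suc N) * y ^ Suc N)"
    by (simp only: sum.atMost_Suc distrib_left)
  also have "\<dots> = (1 - fps_const q * y) * (\<Sum>M\<le>N. qbin_coeff q M * (fps_X * y) ^ M) -
      qbin_coeff q (Suc N) * (1 - fps_X ^ Suc N) * y ^ Suc N + (1 - y) * (qbin_coeff q (Suc N) * y ^ Suc N)"
    unfolding Suc.IH q ..
  also have "\<dots> = (1 - fps_const q * y) * (\<Sum>M\<le>N. qbin_coeff q M * (fps_X * y) ^ M) +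
     (1 - fps_const q * y) * (qbin_coeff q (Suc N) * (fps_X * y) ^ Suc N) -
     (1 - fps_const q * fps_X ^ Suc N) * qbin_coeff q (Suc N) * y ^ Suc (Suc N)"
    by (simp add: power_mult_distrib algebra_simps)
  finally show ?case by (simp only: sum.atMost_Suc distrib_left)
qed

text \<open>
  At \<open>y = T\<^bsup>J+1\<^esup> / q\<close> the functional equation reads
  \<open>(1 - T\<^bsup>J+1\<^esup> / q) U(y) = (1 - T\<^bsup>J+1\<^esup>) U(T y)\<close>, and the error term is divisible by
  \<open>T\<^bsup>N+1\<^esup>\<close>.  Iterating it yields the \<open>q\<close>-binomial theorem.
\<close>

lemma qbin_infinite_product:
  assumes "q \<noteq> 0"
  shows "trunc_eq N (q_factors (inverse q) J * (\<Sum>M\<le>N. qbin_coeff q M * (fps_const (inverse q) * fps_X) ^ M))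
    (q_factors 1 J * (\<Sum>M\<le>N. qbin_coeff q M * (fps_const (inverse q) * fps_X ^ Suc J) ^ M))"
proof (induction J)
  case (Suc J)
  let ?y = "fps_const (inverse q) * fps_X ^ Suc J"
  let ?U = "\<lambda>y. \<Sum>M\<le>N. qbin_coeff q M * y ^ M"
  have y: "fps_const q * ?y = fps_X ^ Suc J"
    using assms by (simp add: mult.assoc[symmetric] del: power_Suc)
  have Xy: "fps_X * ?y = fps_const (inverse q) * fps_X ^ Suc (Suc J)" by (simp add: mult_ac)
  have "q_factors (inverse q) (Suc J) * ?U (fps_const (inverse q) * fps_X) =
     (1 - ?y) * (q_factors (inverse q) J * ?U (fps_const (inverse q) * fps_X))"
    by (simp only: q_factors_Suc mult_ac)
  also have "trunc_eq N \<dots> ((1 - ?y) * (q_factors 1 J * ?U ?y))"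
    by (rule trunc_eq_mult[OF trunc_eq_refl Suc.IH])
  also have "(1 - ?y) * (q_factors 1 J * ?U ?y) = q_factors 1 J * ((1 - ?y) * ?U ?y)" by (simp only: mult_ac)
  also have "\<dots> = q_factors 1 J * ((1 - fps_X ^ Suc J) * ?U (fps_X * ?y)) +
      fps_X ^ (Suc J * Suc N) * (- q_factors 1 J * (1 - fps_const q * fps_X ^ N) * qbin_coeff q N * fps_const (inverse q) ^ Suc N)"
  proof -
    have "E * (P - a * b * (c * d)) = E * P + d * (- E * a * b * c)" for E P a b c d :: "'a fps"
      by (simp add: algebra_simps)
    thus ?thesis
      unfolding qbin_partial_step[of ?y] y power_mult_distrib[of "fps_const (inverse q)" "fps_X ^ Suc J" "Suc N"]
        power_mult[symmetric] .
  qed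
  also have "trunc_eq N \<dots> (q_factors 1 J * ((1 - fps_X ^ Suc J) * ?U (fps_X * ?y)))"
    by (rule trunc_eq_power_X_mult) simp
  also have "q_factors 1 J * ((1 - fps_X ^ Suc J) * ?U (fps_X * ?y)) = q_factors 1 (Suc J) * ?U (fps_const (inverse q) * fps_X ^ Suc (Suc J))"
    unfolding Xy q_factors_Suc by (simp only: fps_const_1_eq_1 mult_1_left mult.assoc)
  finally show ?case .
qed simp

lemma average_trunc:
  assumes "q \<noteq> 0"
  shows "trunc_eq N (q_factors q N * q_factors (inverse q) N *
      (fps_const (inverse q ^ N) * vec_count N + fps_const (q - 1) * vec_weight q N)) (q_factors 1 N)"
proof -
  have "q_factors q N * q_factors (inverse q) N *
      (fps_const (inverse q ^ N) * vec_count N + fps_const (q - 1) * vec_weight q N) =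
     q_factors (inverse q) N * (\<Sum>M\<le>N. qbin_coeff q M * (fps_const (inverse q) * fps_X) ^ M)"
    unfolding average_telescope[OF assms, symmetric] by (simp only: mult_ac)
  also have "trunc_eq N \<dots> (q_factors 1 N * (\<Sum>M\<le>N. qbin_coeff q M * (fps_const (inverse q) * fps_X ^ Suc N) ^ M))"
    by (rule qbin_infinite_product[OF assms])
  also have "trunc_eq N \<dots> (q_factors 1 N * 1)"
  proof (rule trunc_eq_mult[OF trunc_eq_refl])
    have "(\<Sum>M\<le>N. qbin_coeff q M * (fps_const (inverse q) * fps_X ^ Suc N) ^ M) =
       1 + (\<Sum>M=1..N. qbin_coeff q M * (fps_const (inverse q) * fps_X ^ Suc N) ^ M)"
      by (simp add: atMost_atLeast0 sum.atLeast_Suc_atMost qbin_coeff_def)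
    also have "(\<Sum>M=1..N. qbin_coeff q M * (fps_const (inverse q) * fps_X ^ Suc N) ^ M) =
       fps_X ^ Suc N * (\<Sum>M=1..N. qbin_coeff q M * fps_const (inverse q) ^ M * fps_X ^ (Suc N * (M - 1)))"
      unfolding sum_distrib_left
    proof (rule sum.cong [OF refl])
      fix M assume "M \<in> {1..N}"
      hence "(fps_X ^ Suc N) ^ M = fps_X ^ Suc N * (fps_X ^ (Suc N * (M - 1)) :: 'a fps)"
      proof -
        have "Suc N * M = Suc N + Suc N * (M - 1)" using \<open>M \<in> {1..N}\<close> by (cases M) auto
        thus ?thesis by (metis power_add power_mult)
      qed
      thus "qbin_coeff q M * (fps_const (inverse q) * fps_X ^ Suc N) ^ M =
         fps_X ^ Suc N * (qbin_coeff q M * fps_const (inverse q) ^ M * fps_X ^ (Suc N * (M - 1)))"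
        by (simp only: power_mult_distrib mult_ac)
    qed
    finally show "trunc_eq N (\<Sum>M\<le>N. qbin_coeff q M * (fps_const (inverse q) * fps_X ^ Suc N) ^ M) 1"
      by (simp only: trunc_eq_power_X_mult lessI)
  qed
  finally show ?thesis by simp
qed

lemma partitions_of_vectors:
  assumes "n \<le> N" "\<And>\<mu>. is_partition \<mu> \<Longrightarrow> sum_list \<mu> = n \<Longrightarrow> f (\<mu> @ replicate (N - length \<mu>) 0) = g \<mu>"
  shows "(\<Sum>\<mu>\<in>partitions_of n. g \<mu>) = (\<Sum>xs\<in>decreasing_vectors N n. f xs)"
proof (rule sum.reindex_bij_witness[of _ pnorm "\<lambda>\<mu>. \<mu> @ replicate (N - length \<mu>) 0"])
  fix \<mu> assume \<mu>: "\<mu> \<in> partitions_of n"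
  have len: "length \<mu> \<le> N" using \<mu> assms(1) length_le_sum_list[of \<mu>] by (auto simp: partitions_of_def is_partition_def)
  show "pnorm (\<mu> @ replicate (N - length \<mu>) 0) = \<mu>"
    using \<mu> by (simp add: pnorm_append_zeros pnorm_partition partitions_of_def)
  show "\<mu> @ replicate (N - length \<mu>) 0 \<in> decreasing_vectors N n"
    using \<mu> len by (auto simp: decreasing_vectors_def partitions_of_def is_partition_def sorted_wrt_append
        sum_list_replicate sorted_wrt_iff_nth_less[of _ "replicate _ _"])
  show "f (\<mu> @ replicate (N - length \<mu>) 0) = g \<mu>" using assms(2) \<mu> by (simp add: partitions_of_def)
next
  fix xs assume xs: "xs \<in> decreasing_vectors N n"
  show "pnorm xs \<in> partitions_of n"
    using xs by (simp add: partitions_of_def is_partition_pnorm sum_list_pnorm decreasing_vectors_def)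
  have sorted: "sorted_wrt (\<ge>) xs" "length xs = N" using xs by (auto simp: decreasing_vectors_def)
  have "\<exists>m. xs = filter (\<lambda>x. x \<noteq> 0) xs @ replicate m 0"
    using sorted(1)
  proof (induction xs)
    case (Cons a xs)
    show ?case
    proof (cases "a = 0")
      case True
      hence "\<forall>x\<in>set xs. x = 0" using Cons.prems by auto
      hence "filter (\<lambda>x. x \<noteq> 0) (a # xs) = []" "a # xs = replicate (Suc (length xs)) 0"
        using True by (auto simp: filter_empty_conv intro!: replicate_eqI)
      thus ?thesis by (metis append_Nil)
    next
      case False
      obtain m where m: "xs = filter (\<lambda>x. x \<noteq> 0) xs @ replicate m 0" using Cons by auto
      have "a # xs = filter (\<lambda>x. x \<noteq> 0) (a # xs) @ replicate m 0"
        using False by (subst m) simp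
      thus ?thesis by blast
    qed
  qed simp
  then obtain m where m: "xs = filter (\<lambda>x. x \<noteq> 0) xs @ replicate m 0" by blast
  have "pnorm xs = filter (\<lambda>x. x \<noteq> 0) xs"
  proof -
    have "sorted_wrt (\<ge>) (filter (\<lambda>x. x \<noteq> 0) xs)" using sorted(1) by (rule sorted_wrt_filter)
    hence "is_partition (filter (\<lambda>x. x \<noteq> 0) xs)" by (simp add: is_partition_def)
    from pnorm_partition[OF this] show ?thesis by (simp add: pnorm_def)
  qed
  hence xs_eq: "pnorm xs @ replicate m 0 = xs" using m by simp
  hence "length (pnorm xs) + m = N" using sorted(2) by (metis length_append length_replicate)
  hence "N - length (pnorm xs) = m" by simp
  thus "pnorm xs @ replicate (N - length (pnorm xs)) 0 = xs" using xs_eq by simp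
qed

definition partition_series :: "'k::field_char_0 fps" where
  "partition_series = Abs_fps (\<lambda>n. \<Sum>\<mu>\<in>partitions_of n. 1)"

definition average_series :: "'k \<Rightarrow> 'k::field_char_0 fps" where
  "average_series q = Abs_fps (\<lambda>n. \<Sum>\<mu>\<in>partitions_of n. macdonald_eigenvalue q (inverse q) \<mu>)"

text \<open>
  Modulo \<open>T\<^bsup>N+1\<^esup>\<close> only partitions with at most \<open>N\<close> parts count, so the statements about vectors
  of length \<open>N\<close> suffice.
\<close>

lemma average_series_product:
  fixes q :: "'a::field_char_0"
  assumes "q \<noteq> 0"
  shows "trunc_eq N (q_factors q N * q_factors (inverse q) N * average_series q) (q_factors 1 N)"
    "trunc_eq N (q_factors 1 N * partition_series) (1 :: 'a fps)"
proof -
  have cell: "cell_sum q t (\<mu> @ replicate m 0) = cell_sum q t \<mu>" for t and \<mu> :: "nat list" and m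
  proof -
    have "cell_sum q t (\<mu> @ replicate m 0) = (\<Sum>i<length \<mu>. t ^ i * (\<Sum>j<(\<mu> @ replicate m 0) ! i. q ^ j))"
      unfolding cell_sum_def by (rule sum.mono_neutral_right) (auto simp: nth_append)
    also have "\<dots> = cell_sum q t \<mu>" unfolding cell_sum_def by (rule sum.cong) (auto simp: nth_append)
    finally show ?thesis .
  qed
  have "trunc_eq N (average_series q) (fps_const (inverse q ^ N) * vec_count N + fps_const (q - 1) * vec_weight q N)"
    unfolding trunc_eq_def
  proof (intro allI impI)
    fix n assume "n \<le> N"
    have "fps_nth (average_series q) n = (\<Sum>xs\<in>decreasing_vectors N n. macdonald_eigenvalue q (inverse q) xs)"
      unfolding average_series_def fps_nth_Abs_fps
      by (rule partitions_of_vectors) (use \<open>n \<le> N\<close> in \<open>auto simp: macdonald_eigenvalue_def cell\<close>)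
    also have "\<dots> = (\<Sum>xs\<in>decreasing_vectors N n. inverse q ^ N + (q - 1) * (\<Sum>i<N. q ^ (xs ! i) * inverse q ^ Suc i))"
    proof (rule sum.cong [OF refl])
      fix xs assume "xs \<in> decreasing_vectors N n"
      hence len: "length xs = N" by (simp add: decreasing_vectors_def)
      have "(1 - inverse q) * (\<Sum>i<N. inverse q ^ i * q ^ (xs ! i)) = (q - 1) * (\<Sum>i<N. q ^ (xs ! i) * inverse q ^ Suc i)"
        unfolding sum_distrib_left by (rule sum.cong) (use assms in \<open>auto simp: field_simps\<close>)
      thus "macdonald_eigenvalue q (inverse q) xs = inverse q ^ N + (q - 1) * (\<Sum>i<N. q ^ (xs ! i) * inverse q ^ Suc i)"
        by (simp only: macdonald_eigenvalue_alt len)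
    qed
    finally show "fps_nth (average_series q) n =
        fps_nth (fps_const (inverse q ^ N) * vec_count N + fps_const (q - 1) * vec_weight q N) n"
      by (simp add: vec_count_def vec_weight_def sum.distrib sum_distrib_left mult.commute)
  qed
  from trunc_eq_trans[OF trunc_eq_mult[OF trunc_eq_refl this] average_trunc[OF assms]]
  show "trunc_eq N (q_factors q N * q_factors (inverse q) N * average_series q) (q_factors 1 N)" .
  have "trunc_eq N partition_series (vec_count N :: 'a fps)"
    unfolding trunc_eq_def partition_series_def vec_count_def fps_nth_Abs_fps
    by (intro allI impI partitions_of_vectors) auto
  from trunc_eq_mult[OF trunc_eq_refl this, of "q_factors 1 N"]
  show "trunc_eq N (q_factors 1 N * partition_series) (1 :: 'a fps)"
    using vec_count_q_factors[of N, where ?'a = 'a] by (simp add: mult.commute)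
qed

section \<open>Evaluation of rational functions\<close>

lemma poly_eval_hom: "comm_ring_hom (\<lambda>p. poly p (x :: 'a::comm_ring_1))"
  by unfold_locales auto

lemma of_rat_hom: "comm_ring_hom (of_rat :: rat \<Rightarrow> 'a::field_char_0)"
  by unfold_locales (auto simp: of_rat_add of_rat_mult)

lemma eval_poly2_hom: "comm_ring_hom (\<lambda>P. eval_poly2 P (a :: 'a::field_char_0) b)"
  unfolding eval_poly2_def
  by (rule comm_ring_hom_comp[OF poly_eval_hom map_poly_hom,
        OF comm_ring_hom_comp[OF poly_eval_hom map_poly_hom, OF of_rat_hom]])

context
  fixes a b :: "'a::field_char_0"
begin

interpretation ev: comm_ring_hom "\<lambda>P. eval_poly2 P a b"
  by (rule eval_poly2_hom)

text \<open>
  The value can be computed from every representation as a fraction whose denominator does not vanish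
  at the point, because the reduced denominator divides it.
\<close>

lemma ratfun_eval_Fract:
  assumes "eval_poly2 s a b \<noteq> 0"
  shows "ratfun_defined_at (Fract p s) a b" "ratfun_eval (Fract p s) a b = eval_poly2 p a b / eval_poly2 s a b"
proof -
  define u v where "u = fst (quot_of_fract (Fract p s))" and "v = snd (quot_of_fract (Fract p s))"
  have "s \<noteq> 0" using assms by auto
  have "v \<noteq> 0" by (simp add: v_def snd_quot_of_fract_nonzero)
  have "Fract u v = Fract p s" by (simp add: u_def v_def Fract_quot_of_fract)
  hence eq: "u * s = p * v" using \<open>s \<noteq> 0\<close> \<open>v \<noteq> 0\<close> by (simp add: eq_fract)
  have "coprime u v" by (simp add: u_def v_def coprime_quot_of_fract)
  moreover have "v dvd u * s" by (simp add: eq)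
  ultimately have "v dvd s" by (simp add: coprime_dvd_mult_right_iff coprime_commute)
  then obtain w where w: "s = v * w" by auto
  have nz: "eval_poly2 v a b \<noteq> 0" using assms by (auto simp: w ev.hom_mult)
  thus "ratfun_defined_at (Fract p s) a b" by (simp add: ratfun_defined_at_def v_def)
  have "eval_poly2 u a b * eval_poly2 s a b = eval_poly2 p a b * eval_poly2 v a b"
    using arg_cong[OF eq, of "\<lambda>P. eval_poly2 P a b"] by (simp add: ev.hom_mult)
  thus "ratfun_eval (Fract p s) a b = eval_poly2 p a b / eval_poly2 s a b"
    using nz assms by (simp add: ratfun_eval_def u_def[symmetric] v_def[symmetric] field_simps)
qed

lemma ratfun_cases_defined:
  assumes "ratfun_defined_at r a b"
  obtains p s where "r = Fract p s" "eval_poly2 s a b \<noteq> 0" "s \<noteq> 0"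
proof -
  have "r = Fract (fst (quot_of_fract r)) (snd (quot_of_fract r))" by (simp add: Fract_quot_of_fract)
  moreover have "eval_poly2 (snd (quot_of_fract r)) a b \<noteq> 0" using assms by (simp add: ratfun_defined_at_def)
  ultimately show ?thesis using that snd_quot_of_fract_nonzero by blast
qed

lemma ratfun_eval_poly:
  "ratfun_defined_at (Fract p 1) a b" "ratfun_eval (Fract p 1) a b = eval_poly2 p a b"
  using ratfun_eval_Fract[of 1 p] by auto

lemma ratfun_eval_add:
  assumes "ratfun_defined_at r a b" "ratfun_defined_at s a b"
  shows "ratfun_defined_at (r + s) a b" "ratfun_eval (r + s) a b = ratfun_eval r a b + ratfun_eval s a b"
proof -
  obtain p u where r: "r = Fract p u" "eval_poly2 u a b \<noteq> 0" "u \<noteq> 0" using assms(1) by (rule ratfun_cases_defined)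
  obtain p' u' where s: "s = Fract p' u'" "eval_poly2 u' a b \<noteq> 0" "u' \<noteq> 0" using assms(2) by (rule ratfun_cases_defined)
  have rs: "r + s = Fract (p * u' + p' * u) (u * u')" using r s by simp
  have nz: "eval_poly2 (u * u') a b \<noteq> 0" using r s by (simp add: ev.hom_mult)
  show "ratfun_defined_at (r + s) a b" unfolding rs by (rule ratfun_eval_Fract[OF nz])
  show "ratfun_eval (r + s) a b = ratfun_eval r a b + ratfun_eval s a b"
    unfolding rs ratfun_eval_Fract(2)[OF nz] unfolding r(1) s(1) ratfun_eval_Fract(2)[OF r(2)] ratfun_eval_Fract(2)[OF s(2)]
    using r s by (simp add: ev.hom_mult ev.hom_add field_simps)
qed

lemma ratfun_eval_mult:
  assumes "ratfun_defined_at r a b" "ratfun_defined_at s a b"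
  shows "ratfun_defined_at (r * s) a b" "ratfun_eval (r * s) a b = ratfun_eval r a b * ratfun_eval s a b"
proof -
  obtain p u where r: "r = Fract p u" "eval_poly2 u a b \<noteq> 0" "u \<noteq> 0" using assms(1) by (rule ratfun_cases_defined)
  obtain p' u' where s: "s = Fract p' u'" "eval_poly2 u' a b \<noteq> 0" "u' \<noteq> 0" using assms(2) by (rule ratfun_cases_defined)
  have rs: "r * s = Fract (p * p') (u * u')" using r s by simp
  have nz: "eval_poly2 (u * u') a b \<noteq> 0" using r s by (simp add: ev.hom_mult)
  show "ratfun_defined_at (r * s) a b" unfolding rs by (rule ratfun_eval_Fract[OF nz])
  show "ratfun_eval (r * s) a b = ratfun_eval r a b * ratfun_eval s a b"
    unfolding rs ratfun_eval_Fract(2)[OF nz] unfolding r(1) s(1) ratfun_eval_Fract(2)[OF r(2)] ratfun_eval_Fract(2)[OF s(2)]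
    using r s by (simp add: ev.hom_mult field_simps)
qed

lemma ratfun_eval_inverse:
  assumes "ratfun_defined_at r a b" "ratfun_eval r a b \<noteq> 0"
  shows "ratfun_defined_at (inverse r) a b" "ratfun_eval (inverse r) a b = inverse (ratfun_eval r a b)"
proof -
  obtain p u where r: "r = Fract p u" "eval_poly2 u a b \<noteq> 0" "u \<noteq> 0" using assms(1) by (rule ratfun_cases_defined)
  have e: "ratfun_eval r a b = eval_poly2 p a b / eval_poly2 u a b" unfolding r(1) by (rule ratfun_eval_Fract[OF r(2)])
  have nz: "eval_poly2 p a b \<noteq> 0" using assms(2) e by auto
  hence "p \<noteq> 0" by auto
  have i: "inverse r = Fract u p" by (simp add: r)
  show "ratfun_defined_at (inverse r) a b" unfolding i by (rule ratfun_eval_Fract[OF nz])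
  show "ratfun_eval (inverse r) a b = inverse (ratfun_eval r a b)"
    unfolding i e ratfun_eval_Fract(2)[OF nz] by simp
qed

lemma ratfun_eval_const:
  "ratfun_defined_at 0 a b" "ratfun_eval 0 a b = 0" "ratfun_defined_at 1 a b" "ratfun_eval 1 a b = 1"
  using ratfun_eval_poly[of 0] ratfun_eval_poly[of 1] by (simp_all add: Zero_fract_def One_fract_def)

lemma ratfun_eval_uminus:
  assumes "ratfun_defined_at r a b"
  shows "ratfun_defined_at (- r) a b" "ratfun_eval (- r) a b = - ratfun_eval r a b"
proof -
  have m1: "- 1 = (Fract (- 1) 1 :: ratfun)" by (simp add: One_fract_def)
  have d: "ratfun_defined_at (- 1) a b" "ratfun_eval (- 1) a b = - 1"
    unfolding m1 using ratfun_eval_poly[of "- 1"] by (simp_all add: ev.hom_uminus)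
  show "ratfun_defined_at (- r) a b" "ratfun_eval (- r) a b = - ratfun_eval r a b"
    using ratfun_eval_mult[OF d(1) assms] d(2) by simp_all
qed

lemma ratfun_eval_diff:
  assumes "ratfun_defined_at r a b" "ratfun_defined_at s a b"
  shows "ratfun_defined_at (r - s) a b" "ratfun_eval (r - s) a b = ratfun_eval r a b - ratfun_eval s a b"
  using ratfun_eval_add[OF assms(1) ratfun_eval_uminus(1)[OF assms(2)]] ratfun_eval_uminus(2)[OF assms(2)]
  by simp_all

lemma ratfun_eval_divide:
  assumes "ratfun_defined_at r a b" "ratfun_defined_at s a b" "ratfun_eval s a b \<noteq> 0"
  shows "ratfun_defined_at (r / s) a b" "ratfun_eval (r / s) a b = ratfun_eval r a b / ratfun_eval s a b"
  using ratfun_eval_mult[OF assms(1) ratfun_eval_inverse(1)[OF assms(2,3)]] ratfun_eval_inverse(2)[OF assms(2,3)]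
  by (simp_all add: divide_inverse)

lemma ratfun_eval_power:
  assumes "ratfun_defined_at r a b"
  shows "ratfun_defined_at (r ^ n) a b \<and> ratfun_eval (r ^ n) a b = ratfun_eval r a b ^ n"
  by (induction n) (use ratfun_eval_mult[OF assms] ratfun_eval_const in auto)

lemma ratfun_eval_sum:
  assumes "\<And>x. x \<in> A \<Longrightarrow> ratfun_defined_at (f x) a b"
  shows "ratfun_defined_at (sum f A) a b \<and> ratfun_eval (sum f A) a b = (\<Sum>x\<in>A. ratfun_eval (f x) a b)"
  using assms
  by (induction A rule: infinite_finite_induct) (auto simp: ratfun_eval_const ratfun_eval_add)

lemma ratfun_eval_prod:
  assumes "\<And>x. x \<in> A \<Longrightarrow> ratfun_defined_at (f x) a b"
  shows "ratfun_defined_at (prod f A) a b \<and> ratfun_eval (prod f A) a b = (\<Prod>x\<in>A. ratfun_eval (f x) a b)"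
  using assms
  by (induction A rule: infinite_finite_induct) (auto simp: ratfun_eval_const ratfun_eval_mult)

lemma ratfun_eval_var:
  "ratfun_defined_at var1 a b" "ratfun_eval var1 a b = a"
  "ratfun_defined_at var2 a b" "ratfun_eval var2 a b = b"
  unfolding var1_def var2_def
  by (simp_all add: ratfun_eval_poly eval_poly2_def map_poly_pCons)

lemma ratfun_eval_cell_sum:
  assumes "ratfun_defined_at q a b" "ratfun_defined_at t a b"
  shows "ratfun_defined_at (cell_sum q t \<mu>) a b \<and>
    ratfun_eval (cell_sum q t \<mu>) a b = cell_sum (ratfun_eval q a b) (ratfun_eval t a b) \<mu>"
proof -
  have inner: "ratfun_defined_at (\<Sum>j<k. q ^ j) a b \<and>
      ratfun_eval (\<Sum>j<k. q ^ j) a b = (\<Sum>j<k. ratfun_eval q a b ^ j)" for k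
    using ratfun_eval_sum[of "{..<k}" "\<lambda>j. q ^ j"] ratfun_eval_power[OF assms(1)] by simp
  have "ratfun_defined_at (t ^ i * (\<Sum>j<k. q ^ j)) a b \<and>
      ratfun_eval (t ^ i * (\<Sum>j<k. q ^ j)) a b = ratfun_eval t a b ^ i * (\<Sum>j<k. ratfun_eval q a b ^ j)" for i k
    using inner[of k] ratfun_eval_power[OF assms(2), of i] ratfun_eval_mult by auto
  thus ?thesis unfolding cell_sum_def
    using ratfun_eval_sum[of "{..<length \<mu>}" "\<lambda>i. t ^ i * (\<Sum>j<\<mu> ! i. q ^ j)"] by simp
qed

end

lemma eval_poly2_vars: "eval_poly2 P var1 var2 = Fract P 1"
proof -
  interpret F: comm_ring_hom "\<lambda>p::rat poly poly. Fract p 1" by (rule fract_hom)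
  interpret C: comm_ring_hom "\<lambda>c::rat. Fract [:[:c:]:] 1"
    by (rule comm_ring_hom_comp[OF fract_hom comm_ring_hom_comp[OF const_poly_hom const_poly_hom]])
  have rat: "of_rat c = (Fract [:[:c:]:] 1 :: ratfun)" for c
  proof -
    obtain x y where "quotient_of c = (x, y)" by fastforce
    hence c: "c = of_int x / of_int y" "y \<noteq> 0"
      using quotient_of_div quotient_of_denom_pos[of c x y] by auto
    have "Fract [:[:c:]:] 1 * (of_int y :: ratfun) = Fract [:[:c * of_int y:]:] 1"
      by (simp only: C.hom_mult C.hom_of_int)
    also have "c * of_int y = of_int x" using c by simp
    also have "Fract [:[:of_int x:]:] 1 = (of_int x :: ratfun)" by (rule C.hom_of_int)
    finally have "(Fract [:[:c:]:] 1 :: ratfun) = of_int x / of_int y" using c(2) by (simp add: field_simps)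
    thus ?thesis by (simp add: c(1) of_rat_divide)
  qed
  have inner: "poly (map_poly of_rat c) var1 = (Fract [:c:] 1 :: ratfun)" for c :: "rat poly"
  proof (induction c)
    case (pCons d c)
    have "[:pCons d c:] = [:[:d:]:] + [:[:0, 1:]:] * [:c:]" by simp
    hence "(Fract [:pCons d c:] 1 :: ratfun) = Fract [:[:d:]:] 1 + var1 * Fract [:c:] 1"
      unfolding var1_def by (simp only: F.hom_add F.hom_mult)
    moreover have "poly (map_poly of_rat (pCons d c)) var1 = of_rat d + var1 * poly (map_poly of_rat c) var1"
      by (simp add: map_poly_pCons)
    ultimately show ?case using rat[of d] by (simp only: pCons.IH)
  qed (simp flip: Zero_fract_def)
  show ?thesis
  proof (induction P)
    case (pCons c P)
    have "pCons c P = [:c:] + [:0, 1:] * P" by simp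
    hence "(Fract (pCons c P) 1 :: ratfun) = Fract [:c:] 1 + var2 * Fract P 1"
      unfolding var2_def by (simp only: F.hom_add F.hom_mult)
    moreover have "eval_poly2 (pCons c P) var1 var2 = poly (map_poly of_rat c) var1 + var2 * eval_poly2 P var1 var2"
      by (simp add: eval_poly2_def map_poly_pCons)
    ultimately show ?case by (simp only: pCons.IH inner)
  qed (simp add: eval_poly2_def flip: Zero_fract_def)
qed

lemma ratfun_eval_vars: "ratfun_eval r var1 var2 = r"
proof -
  have "ratfun_eval r var1 var2 = Fract (fst (quot_of_fract r)) 1 / Fract (snd (quot_of_fract r)) 1"
    by (simp add: ratfun_eval_def eval_poly2_vars)
  also have "\<dots> = Fract (fst (quot_of_fract r)) (snd (quot_of_fract r))"
    by (simp add: snd_quot_of_fract_nonzero)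
  finally show ?thesis by (simp add: Fract_quot_of_fract)
qed


section \<open>The coefficients of the logarithm\<close>

lemma xcoeff_xsum: "xcoeff (xsum F I) m = (\<Sum>i | i \<in> I \<and> xcoeff (F i) m \<noteq> 0. xcoeff (F i) m)"
  by (simp only: xsum_def xcoeff_Abs_xps)

text \<open>
  The restriction of \<open>F\<close> to a single variable.
\<close>

definition row_series :: "'a::comm_ring_1 xps \<Rightarrow> 'a fps" where
  "row_series F = Abs_fps (\<lambda>n. xcoeff F (replicate_mset n 0))"

text \<open>
  The restriction to \<open>x\<^sub>0\<close> of the derivative by \<open>x\<^sub>1\<close>, hence a derivation over \<open>row_series\<close>.
\<close>

definition hook_series :: "'a::comm_ring_1 xps \<Rightarrow> 'a fps" where
  "hook_series F = Abs_fps (\<lambda>n. xcoeff F (add_mset 1 (replicate_mset n 0)))"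

lemma replicate_mset_plus: "replicate_mset k x + replicate_mset l x = replicate_mset (k + l) x"
  by (rule multiset_eqI) auto

lemma add_eq_replicate_mset:
  assumes "a + b = replicate_mset n x"
  obtains k l where "a = replicate_mset k x" "b = replicate_mset l x" "k + l = n"
proof -
  have "set_mset (a + b) \<subseteq> {x}" unfolding assms by auto
  hence "set_mset a \<subseteq> {x}" "set_mset b \<subseteq> {x}" by simp_all
  note ab = this[THEN set_mset_subset_singletonD]
   have "size a + size b = n" using arg_cong[OF assms, of size] by simp
  with ab show ?thesis by (rule that)
qed

lemma row_series_mult: "row_series (F * G) = row_series F * row_series G"
proof (rule fps_ext)
  fix n
  have "{(a, b). a + b = replicate_mset n (0::nat)} = (\<lambda>k. (replicate_mset k 0, replicate_mset (n - k) 0)) ` {0..n}"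
    (is "?L = ?R")
  proof (rule Set.set_eqI, rule iffI)
    fix x assume "x \<in> ?L"
    then obtain a b where x: "x = (a, b)" "a + b = replicate_mset n 0" by auto
    obtain k l where kl: "a = replicate_mset k 0" "b = replicate_mset l 0" "k + l = n"
      using x(2) by (rule add_eq_replicate_mset)
    thus "x \<in> ?R" using x kl by auto
  qed (auto simp: replicate_mset_plus)
  moreover have "inj_on (\<lambda>k. (replicate_mset k (0::nat), replicate_mset (n - k) (0::nat))) {0..n}"
    by (rule inj_onI) (auto simp: replicate_mset_eq_iff)
  ultimately show "fps_nth (row_series (F * G)) n = fps_nth (row_series F * row_series G) n"
    by (simp add: row_series_def xcoeff_mult fps_mult_nth sum.reindex)
qed

lemma hook_series_mult: "hook_series (F * G) = hook_series F * row_series G + row_series F * hook_series G"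
proof (rule fps_ext)
  fix n
  let ?m = "add_mset (Suc 0) (replicate_mset n (0::nat))"
  let ?f = "\<lambda>k. (add_mset (Suc 0) (replicate_mset k 0), replicate_mset (n - k) (0::nat))"
  let ?g = "\<lambda>k. (replicate_mset k (0::nat), add_mset (Suc 0) (replicate_mset (n - k) 0))"
  have "{(a, b). a + b = ?m} = ?f ` {0..n} \<union> ?g ` {0..n}" (is "?L = ?R")
  proof (rule Set.set_eqI, rule iffI)
    fix x assume "x \<in> ?L"
    then obtain a b where x: "x = (a, b)" "a + b = ?m" by auto
    have "Suc 0 \<in># a + b" using x(2) by simp
    then consider a' where "a = add_mset (Suc 0) a'" | b' where "b = add_mset (Suc 0) b'"
      by (metis multi_member_split union_iff)
    thus "x \<in> ?R"
    proof cases
      case 1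
      hence eq: "a' + b = replicate_mset n 0" using x(2) by simp
      obtain k l where kl: "a' = replicate_mset k 0" "b = replicate_mset l 0" "k + l = n"
        using eq by (rule add_eq_replicate_mset)
      thus ?thesis using x kl 1 by auto
    next
      case 2
      hence eq: "a + b' = replicate_mset n 0" using x(2) by simp
      obtain k l where kl: "a = replicate_mset k 0" "b' = replicate_mset l 0" "k + l = n"
        using eq by (rule add_eq_replicate_mset)
      thus ?thesis using x kl 2 by auto
    qed
  qed (auto simp: replicate_mset_plus)
  moreover have "inj_on ?f {0..n}" "inj_on ?g {0..n}"
    by (rule inj_onI, auto simp: replicate_mset_eq_iff)+
  moreover have "?f ` {0..n} \<inter> ?g ` {0..n} = {}"
  proof -
    have "?f k \<noteq> ?g l" for k l
    proof
      assume "?f k = ?g l"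
      from arg_cong[OF this, of "\<lambda>x. count (fst x) (Suc 0)"] show False by simp
    qed
    thus ?thesis by blast
  qed
  ultimately show "fps_nth (hook_series (F * G)) n =
      fps_nth (hook_series F * row_series G + row_series F * hook_series G) n"
    by (simp add: row_series_def hook_series_def xcoeff_mult fps_mult_nth sum.reindex sum.union_disjoint)
qed

lemma row_series_power: "row_series (F ^ k) = row_series F ^ k"
proof (induction k)
  case 0
  show ?case by (rule fps_ext) (simp add: row_series_def)
qed (simp add: row_series_mult)

lemma hook_series_power: "hook_series (F ^ k) = of_nat k * row_series F ^ (k - 1) * hook_series F"
proof (induction k)
  case 0
  show ?case by (rule fps_ext) (simp add: hook_series_def)
next
  case (Suc k)
  have "hook_series (F ^ Suc k) =
      hook_series F * row_series F ^ k + row_series F * (of_nat k * row_series F ^ (k - 1) * hook_series F)"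
    by (simp add: hook_series_mult Suc.IH row_series_power)
  thus ?case by (cases k) (simp_all add: algebra_simps)
qed

lemma xcoeff_power_small:
  assumes "xcoeff F {#} = 0"
  shows "size m < k \<Longrightarrow> xcoeff (F ^ k) m = 0"
proof (induction k arbitrary: m)
  case (Suc k)
  have "xcoeff F a * xcoeff (F ^ k) b = 0" if "a + b = m" for a b
  proof (cases "a = {#}")
    case False
    hence "size b < k" using that Suc.prems by (auto simp: nonempty_has_size)
    thus ?thesis using Suc.IH by simp
  qed (simp add: assms)
  thus ?case by (auto simp: xcoeff_mult intro!: sum.neutral)
qed simp

lemma xcoeff_xlog:
  assumes "xcoeff F {#} = 1" "size m \<le> N"
  shows "xcoeff (xlog F) m = (\<Sum>k=1..N. (-1) ^ (k - 1) / of_nat k * xcoeff ((F - 1) ^ k) m)"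
proof -
  have "xcoeff (F - 1) {#} = 0" using assms by simp
  hence "xcoeff ((F - 1) ^ k) m = 0" if "N < k" for k
    using that assms(2) by (intro xcoeff_power_small) auto
  hence le: "k \<le> N" if "xcoeff ((F - 1) ^ k) m \<noteq> 0" for k
    using that by (meson not_le)
  show ?thesis
    unfolding xlog_def xcoeff_xsum
    by (intro sum.mono_neutral_cong_left) (use le in \<open>auto\<close>)
qed

text \<open>
  The derivative of a logarithm.  In the logarithm series the derivation produces a geometric series,
  which is truncated at the degree under consideration.
\<close>

lemma hook_series_xlog:
  assumes "xcoeff F {#} = 1"
  shows "hook_series (xlog F) * row_series F = hook_series F"
proof (rule fps_ext)
  fix n
  define A where "A = row_series (F - 1)"
  define S where "S = (\<Sum>k<Suc n. (- A) ^ k)"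
  have h1: "hook_series (F - 1) = hook_series F" by (rule fps_ext) (simp add: hook_series_def)
  have r1: "row_series F = 1 - (- A)"
    by (rule fps_ext) (auto simp: row_series_def A_def replicate_mset_eq_iff simp flip: fps_one_def)
  have log: "fps_nth (hook_series (xlog F)) j = fps_nth (S * hook_series F) j" if "j \<le> n" for j
  proof -
    have "fps_nth (hook_series (xlog F)) j =
        (\<Sum>k=1..Suc n. (-1) ^ (k - 1) / of_nat k * fps_nth (hook_series ((F - 1) ^ k)) j)"
      unfolding hook_series_def fps_nth_Abs_fps by (rule xcoeff_xlog[OF assms]) (use that in simp)
    also have "\<dots> = (\<Sum>k=1..Suc n. fps_nth ((- A) ^ (k - 1) * hook_series F) j)"
    proof (rule sum.cong [OF refl])
      fix k assume k: "k \<in> {1..Suc n}"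
      have 1: "hook_series ((F - 1) ^ k) = fps_const (of_nat k) * (A ^ (k - 1) * hook_series F)"
        unfolding hook_series_power h1 A_def by (simp add: fps_of_nat mult.assoc)
      have 2: "(- A) ^ (k - 1) * hook_series F = fps_const ((-1) ^ (k - 1)) * (A ^ (k - 1) * hook_series F)"
      proof -
        have "(- A) ^ (k - 1) = (-1) ^ (k - 1) * A ^ (k - 1)" by (rule power_minus)
        also have "(-1 :: 'a fps) ^ (k - 1) = fps_const ((-1) ^ (k - 1))"
          by (simp flip: fps_const_power fps_const_neg)
        finally show ?thesis by (simp only: mult.assoc)
      qed
      show "(-1) ^ (k - 1) / of_nat k * fps_nth (hook_series ((F - 1) ^ k)) j =
          fps_nth ((- A) ^ (k - 1) * hook_series F) j"
        unfolding 1 2 fps_mult_left_const_nth using k by simp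
    qed
    also have "\<dots> = (\<Sum>k<Suc n. fps_nth ((- A) ^ k * hook_series F) j)"
      by (rule sum.reindex_bij_witness[of _ Suc "\<lambda>k. k - 1"]) auto
    also have "\<dots> = fps_nth (S * hook_series F) j"
      by (simp add: S_def sum_distrib_right fps_sum_nth del: sum.lessThan_Suc)
    finally show ?thesis .
  qed
  have "trunc_eq n (hook_series (xlog F) * row_series F) (S * hook_series F * row_series F)"
    by (rule trunc_eq_mult) (auto simp: trunc_eq_def log)
  also have "S * hook_series F * row_series F = (1 - (- A) ^ Suc n) * hook_series F"
    unfolding r1 S_def one_diff_power_eq[of "- A" "Suc n"] by (simp only: mult_ac)
  also have "trunc_eq n \<dots> (1 * hook_series F)"
  proof (rule trunc_eq_mult)
    have "fps_nth A 0 = 0" using assms by (simp add: A_def row_series_def)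
    hence "fps_nth ((- A) ^ Suc n) j = 0" if "j \<le> n" for j
      using that by (intro startsby_zero_power_prefix[rule_format]) auto
    thus "trunc_eq n (1 - (- A) ^ Suc n) 1" by (simp add: trunc_eq_def del: power_Suc)
  qed simp
  finally show "fps_nth (hook_series (xlog F) * row_series F) n = fps_nth (hook_series F) n"
    by (simp add: trunc_eq_def)
qed

lemma xcoeff_xlog_degree_one:
  assumes "xcoeff F {#} = 1" "size m = 1"
  shows "xcoeff (xlog F) m = xcoeff F m"
proof -
  have "m \<noteq> {#}" using assms(2) by auto
  have "xcoeff (xlog F) m = (\<Sum>k=1..1. (-1) ^ (k - 1) / of_nat k * xcoeff ((F - 1) ^ k) m)"
    by (rule xcoeff_xlog[OF assms(1)]) (simp only: assms(2))
  thus ?thesis using \<open>m \<noteq> {#}\<close> by simp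
qed

text \<open>
  A variable with exponent 1 excludes the monomials in the image of the Adams operations with
  \<open>d \<ge> 2\<close>.
\<close>

lemma xcoeff_pleth_Log:
  assumes "count m i = 1"
  shows "xcoeff (pleth_Log F) m = xcoeff (xlog F) m"
proof -
  have ad: "xcoeff (adams d (xlog F)) m = (if d = 1 then xcoeff (xlog F) m else 0)" if "d \<ge> 1" for d
  proof (cases "d = 1")
    case True
    have "repeat_mset d a = a" for a :: "nat multiset"
      by (rule multiset_eqI) (simp add: True)
    hence "{a. repeat_mset d a = m} = {m}" by simp
    thus ?thesis by (simp add: adams_def True ratfun_eval_vars)
  next
    case False
    have "repeat_mset d a \<noteq> m" for a
    proof
      assume "repeat_mset d a = m"
      hence "count (repeat_mset d a) i = 1" by (simp only: assms)
      thus False using False by simp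
    qed
    hence "{a. repeat_mset d a = m} = {}" by blast
    hence "xcoeff (adams d (xlog F)) m = 0" unfolding adams_def xcoeff_Abs_xps by (simp only: sum.empty)
    thus ?thesis using False by (simp only: if_False)
  qed
  have "xcoeff (pleth_Log F) m = (\<Sum>d\<in>{1}. of_int (moebius d) / of_nat d * xcoeff (adams d (xlog F)) m)"
    unfolding pleth_Log_def xcoeff_xsum
  proof (rule sum.mono_neutral_cong_left)
    show "{d \<in> {1..}. xcoeff (xconst (of_int (moebius d) / of_nat d) * adams d (xlog F)) m \<noteq> 0} \<subseteq> {1}"
    proof
      fix d assume d: "d \<in> {d \<in> {1..}. xcoeff (xconst (of_int (moebius d) / of_nat d) * adams d (xlog F)) m \<noteq> 0}"
      hence "xcoeff (adams d (xlog F)) m \<noteq> 0" "1 \<le> d" by auto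
      thus "d \<in> {1}" using ad[of d] by (cases "d = 1") simp_all
    qed
  qed auto
  also have "\<dots> = xcoeff (xlog F) m"
  proof -
    have 1: "moebius 1 = 1" by (simp add: moebius_def)
    have "xcoeff (adams 1 (xlog F)) m = (if (1::nat) = 1 then xcoeff (xlog F) m else 0)"
      by (rule ad) (rule order_refl)
    hence 2: "xcoeff (adams 1 (xlog F)) m = xcoeff (xlog F) m" by (simp only: if_P)
    have "(\<Sum>d\<in>{1}. f d) = f 1" for f :: "nat \<Rightarrow> ratfun" by simp
    thus ?thesis by (simp only: 1 2 of_int_1 of_nat_1 div_by_1 mult_1_left)
  qed
  finally show ?thesis .
qed

section \<open>The Eisenstein side\<close>

lemma fps_to_fls_hom: "comm_ring_hom (fps_to_fls :: 'a::comm_ring_1 fps \<Rightarrow> 'a fls)"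
  by unfold_locales (auto simp: fls_times_fps_to_fls fps_to_fls_plus)

text \<open>
  Exchanging the order of the two power series variables respects the ring structure.  This allows
  transporting differential equations.
\<close>

lemma reorder_series_hom: "comm_ring_hom reorder_series"
proof
  interpret h: comm_ring_hom "fps_to_fls :: rat fps \<Rightarrow> rat fls" by (rule fps_to_fls_hom)
  fix F G :: "rat fps fps"
  show "reorder_series (F + G) = reorder_series F + reorder_series G"
  proof (rule fps_ext)
    fix n
    have "Abs_fps (\<lambda>k. fps_nth (fps_nth (F + G) k) n) =
        Abs_fps (\<lambda>k. fps_nth (fps_nth F k) n) + Abs_fps (\<lambda>k. fps_nth (fps_nth G k) n)"
      by (rule fps_ext) simp
    thus "fps_nth (reorder_series (F + G)) n = fps_nth (reorder_series F + reorder_series G) n"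
      by (simp add: reorder_series_def h.hom_add)
  qed
  show "reorder_series (F * G) = reorder_series F * reorder_series G"
  proof (rule fps_ext)
    fix n
    have "Abs_fps (\<lambda>k. fps_nth (fps_nth (F * G) k) n) =
        (\<Sum>j=0..n. Abs_fps (\<lambda>k. fps_nth (fps_nth F k) j) * Abs_fps (\<lambda>k. fps_nth (fps_nth G k) (n - j)))"
    proof (rule fps_ext)
      fix k
      have "fps_nth (fps_nth (F * G) k) n =
          (\<Sum>i=0..k. \<Sum>j=0..n. fps_nth (fps_nth F i) j * fps_nth (fps_nth G (k - i)) (n - j))"
        by (simp add: fps_mult_nth fps_sum_nth)
      also have "\<dots> = (\<Sum>j=0..n. \<Sum>i=0..k. fps_nth (fps_nth F i) j * fps_nth (fps_nth G (k - i)) (n - j))"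
        by (rule sum.swap)
      finally show "fps_nth (Abs_fps (\<lambda>k. fps_nth (fps_nth (F * G) k) n)) k =
          fps_nth (\<Sum>j=0..n. Abs_fps (\<lambda>k. fps_nth (fps_nth F k) j) * Abs_fps (\<lambda>k. fps_nth (fps_nth G k) (n - j))) k"
        by (simp add: fps_sum_nth fps_mult_nth)
    qed
    thus "fps_nth (reorder_series (F * G)) n = fps_nth (reorder_series F * reorder_series G) n"
      by (simp add: reorder_series_def fps_mult_nth[of "Abs_fps _"] h.hom_sum h.hom_mult)
  qed
next
  show "reorder_series 1 = 1"
  proof (rule fps_ext)
    fix n
    have "Abs_fps (\<lambda>k. fps_nth (fps_nth (1 :: rat fps fps) k) n) = (if n = 0 then 1 else 0)"
      by (rule fps_ext) auto
    thus "fps_nth (reorder_series 1) n = fps_nth 1 n" by (simp add: reorder_series_def)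
  qed
  show "reorder_series 0 = 0"
    by (rule fps_ext) (simp add: reorder_series_def fps_zero_def[symmetric])
qed

text \<open>
  The derivation \<open>T d/dT\<close>, acting on the coefficients of the powers of \<open>u\<close>.
\<close>

definition inner_deriv :: "rat fps fps \<Rightarrow> rat fps fps" where
  "inner_deriv F = Abs_fps (\<lambda>k. fps_X * fps_deriv (fps_nth F k))"

lemma inner_deriv_mult: "inner_deriv (F * G) = inner_deriv F * G + F * inner_deriv G"
proof (rule fps_ext)
  fix k
  have "fps_nth (inner_deriv (F * G)) k =
      (\<Sum>i=0..k. fps_X * fps_deriv (fps_nth F i) * fps_nth G (k - i) + fps_nth F i * (fps_X * fps_deriv (fps_nth G (k - i))))"
    by (simp add: inner_deriv_def fps_mult_nth fps_deriv_sum sum_distrib_left algebra_simps)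
  thus "fps_nth (inner_deriv (F * G)) k = fps_nth (inner_deriv F * G + F * inner_deriv G) k"
    by (simp add: inner_deriv_def fps_mult_nth sum.distrib)
qed

lemma inner_deriv_power: "inner_deriv (F ^ i) = of_nat i * F ^ (i - 1) * inner_deriv F"
proof (induction i)
  case 0
  show ?case by (rule fps_ext) (simp add: inner_deriv_def)
next
  case (Suc i)
  have "inner_deriv (F ^ Suc i) = inner_deriv F * F ^ i + F * (of_nat i * F ^ (i - 1) * inner_deriv F)"
    by (simp add: inner_deriv_mult Suc.IH)
  thus ?case by (cases i) (simp_all add: algebra_simps)
qed

lemma reorder_series_inner_deriv:
  "reorder_series (inner_deriv F) = fps_X * fps_deriv (reorder_series F)"
proof (rule fps_ext)
  fix n
  interpret h: comm_ring_hom "fps_to_fls :: rat fps \<Rightarrow> rat fls" by (rule fps_to_fls_hom)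
  have "Abs_fps (\<lambda>k. fps_nth (fps_nth (inner_deriv F) k) n) = of_nat n * Abs_fps (\<lambda>k. fps_nth (fps_nth F k) n)"
    by (rule fps_ext) (simp add: inner_deriv_def fps_X_deriv_nth fps_of_nat[symmetric])
  thus "fps_nth (reorder_series (inner_deriv F)) n = fps_nth (fps_X * fps_deriv (reorder_series F)) n"
    unfolding fps_X_deriv_nth by (simp add: reorder_series_def h.hom_mult h.hom_of_nat)
qed

definition exp_compose :: "rat fps fps \<Rightarrow> rat fps fps" where
  "exp_compose b = fps_compose (Abs_fps (\<lambda>k. fps_const (1 / fact k))) b"

text \<open>
  The exponential of a series without constant term is a finite sum in each degree, and the sum may
  be extended to any larger range.
\<close>

lemma exp_compose_nth:
  assumes "fps_nth b 0 = 0" "k \<le> N"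
  shows "fps_nth (exp_compose b) k = (\<Sum>i\<le>N. fps_const (1 / fact i) * fps_nth (b ^ i) k)"
proof -
  have "fps_nth (exp_compose b) k = (\<Sum>i=0..k. fps_const (1 / fact i) * fps_nth (b ^ i) k)"
    by (simp add: exp_compose_def fps_compose_nth)
  also have "\<dots> = (\<Sum>i\<le>N. fps_const (1 / fact i) * fps_nth (b ^ i) k)"
  proof (rule sum.mono_neutral_left)
    show "\<forall>i\<in>{..N} - {0..k}. fps_const (1 / fact i) * fps_nth (b ^ i) k = 0"
      using startsby_zero_power_prefix[OF assms(1)] by auto
  qed (use assms in auto)
  finally show ?thesis .
qed

lemma inner_deriv_exp_compose:
  assumes b: "fps_nth b 0 = 0"
  shows "inner_deriv (exp_compose b) = exp_compose b * inner_deriv b"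
proof (rule fps_ext)
  fix k
  have d0: "fps_nth (inner_deriv b) 0 = 0" by (simp add: inner_deriv_def b)
  have "fps_nth (inner_deriv (exp_compose b)) k = (\<Sum>i\<le>Suc k. fps_const (1 / fact i) * fps_nth (inner_deriv (b ^ i)) k)"
    by (simp only: inner_deriv_def fps_nth_Abs_fps exp_compose_nth[OF b, of k "Suc k"] le_SucI order_refl
        fps_deriv_sum fps_deriv_mult_const_left sum_distrib_left mult.left_commute)
  also have "\<dots> = (\<Sum>i\<le>Suc k. if i = 0 then 0 else fps_const (1 / fact (i - 1)) * fps_nth (b ^ (i - 1) * inner_deriv b) k)"
  proof (rule sum.cong [OF refl])
    fix i
    show "fps_const (1 / fact i) * fps_nth (inner_deriv (b ^ i)) k =
        (if i = 0 then 0 else fps_const (1 / fact (i - 1)) * fps_nth (b ^ (i - 1) * inner_deriv b) k)"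
    proof (cases i)
      case (Suc j)
      have "fps_nth (inner_deriv (b ^ i)) k = fps_const (of_nat i) * fps_nth (b ^ j * inner_deriv b) k"
      proof -
        have "of_nat i * (b ^ j * inner_deriv b) = fps_const (fps_const (of_nat i)) * (b ^ j * inner_deriv b)"
          by (simp only: fps_of_nat)
        hence "inner_deriv (b ^ i) = fps_const (fps_const (of_nat i)) * (b ^ j * inner_deriv b)"
          unfolding inner_deriv_power by (simp only: Suc diff_Suc_1 mult.assoc)
        thus ?thesis by (simp only: fps_mult_left_const_nth)
      qed
      moreover have "1 / fact i * of_nat i = (1 / fact j :: rat)"
        using of_nat_neq_0[of j, where ?'a = rat] by (simp add: Suc field_simps del: of_nat_Suc)
      ultimately show ?thesis by (simp add: Suc mult.assoc[symmetric] del: of_nat_Suc fact_Suc)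
    qed (simp add: inner_deriv_def)
  qed
  also have "\<dots> = (\<Sum>i\<le>k. fps_const (1 / fact i) * fps_nth (b ^ i * inner_deriv b) k)"
    by (simp add: sum.atMost_Suc_shift del: sum.atMost_Suc)
  also have "\<dots> = (\<Sum>i\<le>k. fps_const (1 / fact i) * (\<Sum>j=0..k. fps_nth (b ^ i) j * fps_nth (inner_deriv b) (k - j)))"
    by (simp only: fps_mult_nth)
  also have "\<dots> = (\<Sum>j=0..k. (\<Sum>i\<le>k. fps_const (1 / fact i) * fps_nth (b ^ i) j) * fps_nth (inner_deriv b) (k - j))"
    unfolding sum_distrib_left sum_distrib_right by (subst sum.swap) (simp only: mult.assoc)
  also have "\<dots> = (\<Sum>j=0..k. fps_nth (exp_compose b) j * fps_nth (inner_deriv b) (k - j))"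
    by (rule sum.cong) (auto simp: exp_compose_nth[OF b, of _ k])
  finally show "fps_nth (inner_deriv (exp_compose b)) k = fps_nth (exp_compose b * inner_deriv b) k"
    by (simp only: fps_mult_nth)
qed

text \<open>
  The factor \<open>(e\<^bsup>u/2\<^esup> - e\<^bsup>-u/2\<^esup>) / u = 2 sinh (u/2) / u\<close> of the right-hand side.
\<close>

definition sinh_series :: "rat fps" where
  "sinh_series = (fps_exp (1/2) - fps_exp (- 1/2)) / fps_X"

lemma rhs_exponent_0: "fps_nth rhs_exponent 0 = 0"
  by (simp add: rhs_exponent_def)

lemma rhs_series_alt:
  "rhs_series = Abs_fps (\<lambda>k. fps_const (fps_nth sinh_series k)) * exp_compose rhs_exponent"
  by (simp add: rhs_series_def sinh_series_def exp_compose_def)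

lemma inner_deriv_rhs_series: "inner_deriv rhs_series = inner_deriv rhs_exponent * rhs_series"
proof -
  have "inner_deriv (Abs_fps (\<lambda>k. fps_const (fps_nth sinh_series k))) = 0"
    by (rule fps_ext) (simp add: inner_deriv_def)
  thus ?thesis
    unfolding rhs_series_alt inner_deriv_mult inner_deriv_exp_compose[OF rhs_exponent_0]
    by (simp add: mult_ac)
qed

text \<open>
  The coefficients of the logarithmic derivative of
  \<open>\<Prod>\<^sub>n (1 - T\<^sup>n)\<^sup>2 / ((1 - q T\<^sup>n) (1 - T\<^sup>n / q))\<close> at \<open>q = exp u\<close>; up to the factor
  \<open>\<Prod>\<^sub>n (1 - T\<^sup>n)\<close> this product is the crank generating function of partitions.
\<close>

definition crank_weight :: "nat \<Rightarrow> rat fls" where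
  "crank_weight n = (\<Sum>d | d dvd n. of_nat d * (exp_u 1 ^ (n div d) + inverse (exp_u 1) ^ (n div d) - 2))"

lemma exp_u_add: "exp_u (a + b) = exp_u a * exp_u b"
  by (simp add: exp_u_def fps_exp_add_mult fls_times_fps_to_fls)

lemma exp_u_0 [simp]: "exp_u 0 = 1"
  by (simp add: exp_u_def)

lemma exp_u_power: "exp_u a ^ n = exp_u (of_nat n * a)"
  by (induction n) (simp_all add: exp_u_add[symmetric] algebra_simps)

lemma exp_u_nonzero [simp]: "exp_u a \<noteq> 0"
  by (simp add: exp_u_def)

lemma exp_u_inverse: "inverse (exp_u a) = exp_u (- a)"
  using exp_u_add[of a "- a"] by (simp add: inverse_unique)

lemma exp_u_inj: "exp_u a = exp_u b \<longleftrightarrow> a = b"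
proof
  assume "exp_u a = exp_u b"
  hence "fps_nth (fps_exp a) 1 = fps_nth (fps_exp b) 1" by (simp add: exp_u_def)
  thus "a = b" by simp
qed simp

text \<open>
  The coefficient of \<open>T\<^sup>n u\<^sup>k\<close> on the left is \<open>2/k! n \<Sum>\<^bsub>d|n\<^esub> d\<^bsup>k-1\<^esup>\<close>.  Replacing \<open>d\<close> by
  \<open>n/d\<close> turns it into \<open>2/k! \<Sum>\<^bsub>d|n\<^esub> d (n/d)\<^sup>k\<close>, and summing over even \<open>k\<close> gives exponentials.
\<close>

lemma log_series_crank: "reorder_series (inner_deriv rhs_exponent) = log_series crank_weight"
proof (rule fps_ext)
  fix n
  interpret h: comm_ring_hom "fps_to_fls :: rat fps \<Rightarrow> rat fls" by (rule fps_to_fls_hom)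
  show "fps_nth (reorder_series (inner_deriv rhs_exponent)) n = fps_nth (log_series crank_weight) n"
  proof (cases "n = 0")
    case True
    have "Abs_fps (\<lambda>k. fps_nth (fps_nth (inner_deriv rhs_exponent) k) 0) = 0"
      by (rule fps_ext) (simp add: inner_deriv_def)
    thus ?thesis using True by (simp add: reorder_series_def log_series_def)
  next
    case False
    have "Abs_fps (\<lambda>k. fps_nth (fps_nth (inner_deriv rhs_exponent) k) n) =
       (\<Sum>d | d dvd n. of_nat d * (fps_exp (of_nat (n div d)) + fps_exp (- of_nat (n div d)) - 2))"
    proof (rule fps_ext)
      fix k
      have "fps_nth (\<Sum>d | d dvd n. of_nat d * (fps_exp (of_nat (n div d)) + fps_exp (- of_nat (n div d)) - 2)) k =
        (\<Sum>d | d dvd n. of_nat d * (of_nat (n div d) ^ k / fact k + (- of_nat (n div d)) ^ k / fact k - (if k = 0 then 2 else 0 :: rat)))"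
        by (simp add: fps_sum_nth fps_of_nat[symmetric] numeral_fps_const)
      also have "\<dots> = (if even k \<and> k \<ge> 2 then 2 / fact k * (of_nat n * (\<Sum>d | d dvd n. of_nat d ^ (k - 1))) else 0)"
      proof (cases "even k \<and> k \<ge> 2")
        case True
        have "(\<Sum>d | d dvd n. of_nat d * (of_nat (n div d) ^ k / fact k + (- of_nat (n div d)) ^ k / fact k - (if k = 0 then 2 else 0 :: rat))) =
           (\<Sum>d | d dvd n. 2 / fact k * (of_nat d * of_nat (n div d) ^ k))"
          by (rule sum.cong) (use True in \<open>auto simp: field_simps\<close>)
        also have "\<dots> = (\<Sum>d | d dvd n. 2 / fact k * (of_nat n * of_nat d ^ (k - 1)))"
        proof (rule sum.reindex_bij_witness[of _ "\<lambda>d. n div d" "\<lambda>d. n div d"])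
          fix d assume "d \<in> {d. d dvd n}"
          then obtain e where e: "n = d * e" by auto
          hence de: "n div d = e" "d \<noteq> 0" using False by auto
          have "(of_nat e :: rat) ^ k = of_nat e * of_nat e ^ (k - 1)"
            using True by (metis power_eq_if not_numeral_le_zero)
          thus "2 / fact k * (of_nat n * of_nat (n div d) ^ (k - 1)) = 2 / fact k * (of_nat d * of_nat (n div d) ^ k :: rat)"
            unfolding de(1) by (simp add: e)
        qed (use False in auto)
        finally show ?thesis using True by (simp add: sum_distrib_left)
      next
        case k: False
        have "of_nat d * (of_nat (n div d) ^ k / fact k + (- of_nat (n div d)) ^ k / fact k - (if k = 0 then 2 else 0 :: rat)) = 0" for d
        proof (cases "k = 0")
          case False
          hence "odd k" using k by (metis One_nat_def Suc_leI gr0I le_neq_implies_less numeral_2_eq_2 odd_one)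
          thus ?thesis using False by simp
        qed simp
        hence "(\<Sum>d | d dvd n. of_nat d * (of_nat (n div d) ^ k / fact k + (- of_nat (n div d)) ^ k / fact k - (if k = 0 then 2 else 0 :: rat))) = 0"
          by (intro sum.neutral ballI)
        thus ?thesis by (simp only: k if_False)
      qed
      finally show "fps_nth (Abs_fps (\<lambda>k. fps_nth (fps_nth (inner_deriv rhs_exponent) k) n)) k =
          fps_nth (\<Sum>d | d dvd n. of_nat d * (fps_exp (of_nat (n div d)) + fps_exp (- of_nat (n div d)) - 2)) k"
        using False by (simp add: inner_deriv_def fps_X_deriv_nth rhs_exponent_def eisenstein_def)
    qed
    hence "fps_nth (reorder_series (inner_deriv rhs_exponent)) n =
       (\<Sum>d | d dvd n. of_nat d * (exp_u (of_nat (n div d)) + exp_u (- of_nat (n div d)) - 2))"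
      by (simp add: reorder_series_def h.hom_sum h.hom_mult h.hom_add h.hom_minus h.hom_of_nat h.hom_numeral exp_u_def)
    thus ?thesis using False
      by (simp add: log_series_def crank_weight_def exp_u_power exp_u_inverse)
  qed
qed

definition bernoulli_series :: "rat fps" where
  "bernoulli_series = fps_X / (fps_exp 1 - 1)"

lemma bernoulli_series_mult: "bernoulli_series * (fps_exp 1 - 1) = fps_X"
proof -
  have nz: "fps_exp 1 - 1 \<noteq> (0 :: rat fps)"
  proof
    assume "fps_exp 1 - 1 = (0 :: rat fps)"
    hence "fps_nth (fps_exp 1 - 1 :: rat fps) 1 = 0" by simp
    thus False by simp
  qed
  have "subdegree (fps_exp 1 - 1 :: rat fps) = 1"
    by (rule subdegreeI) auto
  hence "fps_exp 1 - 1 dvd (fps_X :: rat fps)" using nz by (simp add: fps_dvd_iff)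
  thus ?thesis unfolding bernoulli_series_def by (rule dvd_div_mult_self)
qed

lemma sinh_series_mult: "fps_X * sinh_series = fps_exp (1/2) - fps_exp (- 1/2)"
proof -
  have "fps_X dvd (fps_exp (1/2) - fps_exp (- 1/2) :: rat fps)"
  proof (cases "fps_exp (1/2) - fps_exp (- 1/2) = (0 :: rat fps)")
    case False
    hence "1 \<le> subdegree (fps_exp (1/2) - fps_exp (- 1/2) :: rat fps)"
      by (intro subdegree_geI) auto
    thus ?thesis using False by (simp add: fps_dvd_iff)
  qed simp
  thus ?thesis unfolding sinh_series_def by (metis dvd_mult_div_cancel)
qed

text \<open>
  The substitution \<open>u \<mapsto> -u\<close> changes \<open>u / (e\<^sup>u - 1)\<close> by adding \<open>u\<close>.
\<close>

lemma bernoulli_series_odd: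
  assumes "odd k"
  shows "fps_nth bernoulli_series k = (if k = 1 then - 1/2 else 0)"
proof -
  define \<sigma> :: "rat fps \<Rightarrow> rat fps" where "\<sigma> = (\<lambda>F. Abs_fps (\<lambda>n. (-1) ^ n * fps_nth F n))"
  have mult: "\<sigma> (F * G) = \<sigma> F * \<sigma> G" for F G
  proof (rule fps_ext)
    fix n
    have "(-1) ^ n * (\<Sum>i=0..n. fps_nth F i * fps_nth G (n - i)) =
       (\<Sum>i=0..n. ((-1) ^ i * fps_nth F i) * ((-1) ^ (n - i) * fps_nth G (n - i)))"
      unfolding sum_distrib_left
    proof (rule sum.cong [OF refl])
      fix i assume "i \<in> {0..n}"
      hence "(-1 :: rat) ^ n = (-1) ^ i * (-1) ^ (n - i)" by (simp flip: power_add)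
      thus "(-1) ^ n * (fps_nth F i * fps_nth G (n - i)) = ((-1) ^ i * fps_nth F i) * ((-1) ^ (n - i) * fps_nth G (n - i))"
        by simp
    qed
    thus "fps_nth (\<sigma> (F * G)) n = fps_nth (\<sigma> F * \<sigma> G) n" by (simp add: \<sigma>_def fps_mult_nth)
  qed
  have "\<sigma> (fps_exp 1 - 1) = fps_exp (-1) - 1" by (rule fps_ext) (auto simp: \<sigma>_def)
  moreover have "\<sigma> fps_X = - fps_X" by (rule fps_ext) (auto simp: \<sigma>_def fps_X_def)
  ultimately have 1: "\<sigma> bernoulli_series * (fps_exp (-1) - 1) = - fps_X"
    using mult[of bernoulli_series "fps_exp 1 - 1"] by (simp add: bernoulli_series_mult)
  have e: "fps_exp (-1) * fps_exp 1 = (1 :: rat fps)" by (simp flip: fps_exp_add_mult)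
  have "\<sigma> bernoulli_series * (fps_exp 1 - 1) = - (\<sigma> bernoulli_series * (fps_exp (-1) - 1)) * fps_exp 1"
    using e by (simp add: algebra_simps)
  also have "\<dots> = fps_X * fps_exp 1" by (simp only: 1 minus_minus)
  also have "\<dots> = (bernoulli_series + fps_X) * (fps_exp 1 - 1)"
    by (simp add: distrib_right bernoulli_series_mult) (simp add: algebra_simps)
  finally have "(\<sigma> bernoulli_series - (bernoulli_series + fps_X)) * (fps_exp 1 - 1) = 0" by (simp add: algebra_simps)
  moreover have "fps_exp 1 - 1 \<noteq> (0 :: rat fps)" using bernoulli_series_mult by auto
  ultimately have "\<sigma> bernoulli_series = bernoulli_series + fps_X" by simp
  hence "fps_nth (\<sigma> bernoulli_series) k = fps_nth (bernoulli_series + fps_X) k" by simp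
  thus ?thesis using assms by (auto simp: \<sigma>_def fps_X_def)
qed

text \<open>
  The constant terms of the Eisenstein series are such that \<open>L\<close>, the part of the exponent without
  \<open>T\<close>, satisfies \<open>u L' = 1 - u/2 - u / (e\<^sup>u - 1)\<close>.  The logarithmic derivative of \<open>2 sinh (u/2) / u\<close> is
  the negative of this, so the product has derivative zero.
\<close>

lemma sinh_exp_bernoulli:
  "sinh_series * fps_compose (fps_exp 1) (Abs_fps (\<lambda>k. fps_nth (fps_nth rhs_exponent k) 0)) = 1"
proof -
  define L where "L = Abs_fps (\<lambda>k. fps_nth (fps_nth rhs_exponent k) 0)"
  define G where "G = sinh_series * fps_compose (fps_exp 1) L"
  have L0: "fps_nth L 0 = 0" by (simp add: L_def rhs_exponent_def)
  have B0: "fps_nth bernoulli_series 0 = 1"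
  proof -
    have "fps_nth (bernoulli_series * (fps_exp 1 - 1)) 1 = 1" by (simp add: bernoulli_series_mult)
    thus ?thesis by (simp add: fps_mult_nth)
  qed
  have XL: "fps_X * fps_deriv L = - (bernoulli_series - 1 + fps_const (1/2) * fps_X)"
  proof (rule fps_ext)
    fix k
    show "fps_nth (fps_X * fps_deriv L) k = fps_nth (- (bernoulli_series - 1 + fps_const (1/2) * fps_X)) k"
    proof (cases "even k \<and> k \<ge> 2")
      case True
      hence "fps_nth (fps_X * fps_deriv L) k = - (fps_nth bernoulli_series k)"
        unfolding fps_X_deriv_nth
        by (simp add: L_def rhs_exponent_def eisenstein_def bernoulli_num_def bernoulli_series_def)
      thus ?thesis using True by (simp add: fps_X_def)
    next
      case False
      hence L: "fps_nth L k = 0" by (auto simp: L_def rhs_exponent_def)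
      have "k = 0 \<or> odd k" using False by (metis One_nat_def Suc_leI gr0I le_neq_implies_less numeral_2_eq_2 odd_one)
      thus ?thesis unfolding fps_X_deriv_nth L
        by (auto simp: B0 bernoulli_series_odd fps_X_def)
    qed
  qed
  have Xsinh: "fps_X * fps_deriv sinh_series = (bernoulli_series - 1 + fps_const (1/2) * fps_X) * sinh_series"
  proof -
    let ?a = "fps_exp (1/2) :: rat fps" and ?b = "fps_exp (- 1/2) :: rat fps"
    have ab: "?a * ?b = 1" "?a * ?a = fps_exp 1" by (simp_all flip: fps_exp_add_mult)
    have "fps_deriv (fps_X * sinh_series) = fps_const (1/2) * ?a + fps_const (1/2) * ?b"
      unfolding sinh_series_mult by (simp flip: fps_const_neg)
    hence 1: "fps_X * fps_deriv sinh_series = fps_const (1/2) * (?a + ?b) - sinh_series"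
      by (simp add: algebra_simps)
    have "bernoulli_series * (?a - ?b) = bernoulli_series * (fps_exp 1 - 1) * ?b"
    proof -
      have "(fps_exp 1 - 1) * ?b = ?a - ?b"
        unfolding ab(2)[symmetric] using ab(1) by (simp add: algebra_simps)
      thus ?thesis by (simp only: mult.assoc)
    qed
    hence 2: "bernoulli_series * (?a - ?b) = fps_X * ?b" by (simp only: bernoulli_series_mult)
    have h: "fps_const (1/2) * x + fps_const (1/2) * x = x" for x :: "rat fps"
      by (simp flip: distrib_right)
    have "fps_X * (fps_X * fps_deriv sinh_series) = fps_X * (fps_const (1/2) * (?a + ?b)) - fps_X * sinh_series"
      by (simp add: 1 right_diff_distrib)
    also have "fps_X * (fps_const (1/2) * (?a + ?b)) = fps_X * ?b + fps_X * (fps_const (1/2) * (?a - ?b))"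
    proof -
      have "fps_const (1/2) * (?a + ?b) = ?b + fps_const (1/2) * (?a - ?b)"
        using h[of ?b] by (simp add: distrib_left right_diff_distrib)
      thus ?thesis by (simp only: distrib_left)
    qed
    also have "fps_X * ?b + fps_X * (fps_const (1/2) * (?a - ?b)) - fps_X * sinh_series =
        (bernoulli_series - 1 + fps_const (1/2) * fps_X) * (fps_X * sinh_series)"
      unfolding 2[symmetric] sinh_series_mult by (simp add: algebra_simps)
    finally have "fps_X * (fps_X * fps_deriv sinh_series) =
        fps_X * ((bernoulli_series - 1 + fps_const (1/2) * fps_X) * sinh_series)"
      by (simp only: mult.left_commute)
    thus ?thesis by simp
  qed
  have "fps_X * fps_deriv G = fps_X * fps_deriv sinh_series * fps_compose (fps_exp 1) L +
      sinh_series * fps_compose (fps_exp 1) L * (fps_X * fps_deriv L)"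
    unfolding G_def by (simp add: fps_compose_deriv[OF L0] algebra_simps)
  also have "\<dots> = 0" unfolding XL Xsinh by (simp add: algebra_simps)
  finally have "fps_deriv G = 0" by simp
  hence "G = fps_const (fps_nth G 0)" by (simp add: fps_deriv_eq_0_iff)
  moreover have "fps_nth G 0 = 1"
  proof -
    have "fps_nth (fps_X * sinh_series) 1 = 1" unfolding sinh_series_mult by simp
    thus ?thesis by (simp add: G_def fps_compose_nth)
  qed
  ultimately show ?thesis by (simp add: G_def L_def)
qed

lemma reorder_rhs_series_0: "fps_nth (reorder_series rhs_series) 0 = 1"
proof -
  define c where "c = (\<lambda>F :: rat fps fps. Abs_fps (\<lambda>k. fps_nth (fps_nth F k) 0))"
  have mult: "c (F * G) = c F * c G" for F G
    by (rule fps_ext) (simp add: c_def fps_mult_nth fps_sum_nth)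
  have one: "c 1 = 1" by (rule fps_ext) (auto simp: c_def)
  have power: "c (F ^ i) = c F ^ i" for F i
    by (induction i) (auto simp: one mult)
  have "c (exp_compose rhs_exponent) = fps_compose (fps_exp 1) (c rhs_exponent)"
  proof (rule fps_ext)
    fix k
    have cn: "fps_nth (c F) k = fps_nth (fps_nth F k) 0" for F k by (simp add: c_def)
    have "fps_nth (c F ^ i) k = fps_nth (fps_nth (F ^ i) k) 0" for F i
      by (simp only: power[symmetric] cn)
    thus "fps_nth (c (exp_compose rhs_exponent)) k = fps_nth (fps_compose (fps_exp 1) (c rhs_exponent)) k"
      unfolding cn exp_compose_def fps_compose_nth fps_sum_nth by simp
  qed
  moreover have "c (Abs_fps (\<lambda>k. fps_const (fps_nth sinh_series k))) = sinh_series"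
    by (rule fps_ext) (simp add: c_def)
  ultimately have "c rhs_series = sinh_series * fps_compose (fps_exp 1) (c rhs_exponent)"
    unfolding rhs_series_alt mult by simp
  also have "\<dots> = 1" unfolding c_def by (rule sinh_exp_bernoulli)
  finally show ?thesis by (simp add: reorder_series_def c_def)
qed

lemma exp_series_reorder_rhs: "exp_series crank_weight (reorder_series rhs_series)"
proof -
  interpret comm_ring_hom reorder_series by (rule reorder_series_hom)
  have "fps_X * fps_deriv (reorder_series rhs_series) = log_series crank_weight * reorder_series rhs_series"
    unfolding reorder_series_inner_deriv[symmetric] inner_deriv_rhs_series hom_mult log_series_crank ..
  thus ?thesis by (simp add: exp_series_def reorder_rhs_series_0)
qed

lemma quasi_modular_sum: "(\<And>x. x \<in> A \<Longrightarrow> f x \<in> quasi_modular) \<Longrightarrow> sum f A \<in> quasi_modular"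
proof (induction A rule: infinite_finite_induct)
  case empty
  show ?case using quasi_modular.const[of 0] by simp
next
  case (infinite A)
  thus ?case using quasi_modular.const[of 0] by simp
qed (auto intro: quasi_modular.add)

lemma quasi_modular_rhs_series: "fps_nth rhs_series k \<in> quasi_modular"
proof -
  have E: "fps_nth rhs_exponent k \<in> quasi_modular" for k
    using quasi_modular.const[of 0]
    by (auto simp: rhs_exponent_def intro!: quasi_modular.mult quasi_modular.const quasi_modular.eisenstein)
  have P: "fps_nth (rhs_exponent ^ i) k \<in> quasi_modular" for i k
  proof (induction i arbitrary: k)
    case 0
    show ?case using quasi_modular.const[of 0] quasi_modular.const[of 1] by simp
  next
    case (Suc i)
    show ?case unfolding power_Suc fps_mult_nth
      by (intro quasi_modular_sum quasi_modular.mult E Suc.IH)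
  qed
  have "fps_nth (exp_compose rhs_exponent) k \<in> quasi_modular" for k
    unfolding exp_compose_nth[OF rhs_exponent_0 order_refl]
    by (intro quasi_modular_sum quasi_modular.mult quasi_modular.const P)
  thus ?thesis unfolding rhs_series_alt fps_mult_nth fps_nth_Abs_fps
    by (intro quasi_modular_sum quasi_modular.mult quasi_modular.const)
qed

lemma u_coeff_reorder_rhs: "u_coeff (reorder_series rhs_series) j \<in> quasi_modular"
proof (cases "j < 0")
  case True
  have "u_coeff (reorder_series rhs_series) j = fps_const 0"
    by (rule fps_ext) (use True in \<open>simp add: u_coeff_def reorder_series_def\<close>)
  thus ?thesis using quasi_modular.const by metis
next
  case False
  have "u_coeff (reorder_series rhs_series) j = fps_nth rhs_series (nat j)"
    by (rule fps_ext) (use False in \<open>simp add: u_coeff_def reorder_series_def\<close>)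
  thus ?thesis using quasi_modular_rhs_series by metis
qed

section \<open>The product formula for the exponential\<close>

lemma exp_series_factor:
  fixes c :: "'r::comm_ring_1"
  assumes "0 < n"
  shows "exp_series (\<lambda>k. if n dvd k then - (of_nat n * c ^ (k div n)) else 0) (1 - fps_const c * fps_X ^ n)"
proof -
  let ?a = "\<lambda>k. if n dvd k then - (of_nat n * c ^ (k div n)) else 0"
  have "fps_X * fps_deriv (1 - fps_const c * fps_X ^ n) = - (of_nat n * (fps_const c * fps_X ^ n))"
  proof (rule fps_ext)
    fix k
    show "fps_nth (fps_X * fps_deriv (1 - fps_const c * fps_X ^ n)) k = fps_nth (- (of_nat n * (fps_const c * fps_X ^ n))) k"
      unfolding fps_X_deriv_nth by (auto simp: fps_of_nat[symmetric])
  qed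
  moreover have "log_series ?a * (1 - fps_const c * fps_X ^ n) = - (of_nat n * (fps_const c * fps_X ^ n))"
  proof (rule fps_ext)
    fix k
    have "fps_nth (log_series ?a * (1 - fps_const c * fps_X ^ n)) k =
        fps_nth (log_series ?a) k - (if k < n then 0 else c * fps_nth (log_series ?a) (k - n))"
    proof -
      have "log_series ?a * (1 - fps_const c * fps_X ^ n) = log_series ?a - fps_const c * (fps_X ^ n * log_series ?a)"
        by (simp add: algebra_simps)
      thus ?thesis by (simp add: fps_X_power_mult_nth)
    qed
    also have "\<dots> = (if k = n then - (of_nat n * c) else 0)"
    proof (cases "n dvd k")
      case True
      then obtain j where j: "k = n * j" by auto
      consider "j = 0" | "j = 1" | i where "j = Suc (Suc i)" by (metis One_nat_def not0_implies_Suc)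
      thus ?thesis
      proof cases
        case 3
        have "k - n = n * Suc i" by (simp add: j 3)
        thus ?thesis using assms by (simp add: log_series_def j 3 mult_ac)
      qed (use assms in \<open>auto simp: log_series_def j\<close>)
    next
      case False
      hence "\<not> n dvd k - n" if "n \<le> k" using that by (simp add: dvd_diff_nat dvd_minus_self)
      thus ?thesis using False by (auto simp: log_series_def)
    qed
    also have "\<dots> = fps_nth (- (of_nat n * (fps_const c * fps_X ^ n))) k"
      by (simp add: fps_of_nat[symmetric])
    finally show "fps_nth (log_series ?a * (1 - fps_const c * fps_X ^ n)) k =
        fps_nth (- (of_nat n * (fps_const c * fps_X ^ n))) k" .
  qed
  ultimately show ?thesis using assms by (simp add: exp_series_def)
qed

lemma exp_series_1: "exp_series (\<lambda>_. 0) 1"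
  by (auto simp: exp_series_iff)

lemma exp_series_q_factors:
  "exp_series (\<lambda>k. \<Sum>n=1..N. if n dvd k then - (of_nat n * c ^ (k div n)) else 0) (q_factors c N)"
proof (induction N)
  case (Suc N)
  have "exp_series (\<lambda>k. (\<Sum>n=1..N. if n dvd k then - (of_nat n * c ^ (k div n)) else 0) +
      (if Suc N dvd k then - (of_nat (Suc N) * c ^ (k div Suc N)) else 0)) (q_factors c (Suc N))"
    unfolding q_factors_Suc by (rule exp_series_mult[OF Suc exp_series_factor]) simp
  thus ?case by (rule exp_series_cong) simp
qed (simp add: exp_series_1)

text \<open>
  Series with the same logarithmic derivative up to degree \<open>N\<close> agree up to degree \<open>N\<close>.  The truncation
  replaces convergence of the infinite products.
\<close>

lemma exp_series_trunc_eq: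
  fixes F G :: "'r::field_char_0 fps"
  assumes "exp_series a F" "exp_series b G" "\<And>k. 0 < k \<Longrightarrow> k \<le> N \<Longrightarrow> a k = b k"
  shows "trunc_eq N F G"
  unfolding trunc_eq_def
proof (intro allI impI)
  fix n assume "n \<le> N"
  thus "fps_nth F n = fps_nth G n"
  proof (induction n rule: less_induct)
    case (less n)
    show ?case
    proof (cases "n = 0")
      case False
      have "of_nat n * fps_nth F n = (\<Sum>r=1..n. a r * fps_nth F (n - r))"
        using assms(1) by (simp only: exp_series_iff)
      also have "\<dots> = (\<Sum>r=1..n. b r * fps_nth G (n - r))"
        by (rule sum.cong) (use less assms(3) False in auto)
      also have "\<dots> = of_nat n * fps_nth G n"
        using assms(2) by (simp only: exp_series_iff)
      finally show ?thesis using False by simp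
    qed (use assms in \<open>simp add: exp_series_iff\<close>)
  qed
qed

lemma rhs_series_product:
  "trunc_eq N (reorder_series rhs_series * (q_factors (exp_u 1) N * q_factors (inverse (exp_u 1)) N))
     (q_factors 1 N * q_factors 1 N)"
proof (rule exp_series_trunc_eq)
  let ?d = "\<lambda>c k. \<Sum>n=1..N. if n dvd k then - (of_nat n * c ^ (k div n)) else 0 :: rat fls"
  show "exp_series (\<lambda>k. crank_weight k + (?d (exp_u 1) k + ?d (inverse (exp_u 1)) k))
      (reorder_series rhs_series * (q_factors (exp_u 1) N * q_factors (inverse (exp_u 1)) N))"
    by (intro exp_series_mult exp_series_reorder_rhs exp_series_q_factors)
  show "exp_series (\<lambda>k. ?d 1 k + ?d 1 k) (q_factors 1 N * q_factors 1 N)"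
    by (intro exp_series_mult exp_series_q_factors)
  fix k assume k: "0 < k" "k \<le> N"
  have d: "?d c k = (\<Sum>n | n dvd k. - (of_nat n * c ^ (k div n)))" for c
  proof (rule sum.mono_neutral_cong_right)
    show "{n. n dvd k} \<subseteq> {1..N}"
    proof
      fix n assume "n \<in> {n. n dvd k}"
      hence "n dvd k" by simp
      hence "n \<le> k" "0 < n" using k by (auto intro: dvd_imp_le dvd_pos_nat)
      thus "n \<in> {1..N}" using k by simp
    qed
  qed auto
  show "crank_weight k + (?d (exp_u 1) k + ?d (inverse (exp_u 1)) k) = ?d 1 k + ?d 1 k"
    unfolding d crank_weight_def sum.distrib[symmetric]
    by (rule sum.cong) (auto simp: algebra_simps)
qed

section \<open>Specialization at inverse variables\<close>

abbreviation z_pt :: "rat fls" where "z_pt \<equiv> exp_u (1/2)"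
abbreviation w_pt :: "rat fls" where "w_pt \<equiv> exp_u (- 1/2)"

text \<open>
  This is why the hook function disappears at \<open>w = 1/z\<close>: numerator and denominator of each factor agree.
\<close>

lemma hook_factor_identity:
  fixes z w x y :: "'a::comm_ring_1"
  assumes "z * w = 1"
  shows "(z * x\<^sup>2 - w * y\<^sup>2)\<^sup>2 = (z\<^sup>2 * x\<^sup>2 - y\<^sup>2) * (x\<^sup>2 - w\<^sup>2 * y\<^sup>2)"
proof -
  have "(z * x\<^sup>2 - w * y\<^sup>2)\<^sup>2 = (z\<^sup>2 * x\<^sup>2 - y\<^sup>2) * (x\<^sup>2 - w\<^sup>2 * y\<^sup>2) + x\<^sup>2 * y\<^sup>2 * (z * w - 1)\<^sup>2"
    by (simp add: power2_eq_square algebra_simps)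
  thus ?thesis using assms by simp
qed

lemma power_split_double:
  fixes x :: "'a::comm_ring_1"
  shows "x ^ (2 * n + 1) = x * (x ^ n)\<^sup>2" "x ^ (2 * n + 2) = x\<^sup>2 * (x ^ n)\<^sup>2" "x ^ (2 * n) = (x ^ n)\<^sup>2"
  by (simp_all add: power_add power2_eq_square mult_2)

lemma hook_factor_eval:
  "ratfun_defined_at ((var1 ^ (2 * a + 1) - var2 ^ (2 * l + 1)) ^ 2 /
       ((var1 ^ (2 * a + 2) - var2 ^ (2 * l)) * (var1 ^ (2 * a) - var2 ^ (2 * l + 2)))) z_pt w_pt \<and>
   ratfun_eval ((var1 ^ (2 * a + 1) - var2 ^ (2 * l + 1)) ^ 2 /
       ((var1 ^ (2 * a + 2) - var2 ^ (2 * l)) * (var1 ^ (2 * a) - var2 ^ (2 * l + 2)))) z_pt w_pt = 1"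
proof -
  have v: "ratfun_defined_at (var1 ^ m) z_pt w_pt" "ratfun_eval (var1 ^ m) z_pt w_pt = z_pt ^ m"
    "ratfun_defined_at (var2 ^ m) z_pt w_pt" "ratfun_eval (var2 ^ m) z_pt w_pt = w_pt ^ m" for m
    using ratfun_eval_power[OF ratfun_eval_var(1), of m z_pt w_pt] ratfun_eval_power[OF ratfun_eval_var(3), of m z_pt w_pt]
    by (simp_all only: ratfun_eval_var simp_thms)
  have d: "ratfun_defined_at (var1 ^ m - var2 ^ k) z_pt w_pt" "ratfun_eval (var1 ^ m - var2 ^ k) z_pt w_pt = z_pt ^ m - w_pt ^ k" for m k
    using ratfun_eval_diff[OF v(1)[of m] v(3)[of k]] by (simp_all only: v)
  have num: "ratfun_defined_at ((var1 ^ (2 * a + 1) - var2 ^ (2 * l + 1)) ^ 2) z_pt w_pt"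
    "ratfun_eval ((var1 ^ (2 * a + 1) - var2 ^ (2 * l + 1)) ^ 2) z_pt w_pt = (z_pt ^ (2 * a + 1) - w_pt ^ (2 * l + 1)) ^ 2"
    using ratfun_eval_power[OF d(1)[of "2 * a + 1" "2 * l + 1"], of 2] by (simp_all only: d simp_thms)
  have den: "ratfun_defined_at ((var1 ^ (2 * a + 2) - var2 ^ (2 * l)) * (var1 ^ (2 * a) - var2 ^ (2 * l + 2))) z_pt w_pt"
    "ratfun_eval ((var1 ^ (2 * a + 2) - var2 ^ (2 * l)) * (var1 ^ (2 * a) - var2 ^ (2 * l + 2))) z_pt w_pt =
      (z_pt ^ (2 * a + 2) - w_pt ^ (2 * l)) * (z_pt ^ (2 * a) - w_pt ^ (2 * l + 2))"
    using ratfun_eval_mult[OF d(1)[of "2 * a + 2" "2 * l"] d(1)[of "2 * a" "2 * l + 2"]] by (simp_all only: d)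
  have nz: "z_pt ^ m - w_pt ^ k \<noteq> 0" if "m + k > 0" for m k
  proof
    assume "z_pt ^ m - w_pt ^ k = 0"
    hence "of_nat m * (1/2) = (of_nat k * (- 1/2) :: rat)" by (simp add: exp_u_power exp_u_inj)
    hence "of_nat (m + k) = (0 :: rat)" by (simp add: field_simps)
    thus False using that by (simp only: of_nat_eq_0_iff)
  qed
  have zw: "z_pt * w_pt = 1" by (simp flip: exp_u_add)
  have "z_pt ^ (2 * a + 1) = z_pt * (z_pt ^ a)\<^sup>2" "w_pt ^ (2 * l + 1) = w_pt * (w_pt ^ l)\<^sup>2"
    "z_pt ^ (2 * a + 2) = z_pt\<^sup>2 * (z_pt ^ a)\<^sup>2" "w_pt ^ (2 * l + 2) = w_pt\<^sup>2 * (w_pt ^ l)\<^sup>2"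
    "z_pt ^ (2 * a) = (z_pt ^ a)\<^sup>2" "w_pt ^ (2 * l) = (w_pt ^ l)\<^sup>2"
    by (rule power_split_double)+
  hence id: "(z_pt ^ (2 * a + 1) - w_pt ^ (2 * l + 1)) ^ 2 =
      (z_pt ^ (2 * a + 2) - w_pt ^ (2 * l)) * (z_pt ^ (2 * a) - w_pt ^ (2 * l + 2))"
    using hook_factor_identity[OF zw, of "z_pt ^ a" "w_pt ^ l"] by (simp only:)
  have den_nz: "(z_pt ^ (2 * a + 2) - w_pt ^ (2 * l)) * (z_pt ^ (2 * a) - w_pt ^ (2 * l + 2)) \<noteq> 0"
    using nz[of "2 * a + 2" "2 * l"] nz[of "2 * a" "2 * l + 2"] by (simp only: mult_eq_0_iff de_Morgan_disj) simp
  show ?thesis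
    using ratfun_eval_divide[OF num(1) den(1)] den_nz unfolding num(2) den(2) id
    by (simp only: divide_self not_False_eq_True simp_thms)
qed

lemma hook_function_eval:
  "ratfun_defined_at (hook_function \<mu>) z_pt w_pt \<and> ratfun_eval (hook_function \<mu>) z_pt w_pt = 1"
proof -
  note * = ratfun_eval_prod[of "cells \<mu>" "\<lambda>s. (var1 ^ (2 * arm \<mu> s + 1) - var2 ^ (2 * leg \<mu> s + 1)) ^ 2 /
       ((var1 ^ (2 * arm \<mu> s + 2) - var2 ^ (2 * leg \<mu> s)) *
        (var1 ^ (2 * arm \<mu> s) - var2 ^ (2 * leg \<mu> s + 2)))" z_pt w_pt]
  show ?thesis
    unfolding hook_function_def Let_def
    using * hook_factor_eval by (simp only: prod.neutral_const simp_thms)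
qed

context
  fixes Ht :: "nat list \<Rightarrow> ratfun xps"
  assumes Ht: "\<And>\<mu>. is_partition \<mu> \<Longrightarrow> is_modified_macdonald \<mu> (Ht \<mu>)"
begin

lemma xcoeff_Omega:
  "xcoeff (Omega Ht) m =
     (\<Sum>\<mu>\<in>partitions_of (size m). hook_function \<mu> * ratfun_eval (xcoeff (Ht \<mu>) m) (var1 ^ 2) (var2 ^ 2))"
proof -
  let ?F = "\<lambda>\<mu>. xconst (hook_function \<mu>) *
     Abs_xps (\<lambda>m. ratfun_eval (xcoeff (Ht \<mu>) m) (var1 ^ 2) (var2 ^ 2))"
  have F: "xcoeff (?F \<mu>) m = hook_function \<mu> * ratfun_eval (xcoeff (Ht \<mu>) m) (var1 ^ 2) (var2 ^ 2)" for \<mu>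
    by simp
  have sub: "\<mu> \<in> partitions_of (size m)" if "is_partition \<mu>" "xcoeff (?F \<mu>) m \<noteq> 0" for \<mu>
  proof -
    have "xcoeff (Ht \<mu>) m \<noteq> 0"
    proof
      assume "xcoeff (Ht \<mu>) m = 0"
      hence "xcoeff (?F \<mu>) m = 0" unfolding F by (simp only: ratfun_eval_const mult_zero_right)
      thus False using that by blast
    qed
    thus ?thesis using modified_macdonald_coefficients(1)[OF that(1) Ht[OF that(1)]] that(1)
      by (simp add: partitions_of_def)
  qed
  have "xcoeff (Omega Ht) m = (\<Sum>\<mu> | \<mu> \<in> {\<mu>. is_partition \<mu>} \<and> xcoeff (?F \<mu>) m \<noteq> 0. xcoeff (?F \<mu>) m)"
    unfolding Omega_def by (rule xcoeff_xsum)
  also have "\<dots> = (\<Sum>\<mu>\<in>partitions_of (size m). xcoeff (?F \<mu>) m)"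
  proof (rule sum.mono_neutral_left)
    show "{\<mu> \<in> {\<mu>. is_partition \<mu>}. xcoeff (?F \<mu>) m \<noteq> 0} \<subseteq> partitions_of (size m)"
      using sub by blast
    show "\<forall>\<mu>\<in>partitions_of (size m) - {\<mu> \<in> {\<mu>. is_partition \<mu>}. xcoeff (?F \<mu>) m \<noteq> 0}. xcoeff (?F \<mu>) m = 0"
      unfolding partitions_of_def by blast
  qed (rule finite_partitions_of)
  finally show ?thesis unfolding F .
qed

lemma row_series_Omega: "fps_nth (row_series (Omega Ht)) n = (\<Sum>\<mu>\<in>partitions_of n. hook_function \<mu>)"
proof -
  have "fps_nth (row_series (Omega Ht)) n = (\<Sum>\<mu>\<in>partitions_of n.
      hook_function \<mu> * ratfun_eval (xcoeff (Ht \<mu>) (replicate_mset n 0)) (var1 ^ 2) (var2 ^ 2))"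
    unfolding row_series_def fps_nth_Abs_fps xcoeff_Omega size_replicate_mset ..
  also have "\<dots> = (\<Sum>\<mu>\<in>partitions_of n. hook_function \<mu>)"
  proof (rule sum.cong [OF refl])
    fix \<mu> assume "\<mu> \<in> partitions_of n"
    hence \<mu>: "is_partition \<mu>" "sum_list \<mu> = n" by (auto simp: partitions_of_def)
    have "xcoeff (Ht \<mu>) (replicate_mset n 0) = 1"
      using modified_macdonald_coefficients(2)[OF \<mu>(1) Ht[OF \<mu>(1)]] \<mu>(2) by simp
    thus "hook_function \<mu> * ratfun_eval (xcoeff (Ht \<mu>) (replicate_mset n 0)) (var1 ^ 2) (var2 ^ 2) = hook_function \<mu>"
      by (simp only: ratfun_eval_const mult_1_right)
  qed
  finally show ?thesis .
qed

lemma hook_series_Omega: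
  "fps_nth (hook_series (Omega Ht)) n =
     (\<Sum>\<mu>\<in>partitions_of (Suc n). hook_function \<mu> * cell_sum (var1 ^ 2) (var2 ^ 2) \<mu>)"
proof -
  have "fps_nth (hook_series (Omega Ht)) n = (\<Sum>\<mu>\<in>partitions_of (Suc n).
      hook_function \<mu> * ratfun_eval (xcoeff (Ht \<mu>) (add_mset (Suc 0) (replicate_mset n 0))) (var1 ^ 2) (var2 ^ 2))"
    unfolding hook_series_def fps_nth_Abs_fps xcoeff_Omega size_add_mset size_replicate_mset One_nat_def ..
  also have "\<dots> = (\<Sum>\<mu>\<in>partitions_of (Suc n). hook_function \<mu> * cell_sum (var1 ^ 2) (var2 ^ 2) \<mu>)"
  proof (rule sum.cong [OF refl])
    fix \<mu> assume "\<mu> \<in> partitions_of (Suc n)"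
    hence \<mu>: "is_partition \<mu>" "sum_list \<mu> = Suc n" by (auto simp: partitions_of_def)
    have "xcoeff (Ht \<mu>) (add_mset (Suc 0) (replicate_mset n 0)) = cell_sum var1 var2 \<mu>"
      by (rule modified_macdonald_coefficients(3)[OF \<mu>(1) Ht[OF \<mu>(1)] \<mu>(2)])
    moreover have "ratfun_eval (cell_sum var1 var2 \<mu>) (var1 ^ 2) (var2 ^ 2) = cell_sum (var1 ^ 2) (var2 ^ 2) \<mu>"
      using ratfun_eval_cell_sum[OF ratfun_eval_var(1,3), where a = "var1 ^ 2" and b = "var2 ^ 2" and \<mu> = \<mu>]
      by (simp only: ratfun_eval_var simp_thms)
    ultimately show "hook_function \<mu> * ratfun_eval (xcoeff (Ht \<mu>) (add_mset (Suc 0) (replicate_mset n 0))) (var1 ^ 2) (var2 ^ 2) =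
        hook_function \<mu> * cell_sum (var1 ^ 2) (var2 ^ 2) \<mu>" by (simp only:)
  qed
  finally show ?thesis .
qed

lemma partitions_of_0: "partitions_of 0 = {[]}"
proof -
  have "\<mu> = []" if "\<mu> \<in> partitions_of 0" for \<mu>
  proof -
    have "0 \<notin> set \<mu>" "sum_list \<mu> = 0"
      using that by (simp_all only: partitions_of_def is_partition_def mem_Collect_eq simp_thms)
    hence "length \<mu> \<le> 0" using length_le_sum_list by metis
    thus ?thesis by simp
  qed
  moreover have "[] \<in> partitions_of 0" by (simp add: partitions_of_def is_partition_def)
  ultimately show ?thesis by blast
qed

lemma xcoeff_Omega_empty: "xcoeff (Omega Ht) {#} = 1"
proof -
  have "xcoeff (Omega Ht) {#} = fps_nth (row_series (Omega Ht)) 0"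
    by (simp add: row_series_def)
  also have "\<dots> = 1" unfolding row_series_Omega partitions_of_0
    by (simp add: hook_function_def cells_def)
  finally show ?thesis .
qed

lemma cell_sum_size_one:
  assumes "\<mu> \<in> partitions_of (Suc 0)"
  shows "cell_sum q t \<mu> = 1"
proof -
  have \<mu>: "0 \<notin> set \<mu>" "sum_list \<mu> = 1" using assms by (auto simp: partitions_of_def is_partition_def)
  then obtain a xs where a: "\<mu> = a # xs" by (cases \<mu>) auto
  have "0 < a" "a + sum_list xs = 1" using \<mu> by (simp_all add: a)
  hence "a = 1" "sum_list xs = 0" by linarith+
  moreover have "xs = []"
  proof -
    have "0 \<notin> set xs" using \<mu> a by simp
    hence "length xs \<le> 0" using length_le_sum_list calculation(2) by metis
    thus ?thesis by simp
  qed
  ultimately show ?thesis by (simp add: cell_sum_def a)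
qed

definition log_coeff :: "ratfun fps" where
  "log_coeff = hook_series (xlog (Omega Ht))"

text \<open>
  For \<open>n = 1\<close> the partition is \<open>(1)\<close> and the monomial is \<open>x\<^sub>0\<close> instead of \<open>x\<^sub>1\<close>; in degree 1 the
  two coefficients agree, since the cell sum of the partition \<open>(1)\<close> is 1.
\<close>

lemma HH_hook_partition:
  assumes "1 \<le> n"
  shows "HH Ht (hook_partition n) = (var1 ^ 2 - 1) * (1 - var2 ^ 2) * fps_nth log_coeff (n - 1)"
proof -
  have part: "is_partition (hook_partition n)"
    using assms by (auto simp: hook_partition_def is_partition_def)
  have "xcoeff (pleth_Log (Omega Ht)) (part_monomial (hook_partition n)) = fps_nth log_coeff (n - 1)"
  proof (cases "n = 1")
    case True
    have m: "part_monomial (hook_partition n) = replicate_mset (Suc 0) 0"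
      by (simp add: True hook_partition_def part_monomial_def lessThan_Suc)
    have "xcoeff (pleth_Log (Omega Ht)) (replicate_mset (Suc 0) 0) = xcoeff (xlog (Omega Ht)) (replicate_mset (Suc 0) 0)"
      by (rule xcoeff_pleth_Log[of _ 0]) simp
    also have "\<dots> = xcoeff (Omega Ht) (replicate_mset (Suc 0) 0)"
      by (rule xcoeff_xlog_degree_one[OF xcoeff_Omega_empty]) simp
    also have "\<dots> = fps_nth (row_series (Omega Ht)) (Suc 0)" by (simp only: row_series_def fps_nth_Abs_fps)
    also have "\<dots> = fps_nth (hook_series (Omega Ht)) 0"
      unfolding row_series_Omega hook_series_Omega by (rule sum.cong) (simp_all only: cell_sum_size_one mult_1_right)
    also have "\<dots> = xcoeff (Omega Ht) (add_mset 1 (replicate_mset 0 0))" by (simp only: hook_series_def fps_nth_Abs_fps)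
    also have "\<dots> = xcoeff (xlog (Omega Ht)) (add_mset 1 (replicate_mset 0 0))"
      by (rule xcoeff_xlog_degree_one[OF xcoeff_Omega_empty, symmetric]) simp
    also have "\<dots> = fps_nth log_coeff (n - 1)" unfolding log_coeff_def hook_series_def fps_nth_Abs_fps True by simp
    finally show ?thesis unfolding m .
  next
    case False
    have m: "part_monomial (hook_partition n) = add_mset 1 (replicate_mset (n - 1) 0)"
      using False by (simp add: hook_partition_def part_monomial_def)
    show ?thesis unfolding m log_coeff_def hook_series_def fps_nth_Abs_fps
      by (rule xcoeff_pleth_Log[of _ 1]) simp
  qed
  thus ?thesis unfolding HH_def by (simp only: hall_h_fun[OF part])
qed

text \<open>
  Solving the product \<open>hook_series_xlog\<close> for the last coefficient expresses \<open>log_coeff\<close> polynomially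
  in quantities that are defined at \<open>w = 1/z\<close>, so it is itself defined there and its values may be
  computed termwise.
\<close>

lemma log_coeff_recursion:
  "fps_nth log_coeff n = fps_nth (hook_series (Omega Ht)) n -
     (\<Sum>i<n. fps_nth log_coeff i * fps_nth (row_series (Omega Ht)) (n - i))"
proof -
  have "fps_nth (row_series (Omega Ht)) 0 = 1"
    using xcoeff_Omega_empty by (simp add: row_series_def)
  moreover have "fps_nth (hook_series (Omega Ht)) n =
      (\<Sum>i<n. fps_nth log_coeff i * fps_nth (row_series (Omega Ht)) (n - i)) +
      fps_nth log_coeff n * fps_nth (row_series (Omega Ht)) (n - n)"
    unfolding hook_series_xlog[OF xcoeff_Omega_empty, symmetric] log_coeff_def[symmetric] fps_mult_nth
    by (simp only: atLeast0AtMost lessThan_Suc_atMost[symmetric] sum.lessThan_Suc)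
  ultimately show ?thesis by (simp only: diff_self_eq_0 mult_1_right add_diff_cancel_left')
qed

definition log_value :: "rat fls fps" where
  "log_value = Abs_fps (\<lambda>n. ratfun_eval (fps_nth log_coeff n) z_pt w_pt)"

lemma z_pt_squared: "z_pt ^ 2 = exp_u 1" "w_pt ^ 2 = inverse (exp_u 1)"
  by (simp_all add: exp_u_power exp_u_inverse)

lemma row_series_eval:
  "ratfun_defined_at (fps_nth (row_series (Omega Ht)) n) z_pt w_pt \<and>
   ratfun_eval (fps_nth (row_series (Omega Ht)) n) z_pt w_pt = fps_nth partition_series n"
  unfolding row_series_Omega partition_series_def fps_nth_Abs_fps
  using ratfun_eval_sum[of "partitions_of n" hook_function z_pt w_pt] hook_function_eval
  by (simp only: simp_thms)

lemma hook_series_eval: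
  "ratfun_defined_at (fps_nth (hook_series (Omega Ht)) n) z_pt w_pt \<and>
   ratfun_eval (fps_nth (hook_series (Omega Ht)) n) z_pt w_pt =
     (\<Sum>\<mu>\<in>partitions_of (Suc n). cell_sum (exp_u 1) (inverse (exp_u 1)) \<mu>)"
proof -
  have v: "ratfun_defined_at (var1 ^ 2) z_pt w_pt" "ratfun_eval (var1 ^ 2) z_pt w_pt = exp_u 1"
    "ratfun_defined_at (var2 ^ 2) z_pt w_pt" "ratfun_eval (var2 ^ 2) z_pt w_pt = inverse (exp_u 1)"
    using ratfun_eval_power[OF ratfun_eval_var(1), of 2 z_pt w_pt] ratfun_eval_power[OF ratfun_eval_var(3), of 2 z_pt w_pt]
    by (simp_all only: ratfun_eval_var z_pt_squared simp_thms)
  have c: "ratfun_defined_at (cell_sum (var1 ^ 2) (var2 ^ 2) \<mu>) z_pt w_pt"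
    "ratfun_eval (cell_sum (var1 ^ 2) (var2 ^ 2) \<mu>) z_pt w_pt = cell_sum (exp_u 1) (inverse (exp_u 1)) \<mu>" for \<mu>
    using ratfun_eval_cell_sum[OF v(1,3), of \<mu>] by (simp_all only: v simp_thms)
  have "ratfun_defined_at (hook_function \<mu> * cell_sum (var1 ^ 2) (var2 ^ 2) \<mu>) z_pt w_pt \<and>
    ratfun_eval (hook_function \<mu> * cell_sum (var1 ^ 2) (var2 ^ 2) \<mu>) z_pt w_pt = cell_sum (exp_u 1) (inverse (exp_u 1)) \<mu>" for \<mu>
    using ratfun_eval_mult[OF conjunct1[OF hook_function_eval] c(1), of \<mu> \<mu>] hook_function_eval[of \<mu>]
    by (simp only: c mult_1_left simp_thms)
  thus ?thesis unfolding hook_series_Omega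
    using ratfun_eval_sum[of "partitions_of (Suc n)" "\<lambda>\<mu>. hook_function \<mu> * cell_sum (var1 ^ 2) (var2 ^ 2) \<mu>" z_pt w_pt]
    by (simp only: simp_thms)
qed

lemma log_coeff_defined: "ratfun_defined_at (fps_nth log_coeff n) z_pt w_pt"
proof (induction n rule: less_induct)
  case (less n)
  have "ratfun_defined_at (fps_nth log_coeff i * fps_nth (row_series (Omega Ht)) (n - i)) z_pt w_pt" if "i \<in> {..<n}" for i
    using ratfun_eval_mult(1)[OF less[of i]] row_series_eval that by simp
  hence "ratfun_defined_at (\<Sum>i<n. fps_nth log_coeff i * fps_nth (row_series (Omega Ht)) (n - i)) z_pt w_pt"
    by (rule conjunct1[OF ratfun_eval_sum])
  thus ?case unfolding log_coeff_recursion[of n]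
    using ratfun_eval_diff(1) hook_series_eval by blast
qed

lemma log_value_mult:
  "log_value * partition_series =
     Abs_fps (\<lambda>n. \<Sum>\<mu>\<in>partitions_of (Suc n). cell_sum (exp_u 1) (inverse (exp_u 1)) \<mu>)"
proof (rule fps_ext)
  fix n
  have d: "ratfun_defined_at (fps_nth log_coeff i * fps_nth (row_series (Omega Ht)) (n - i)) z_pt w_pt"
    "ratfun_eval (fps_nth log_coeff i * fps_nth (row_series (Omega Ht)) (n - i)) z_pt w_pt =
       fps_nth log_value i * fps_nth partition_series (n - i)" for i
    using ratfun_eval_mult[OF log_coeff_defined conjunct1[OF row_series_eval], of i "n - i"] row_series_eval[of "n - i"]
    by (simp_all only: log_value_def fps_nth_Abs_fps simp_thms)
  have "hook_series (Omega Ht) = log_coeff * row_series (Omega Ht)"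
    unfolding log_coeff_def by (rule hook_series_xlog[OF xcoeff_Omega_empty, symmetric])
  hence "fps_nth (hook_series (Omega Ht)) n = (\<Sum>i=0..n. fps_nth log_coeff i * fps_nth (row_series (Omega Ht)) (n - i))"
    by (simp only: fps_mult_nth)
  hence "ratfun_eval (fps_nth (hook_series (Omega Ht)) n) z_pt w_pt = fps_nth (log_value * partition_series) n"
    using ratfun_eval_sum[of "{0..n}" "\<lambda>i. fps_nth log_coeff i * fps_nth (row_series (Omega Ht)) (n - i)" z_pt w_pt]
    by (simp only: d fps_mult_nth simp_thms)
  thus "fps_nth (log_value * partition_series) n = fps_nth (Abs_fps (\<lambda>n. \<Sum>\<mu>\<in>partitions_of (Suc n). cell_sum (exp_u 1) (inverse (exp_u 1)) \<mu>)) n"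
    unfolding fps_nth_Abs_fps by (simp only: hook_series_eval)
qed

lemma HH_eval:
  assumes "1 \<le> n"
  shows "ratfun_defined_at (HH Ht (hook_partition n)) z_pt w_pt"
    "ratfun_eval (HH Ht (hook_partition n)) z_pt w_pt =
       (exp_u 1 - 1) * (1 - inverse (exp_u 1)) * fps_nth log_value (n - 1)"
proof -
  have v: "ratfun_defined_at (var1 ^ 2) z_pt w_pt" "ratfun_eval (var1 ^ 2) z_pt w_pt = exp_u 1"
    "ratfun_defined_at (var2 ^ 2) z_pt w_pt" "ratfun_eval (var2 ^ 2) z_pt w_pt = inverse (exp_u 1)"
    using ratfun_eval_power[OF ratfun_eval_var(1), of 2 z_pt w_pt] ratfun_eval_power[OF ratfun_eval_var(3), of 2 z_pt w_pt]
    by (simp_all only: ratfun_eval_var z_pt_squared simp_thms)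
  note a = ratfun_eval_diff[OF v(1) ratfun_eval_const(3)]
  note b = ratfun_eval_diff[OF ratfun_eval_const(3) v(3)]
  note ab = ratfun_eval_mult[OF a(1) b(1)]
  note abc = ratfun_eval_mult[OF ab(1) log_coeff_defined[of "n - 1"]]
  show "ratfun_defined_at (HH Ht (hook_partition n)) z_pt w_pt"
    unfolding HH_hook_partition[OF assms] by (rule abc(1))
  show "ratfun_eval (HH Ht (hook_partition n)) z_pt w_pt =
       (exp_u 1 - 1) * (1 - inverse (exp_u 1)) * fps_nth log_value (n - 1)"
    unfolding HH_hook_partition[OF assms] abc(2) ab(2) a(2) b(2) v ratfun_eval_const log_value_def fps_nth_Abs_fps ..
qed

text \<open>
  Since \<open>(z\<^sup>2 - 1) (1 - w\<^sup>2) = - (1 - q) (1 - 1/q)\<close>, the prefactor in \<open>HH\<close> completes the cell sums to the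
  eigenvalues.
\<close>

lemma lhs_series_average: "lhs_series Ht * partition_series = average_series (exp_u 1)"
proof -
  let ?q = "exp_u 1"
  let ?c = "(?q - 1) * (1 - inverse ?q)"
  have "lhs_series Ht = 1 + fps_X * (fps_const ?c * log_value)"
  proof (rule fps_ext)
    fix n
    show "fps_nth (lhs_series Ht) n = fps_nth (1 + fps_X * (fps_const ?c * log_value)) n"
      by (cases n) (simp_all add: lhs_series_def HH_eval(2)[simplified])
  qed
  hence "lhs_series Ht * partition_series =
      partition_series + fps_X * (fps_const ?c * (log_value * partition_series))"
    by (simp only: distrib_right mult_1_left mult.assoc)
  also have "\<dots> = average_series ?q"
  proof (rule fps_ext)
    fix n
    have e: "macdonald_eigenvalue ?q (inverse ?q) \<mu> = 1 + ?c * cell_sum ?q (inverse ?q) \<mu>" for \<mu>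
      by (simp add: macdonald_eigenvalue_def algebra_simps)
    show "fps_nth (partition_series + fps_X * (fps_const ?c * (log_value * partition_series))) n =
        fps_nth (average_series ?q) n"
    proof (cases n)
      case 0
      thus ?thesis
        by (simp add: partition_series_def average_series_def partitions_of_0 macdonald_eigenvalue_def cell_sum_def)
    next
      case (Suc k)
      have "fps_nth (fps_X * (fps_const ?c * (log_value * partition_series))) n =
          ?c * (\<Sum>\<mu>\<in>partitions_of n. cell_sum ?q (inverse ?q) \<mu>)"
        unfolding log_value_mult Suc by simp
      moreover have "fps_nth (average_series ?q) n =
          (\<Sum>\<mu>\<in>partitions_of n. 1) + ?c * (\<Sum>\<mu>\<in>partitions_of n. cell_sum ?q (inverse ?q) \<mu>)"
        unfolding average_series_def fps_nth_Abs_fps e sum.distrib sum_distrib_left ..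
      ultimately show ?thesis by (simp only: fps_add_nth partition_series_def fps_nth_Abs_fps)
    qed
  qed
  finally show ?thesis .
qed

lemma q_factors_nth_0: "fps_nth (q_factors c N) 0 = 1"
  by (induction N) (simp_all add: q_factors_Suc)

text \<open>
  Both sides agree modulo \<open>T\<^bsup>N+1\<^esup>\<close> for every \<open>N\<close>, because both become the same product after
  multiplication with the invertible series \<open>Q\<close>.
\<close>

lemma lhs_series_eq: "lhs_series Ht = reorder_series rhs_series"
proof (rule fps_ext)
  fix N
  let ?q = "exp_u 1"
  define Q where "Q = q_factors ?q N * q_factors (inverse ?q) N"
  define E :: "rat fls fps" where "E = q_factors 1 N"
  define F where "F = lhs_series Ht"
  define R where "R = reorder_series rhs_series"
  have avg: "trunc_eq N (Q * average_series ?q) E"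
    unfolding Q_def E_def by (rule average_series_product) simp
  have part: "trunc_eq N (E * partition_series) 1"
    unfolding E_def by (rule average_series_product[of ?q]) simp
  have "trunc_eq N (F * Q * (E * partition_series)) (F * Q * 1)"
    by (rule trunc_eq_mult[OF trunc_eq_refl part])
  hence "trunc_eq N (F * Q) (F * Q * (E * partition_series))"
    by (simp only: mult_1_right) (rule trunc_eq_sym)
  also have "F * Q * (E * partition_series) = Q * average_series ?q * E"
    unfolding lhs_series_average[symmetric] F_def by (simp only: mult_ac)
  also have "trunc_eq N \<dots> (E * E)"
    by (rule trunc_eq_mult[OF avg trunc_eq_refl])
  also have "trunc_eq N (E * E) (R * Q)"
    unfolding R_def Q_def E_def by (rule trunc_eq_sym[OF rhs_series_product])
  finally have "trunc_eq N (F * Q * inverse Q) (R * Q * inverse Q)"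
    by (rule trunc_eq_mult[OF _ trunc_eq_refl])
  moreover have "Q * inverse Q = 1"
    by (rule inverse_mult_eq_1') (simp add: Q_def q_factors_nth_0)
  ultimately have "trunc_eq N F R" by (simp only: mult.assoc mult_1_right)
  thus "fps_nth (lhs_series Ht) N = fps_nth (reorder_series rhs_series) N"
    by (simp add: trunc_eq_def F_def R_def)
qed

end

theorem corollary1p2p3:
  fixes Ht :: "nat list \<Rightarrow> ratfun xps"
  assumes "\<And>\<mu>. is_partition \<mu> \<Longrightarrow> is_modified_macdonald \<mu> (Ht \<mu>)"
  shows "(\<forall>n\<ge>1. ratfun_defined_at (HH Ht (hook_partition n)) (exp_u (1/2)) (exp_u (- 1/2))) \<and>
    lhs_series Ht = reorder_series rhs_series \<and>
    (\<forall>j. u_coeff (lhs_series Ht) j \<in> quasi_modular)"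
  using HH_eval(1)[OF assms] lhs_series_eq[OF assms] u_coeff_reorder_rhs by auto

end
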